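(* Let $\Omega_p$ be a nozzle satisfying (A1)–(A3) below. Suppose that $v_1^-=v_1^-(x_2)\in C^2([0,1])$ satisfies $$v_1^->0\ \text{in }[0,1]\quad\text{and}\quad (v_1^-)'(0)\le 0\le (v_1^-)'(1).$$ Then there exists a classical solution $(v,p)$, $v=(v_1,v_2)$, to the steady hydrostatic Euler equations $$v_1\partial_{x_1}v_1+v_2\partial_{x_2}v_1=-\partial_{x_1}p,\qquad 0=-\partial_{x_2}p,\qquad \partial_{x_1}v_1+\partial_{x_2}v_2=0\qquad\text{in }\Omega_p,$$ with $v\cdot\nu=0$ on $\partial\Omega_p$ and $$v_1(x_1,\cdot)\to v_1^-\ \text{ uniformly on any compact subset of }(0,1)\text{ as }x_1\to-\infty ,$$ which satisfies $v_1>0$ in $\overline{\Omega_p}$ and the far field behaviors $$(v_1,v_2)(x_1,\cdot)\to(v_1^-,0)\ \text{ uniformly on any compact subset of }(0,1)\text{ as }x_1\to-\infty,\qquad (\ast)$$ $$(v_1,v_2)(x_1,\cdot)\to(v_1^+,0)\ \text{ uniformly on any compact subset of }(a,a+\sigma)\text{ as }x_1\to+\infty,$$ where $v_1^+$ is uniquely determined by $v_1^-$ and $\sigma$ (up to the translation by $a$ of its domain). More precisely, $$v_1^+(x_2)=\frac{1}{\sigma}(\phi^\infty)'\!\left(\frac{x_2-a}{\sigma}\right),\quad x_2\in(a,a+\sigma),$$ where $\phi^\infty:[0,1]\to[0,\mathfrak{c}]$ satisfies $$(\phi^\infty)''=\sigma^2 f(\phi^\infty)\ \text{in }(0,1),\qquad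 \phi^\infty(0)=0,\quad\phi^\infty(1)=\mathfrak{c}.$$ Furthermore, the solution is unique (the pressure being determined up to an additive constant) in the class of classical solutions satisfying the boundary condition, $v_1>0$ in $\overline{\Omega_p}$, and $(\ast)$.
   Context: Nozzle: $\Omega_p:=\{(x_1,x_2): x_1\in\mathbb{R},\ s_0(x_1)<x_2<s_1(x_1)\}$, where $s_0,s_1:\mathbb{R}\to\mathbb{R}$ satisfy: (A1) $s_0,s_1\in C^2(\mathbb{R})$ with finite $C^2(\mathbb{R})$ norm (i.e. $s_i,s_i',s_i''$ are bounded), and $s_1(x_1)>s_0(x_1)$ for all $x_1\in\mathbb{R}$; (A2) $\lim_{x_1\to-\infty}(s_1(x_1),s_0(x_1))=(1,0)$; (A3) there exist constants $a\in\mathbb{R}$, $\sigma>0$ such that $\lim_{x_1\to+\infty}(s_1(x_1),s_0(x_1))=(a+\sigma,a)$. $\nu$ is the unit outward normal to $\partial\Omega_p$. Definitions: $\mathfrak{c}:=\int_0^1 v_1^-(\tau)\,d\tau$; $\kappa:[0,\mathfrak{c}]\to[0,1]$ is the inverse of the strictly increasing function $x_2\mapsto\int_0^{x_2}v_1^-(\tau)\,d\tau$; $f:[0,\mathfrak{c}]\to\mathbb{R}$, $f(\cdot):=(v_1^-)'(\kappa(\cdot))$. A classical solution is one for which $v_1,v_2,p$ and all the partial derivatives appearing in the system exist and are continuous on $\overline{\Omega_p}$, and the equations and boundary condition hold pointwise. *)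

theory Defs
  imports "HOL-Analysis.Analysis"
begin

text \<open>For \<open>S = {a..b}\<close> the derivatives at the endpoints are one-sided.\<close>

definition C2_on :: "real set \<Rightarrow> (real \<Rightarrow> real) \<Rightarrow> bool" where
  "C2_on S u \<longleftrightarrow>
     (\<exists>u' u''. (\<forall>x\<in>S. (u has_real_derivative u' x) (at x within S)) \<and>
               (\<forall>x\<in>S. (u' has_real_derivative u'' x) (at x within S)) \<and>
               continuous_on S u'')"

definition finite_C2_norm :: "(real \<Rightarrow> real) \<Rightarrow> bool" where
  "finite_C2_norm s \<longleftrightarrow>
     bounded (range s) \<and> bounded (range (deriv s)) \<and> bounded (range (deriv (deriv s)))"

definition nozzle :: "(real \<Rightarrow> real) \<Rightarrow> (real \<Rightarrow> real) \<Rightarrow> (real \<times> real) set" where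
  "nozzle s0 s1 = {(x1, x2). s0 x1 < x2 \<and> x2 < s1 x1}"

definition nozzle_conditions ::
    "(real \<Rightarrow> real) \<Rightarrow> (real \<Rightarrow> real) \<Rightarrow> real \<Rightarrow> real \<Rightarrow> bool" where
  "nozzle_conditions s0 s1 a \<sigma> \<longleftrightarrow>
     C2_on UNIV s0 \<and> finite_C2_norm s0 \<and> C2_on UNIV s1 \<and> finite_C2_norm s1 \<and>
     (\<forall>x1. s0 x1 < s1 x1) \<and>
     ((\<lambda>x1. (s1 x1, s0 x1)) \<longlongrightarrow> (1, 0)) at_bot \<and>
     \<sigma> > 0 \<and>
     ((\<lambda>x1. (s1 x1, s0 x1)) \<longlongrightarrow> (a + \<sigma>, a)) at_top"

text \<open>The unit outward normal at a point of the boundary, which consists of the graph of \<open>s0\<close>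
  (lower wall) and the graph of \<open>s1\<close> (upper wall). Only the values on the frontier matter.\<close>

definition nozzle_normal ::
    "(real \<Rightarrow> real) \<Rightarrow> (real \<Rightarrow> real) \<Rightarrow> real \<times> real \<Rightarrow> real \<times> real" where
  "nozzle_normal s0 s1 = (\<lambda>(x1, x2).
     if x2 = s0 x1
     then (1 / sqrt (1 + (deriv s0 x1)\<^sup>2)) *\<^sub>R (deriv s0 x1, - 1)
     else (1 / sqrt (1 + (deriv s1 x1)\<^sup>2)) *\<^sub>R (- deriv s1 x1, 1))"

text \<open>A partial derivative ``exists and is continuous on the closure of \<open>\<Omega>\<close>'' in the usual
  \<open>C\<^sup>1\<close>-up-to-the-boundary sense: it exists in \<open>\<Omega>\<close> and extends to a continuous function \<open>D\<close> on the
  closure. (A difference quotient inside the closure need not make sense at a boundary point: a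
  line parallel to an axis can meet the closure in that point only.)\<close>

definition has_cont_partial1 ::
    "(real \<times> real) set \<Rightarrow> (real \<times> real \<Rightarrow> real) \<Rightarrow> (real \<times> real \<Rightarrow> real) \<Rightarrow> bool" where
  "has_cont_partial1 \<Omega> u D \<longleftrightarrow>
     (\<forall>(x1, x2)\<in>\<Omega>. ((\<lambda>t. u (t, x2)) has_real_derivative D (x1, x2)) (at x1)) \<and>
     continuous_on (closure \<Omega>) D"

definition has_cont_partial2 ::
    "(real \<times> real) set \<Rightarrow> (real \<times> real \<Rightarrow> real) \<Rightarrow> (real \<times> real \<Rightarrow> real) \<Rightarrow> bool" where
  "has_cont_partial2 \<Omega> u D \<longleftrightarrow>
     (\<forall>(x1, x2)\<in>\<Omega>. ((\<lambda>t. u (x1, t)) has_real_derivative D (x1, x2)) (at x2)) \<and>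
     continuous_on (closure \<Omega>) D"

definition hydrostatic_Euler_solution ::
    "(real \<times> real) set \<Rightarrow> (real \<times> real \<Rightarrow> real \<times> real) \<Rightarrow> (real \<times> real \<Rightarrow> real) \<Rightarrow> bool" where
  "hydrostatic_Euler_solution \<Omega> v p \<longleftrightarrow>
     continuous_on (closure \<Omega>) v \<and> continuous_on (closure \<Omega>) p \<and>
     (\<exists>d1v1 d2v1 d2v2 d1p d2p.
        has_cont_partial1 \<Omega> (\<lambda>x. fst (v x)) d1v1 \<and>
        has_cont_partial2 \<Omega> (\<lambda>x. fst (v x)) d2v1 \<and>
        has_cont_partial2 \<Omega> (\<lambda>x. snd (v x)) d2v2 \<and>
        has_cont_partial1 \<Omega> p d1p \<and>
        has_cont_partial2 \<Omega> p d2p \<and>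
        (\<forall>x\<in>\<Omega>. fst (v x) * d1v1 x + snd (v x) * d2v1 x = - d1p x \<and>
                0 = - d2p x \<and>
                d1v1 x + d2v2 x = 0))"

definition slip_condition ::
    "(real \<Rightarrow> real) \<Rightarrow> (real \<Rightarrow> real) \<Rightarrow> (real \<times> real \<Rightarrow> real \<times> real) \<Rightarrow> bool" where
  "slip_condition s0 s1 v \<longleftrightarrow>
     (\<forall>x\<in>frontier (nozzle s0 s1). v x \<bullet> nozzle_normal s0 s1 x = 0)"

text \<open>For compact \<open>K \<subseteq> I\<close>, the slice \<open>{x1} \<times> K\<close> lies in the nozzle once \<open>\<bar>x1\<bar>\<close> is large (\<open>I\<close> being
  the limiting cross-section), so the values of \<open>w\<close> outside the nozzle are irrelevant.\<close>

definition far_field ::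
    "(real \<times> real \<Rightarrow> 'b::metric_space) \<Rightarrow> (real \<Rightarrow> 'b) \<Rightarrow> real set \<Rightarrow> real filter \<Rightarrow> bool" where
  "far_field w w\<^sub>0 I F \<longleftrightarrow>
     (\<forall>K. compact K \<and> K \<subseteq> I \<longrightarrow> uniform_limit K (\<lambda>x1 x2. w (x1, x2)) w\<^sub>0 F)"

definition flux :: "(real \<Rightarrow> real) \<Rightarrow> real" where
  "flux v1m = integral {0..1} v1m"

definition kappa :: "(real \<Rightarrow> real) \<Rightarrow> real \<Rightarrow> real" where
  "kappa v1m = inv_into {0..1} (\<lambda>x2. integral {0..x2} v1m)"

text \<open>The function \<open>f = (v1m)' \<circ> kappa\<close>, i.e. the upstream vorticity as a function of the stream
  function.\<close>

definition vort :: "(real \<Rightarrow> real) \<Rightarrow> real \<Rightarrow> real" where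
  "vort v1m z = vector_derivative v1m (at (kappa v1m z) within {0..1})"

definition downstream_stream_fun :: "(real \<Rightarrow> real) \<Rightarrow> real \<Rightarrow> (real \<Rightarrow> real) \<Rightarrow> bool" where
  "downstream_stream_fun v1m \<sigma> \<phi> \<longleftrightarrow>
     \<phi> \<in> {0..1} \<rightarrow> {0..flux v1m} \<and> continuous_on {0..1} \<phi> \<and>
     (\<forall>t\<in>{0<..<1}. \<phi> differentiable (at t) \<and>
        (deriv \<phi> has_real_derivative \<sigma>\<^sup>2 * vort v1m (\<phi> t)) (at t)) \<and>
     \<phi> 0 = 0 \<and> \<phi> 1 = flux v1m"

text \<open>The uniqueness class; there is no requirement as \<open>x1 \<rightarrow> +\<infinity>\<close>.\<close>

definition admissible_solution ::
    "(real \<Rightarrow> real) \<Rightarrow> (real \<Rightarrow> real) \<Rightarrow> (real \<Rightarrow> real) \<Rightarrow>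
     (real \<times> real \<Rightarrow> real \<times> real) \<Rightarrow> (real \<times> real \<Rightarrow> real) \<Rightarrow> bool" where
  "admissible_solution s0 s1 v1m v p \<longleftrightarrow>
     hydrostatic_Euler_solution (nozzle s0 s1) v p \<and>
     slip_condition s0 s1 v \<and>
     (\<forall>x\<in>closure (nozzle s0 s1). 0 < fst (v x)) \<and>
     far_field v (\<lambda>x2. (v1m x2, 0)) {0<..<1} at_bot"

end

theory Submission
  imports Defs
begin

text \<open>Write \<open>m\<close> for the incoming profile. The pressure depends on \<open>x1\<close> only, and \<open>v1\<^sup>2 / 2 + p\<close> is
  constant along streamlines. Label a streamline by the height \<open>\<tau> \<in> [0, 1]\<close> at which it starts far
  upstream. Then in the cross-section at \<open>x1\<close> its horizontal speed is \<open>sqrt ((m \<tau>)\<^sup>2 + \<lambda>)\<close>, with one number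
  \<open>\<lambda>\<close> for the whole section (twice the pressure drop from upstream). The flux \<open>m \<tau> d\<tau>\<close> between neighbouring
  streamlines is conserved, so the streamline \<open>\<tau>\<close> runs at height
  \<open>\<integral>\<^sub>0\<^sup>\<tau> m s / sqrt ((m s)\<^sup>2 + \<lambda>) ds\<close> above the lower wall. For \<open>\<tau> = 1\<close> this must be the width of the section,
  which determines \<open>\<lambda>\<close>: the width is a strictly decreasing function of \<open>\<lambda>\<close> on \<open>(- min m\<^sup>2, \<infinity>)\<close> and takes every
  positive value (\<open>width_attained\<close>). Here the sign conditions on \<open>m'\<close> at the walls enter. They force \<open>m' = 0\<close> at a minimum point of \<open>m\<close>, so that \<open>m\<^sup>2 - min m\<^sup>2\<close> vanishes to second
  order there and the width integral diverges as \<open>\<lambda>\<close> decreases to \<open>- min m\<^sup>2\<close> (\<open>width_unbounded\<close>).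

  Hence the solution is explicit, and no differential equation has to be solved. With \<open>\<lambda>\<close> and the height above the
  lower wall as variables, the label, the speed and the slope of the streamlines are obtained by inverting a strictly
  increasing function on every fibre (\<open>has_derivative_fibre_inverse\<close>). The equations follow by differentiation
  (\<open>v_solution\<close>). The far field behaviour is continuous dependence on \<open>\<lambda>\<close>, together with the fact that the slopes of
  the walls tend to zero (\<open>derivative_tendsto_0\<close>).

  For uniqueness the same argument is run for an arbitrary solution. After the nozzle has been straightened to a strip,
  the stream function \<open>\<Psi>\<close> has the expected partial derivatives up to the walls (\<open>\<Psi>_DERIV_x\<close>). Its level lines are
  the streamlines, and \<open>v1\<^sup>2 / 2 + p\<close> is constant on them (\<open>bernoulli\<close>). The convergence far upstream is only locally
  uniform in the open section, so flux might a priori concentrate at the walls. This is excluded because the Bernoulli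
  quantity is bounded on the single section \<open>x1 = 0\<close>, hence everywhere, which bounds \<open>v1\<close> upstream
  (\<open>w1_bounded_upstream\<close>). Dominated convergence then gives the flux and the Bernoulli quantity in terms of \<open>m\<close>
  (\<open>total_flux\<close>, \<open>bernoulli_on_stream\<close>), and the width condition identifies \<open>\<lambda>\<close> and with it the flow (\<open>flow_unique\<close>).

  The downstream problem \<open>\<phi>'' = \<sigma>\<^sup>2 f \<phi>\<close> has the first integral \<open>\<phi>'\<^sup>2 = \<sigma>\<^sup>2 (m\<^sup>2 + \<lambda>)\<close>, with \<open>m\<close> evaluated at the label of
  \<open>\<phi>\<close>. If \<open>\<lambda> \<le> - min m\<^sup>2\<close>, a Gronwall argument would make \<open>\<phi>\<close> constant, against its boundary values. Otherwise \<open>\<phi>\<close> is increasing and the width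
  condition fixes \<open>\<lambda>\<close> again (\<open>downstream_unique\<close>).\<close>

section \<open>Calculus of two variables\<close>

lemma continuous_on_slice:
  assumes "continuous_on (U \<times> T) (\<lambda>(x, t). f x t)"
  shows "x \<in> U \<Longrightarrow> continuous_on T (f x)" "t \<in> T \<Longrightarrow> continuous_on U (\<lambda>x. f x t)"
proof -
  show "continuous_on T (f x)" if "x \<in> U"
  proof -
    have "continuous_on T (\<lambda>t. (\<lambda>(x, t). f x t) (x, t))"
      by (rule continuous_on_compose2[OF assms]) (use that in \<open>auto intro!: continuous_intros\<close>)
    then show ?thesis by simp
  qed
  show "continuous_on U (\<lambda>x. f x t)" if "t \<in> T"
  proof -
    have "continuous_on U (\<lambda>x. (\<lambda>(x, t). f x t) (x, t))"
      by (rule continuous_on_compose2[OF assms]) (use that in \<open>auto intro!: continuous_intros\<close>)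
    then show ?thesis by simp
  qed
qed

lemma continuous_on_compose_fst: "continuous_on UNIV f \<Longrightarrow> continuous_on A (\<lambda>z. f (fst z))"
  by (rule continuous_on_compose2[of UNIV]) (auto intro: continuous_intros)

text \<open>Increments in \<open>y\<close> are controlled near the point by continuity of \<open>D2\<close>, those in \<open>x\<close> by the derivative at the
  point itself. A box inside the open set supplies the product structure.\<close>

lemma has_derivative_from_partials:
  fixes f :: "real \<times> real \<Rightarrow> real"
  assumes "open \<Omega>" "(x, y) \<in> \<Omega>"
    and fx: "((\<lambda>t. f (t, y)) has_real_derivative D1) (at x)"
    and fy: "\<And>x y. (x, y) \<in> \<Omega> \<Longrightarrow> ((\<lambda>t. f (x, t)) has_real_derivative D2 (x, y)) (at y)"
    and cont: "continuous_on \<Omega> D2"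
  shows "(f has_derivative (\<lambda>(h, k). D1 * h + D2 (x, y) * k)) (at (x, y))"
proof -
  obtain A B where AB: "open A" "open B" "x \<in> A" "y \<in> B" "A \<times> B \<subseteq> \<Omega>"
    using open_prod_elim[OF assms(1,2)] by (metis mem_Sigma_iff)
  obtain e where e: "e > 0" "ball y e \<subseteq> B"
    using AB openE by blast
  define Y where "Y = ball y e"
  have sub: "A \<times> Y \<subseteq> \<Omega>" using AB e by (auto simp: Y_def)
  have op: "open (A \<times> Y)" "(x, y) \<in> A \<times> Y"
    using AB e by (auto simp: Y_def open_Times)
  have "((\<lambda>(x, y). f (x, y)) has_derivative
      (\<lambda>(tx, ty). (*) D1 tx + blinfun_apply (blinfun_mult_right (D2 (x, y))) ty)) (at (x, y) within A \<times> Y)"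
  proof (rule has_derivative_partialsI)
    show "((\<lambda>x. f (x, y)) has_derivative (*) D1) (at x within A)"
      using fx by (simp add: has_field_derivative_def has_derivative_at_withinI)
    show "((\<lambda>y. f (x, y)) has_derivative blinfun_apply (blinfun_mult_right (D2 (x, y)))) (at y within Y)"
      if "x \<in> A" "y \<in> Y" for x y
    proof -
      have "((\<lambda>t. f (x, t)) has_real_derivative D2 (x, y)) (at y within Y)"
        using fy[of x y] that sub by (auto intro: DERIV_subset)
      then show ?thesis by (simp add: has_field_derivative_def)
    qed
    have "continuous_on (A \<times> Y) (\<lambda>p. blinfun_mult_right (D2 p))"
      by (intro continuous_intros continuous_on_subset[OF cont sub])
    then show "continuous (at (x, y) within A \<times> Y) (\<lambda>(x, y). blinfun_mult_right (D2 (x, y)))"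
      using op by (auto simp: continuous_on_eq_continuous_within case_prod_unfold)
  qed (use op in \<open>auto simp: Y_def\<close>)
  then show ?thesis
    using at_within_open[OF op(2,1)] by (simp add: case_prod_beta)
qed

lemma DERIV_along_curve:
  fixes f :: "real \<times> real \<Rightarrow> real"
  assumes "(f has_derivative (\<lambda>(h, k). P * h + Q * k)) (at (a t, b t))"
    and "(a has_real_derivative a') (at t)" "(b has_real_derivative b') (at t)"
  shows "((\<lambda>t. f (a t, b t)) has_real_derivative P * a' + Q * b') (at t)"
proof -
  have "((\<lambda>t. (a t, b t)) has_derivative (\<lambda>h. (a' * h, b' * h))) (at t)"
    using assms(2,3) by (auto simp: has_field_derivative_def intro!: has_derivative_Pair)
  from has_derivative_compose[OF this assms(1)]
  show ?thesis
    unfolding has_field_derivative_def by (rule has_derivative_eq_rhs) (auto simp: algebra_simps)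
qed

text \<open>Scaling \<open>{0..t}\<close> to the fixed interval \<open>{0..1}\<close> turns the variable upper limit into a parameter of the integrand,
  so that continuity of parameter integrals applies.\<close>

lemma continuous_on_integral_upto:
  fixes k :: "real \<Rightarrow> real \<Rightarrow> real"
  assumes "continuous_on (U \<times> {0..1}) (\<lambda>(x, t). k x t)"
  shows "continuous_on (U \<times> {0..1}) (\<lambda>(x, t). integral {0..t} (k x))"
proof -
  have kx: "continuous_on {0..1} (k x)" if "x \<in> U" for x
    using continuous_on_slice(1)[OF assms that] .
  have eq: "integral {0..t} (k x) = t * integral {0..1} (\<lambda>s. k x (t * s))"
    if "x \<in> U" "t \<in> {0..1}" for x t
  proof -
    have sub: "(\<lambda>s. t * s) ` {0..1} \<subseteq> {0..1}"
      using that by (auto simp: mult_le_one)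
    have "((\<lambda>s. t *\<^sub>R k x (t * s)) has_integral integral {t * 0..t * 1} (k x)) {0..1}"
      by (rule has_integral_substitution[where c = 0 and d = 1])
         (use that sub in \<open>auto intro!: kx derivative_eq_intros\<close>)
    from integral_unique[OF this] show ?thesis by simp
  qed
  have "continuous_on (U \<times> {0..1}) (\<lambda>p. snd p * integral (cbox 0 1) (\<lambda>s. k (fst p) (snd p * s)))"
  proof (intro continuous_on_mult continuous_on_snd continuous_on_id integral_continuous_on_param)
    have "continuous_on ((U \<times> {0..1}) \<times> {0..1}) (\<lambda>q. (\<lambda>(x, t). k x t) (fst (fst q), snd (fst q) * snd q))"
      by (rule continuous_on_compose2[OF assms])
        (auto intro!: continuous_intros simp: mult_le_one)
    then show "continuous_on ((U \<times> {0..1}) \<times> cbox 0 1) (\<lambda>(p, s). k (fst p) (snd p * s))"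
      by (simp add: case_prod_beta)
  qed
  then show ?thesis
    by (rule continuous_on_eq) (auto simp: eq)
qed

text \<open>The derivatives of a solution are only given inside the nozzle. In integrated form,
  \<open>g b t = g a t + \<integral> D x t dx\<close>, the relation passes to the limit \<open>t \<rightarrow> 0, 1\<close>, and can be differentiated again there.\<close>

lemma partial_extends_to_closed_strip:
  fixes g D :: "real \<Rightarrow> real \<Rightarrow> real"
  assumes g: "continuous_on (UNIV \<times> {0..1}) (\<lambda>(x, t). g x t)"
    and D: "continuous_on (UNIV \<times> {0..1}) (\<lambda>(x, t). D x t)"
    and der: "\<And>x t. t \<in> {0<..<1} \<Longrightarrow> ((\<lambda>x. g x t) has_real_derivative D x t) (at x)"
    and t: "t \<in> {0..1}"
  shows "((\<lambda>x. g x t) has_real_derivative D x t) (at x)"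
proof -
  have gt: "continuous_on {0..1} (g x)" for x
    using continuous_on_slice(1)[OF g] by simp
  have Dx: "continuous_on UNIV (\<lambda>x. D x t)" if "t \<in> {0..1}" for t
    using continuous_on_slice(2)[OF D that] .
  have eq: "g b t = g a t + integral {a..b} (\<lambda>x. D x t)" if "a \<le> b" for a b
  proof -
    have cl: "closure {0<..<1::real} = {0..1}" by simp
    have "continuous_on {0..1} (\<lambda>t. integral (cbox a b) (\<lambda>x. D x t))"
    proof (rule integral_continuous_on_param)
      have "continuous_on ({0..1} \<times> cbox a b) (\<lambda>q. (\<lambda>(x, t). D x t) (snd q, fst q))"
        by (rule continuous_on_compose2[OF D]) (auto intro!: continuous_intros)
      then show "continuous_on ({0..1} \<times> cbox a b) (\<lambda>(t, x). D x t)"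
        by (simp add: case_prod_beta)
    qed
    then have c: "continuous_on (closure {0<..<1}) (\<lambda>t. g b t - g a t - integral {a..b} (\<lambda>x. D x t))"
      by (auto intro!: continuous_intros gt simp: cl)
    have z: "g b s - g a s - integral {a..b} (\<lambda>x. D x s) = 0" if "s \<in> {0<..<1}" for s
    proof -
      have "((\<lambda>x. D x s) has_integral g b s - g a s) {a..b}"
        using der[OF that] \<open>a \<le> b\<close>
        by (intro fundamental_theorem_of_calculus)
           (auto simp: has_real_derivative_iff_has_vector_derivative[symmetric] intro: has_field_derivative_at_within)
      then show ?thesis by (simp add: integral_unique)
    qed
    have "g b t - g a t - integral {a..b} (\<lambda>x. D x t) = 0"
    proof (rule continuous_constant_on_closure[OF c])
      show "g b s - g a s - integral {a..b} (\<lambda>x. D x s) = 0" if "s \<in> {0<..<1}" for s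
        by (rule z[OF that])
      show "t \<in> closure {0<..<1}" using t unfolding cl .
    qed
    then show ?thesis by linarith
  qed
  have "((\<lambda>u. g (x - 1) t + integral {x - 1..u} (\<lambda>x. D x t)) has_real_derivative D x t) (at x within {x - 1..x + 1})"
    by (auto intro!: derivative_eq_intros integral_has_real_derivative continuous_on_subset[OF Dx[OF t]])
  then have "((\<lambda>x. g x t) has_real_derivative D x t) (at x within {x - 1..x + 1})"
    by (rule has_field_derivative_transform_within[where d = 1])
       (simp_all, rule eq[symmetric], simp)
  then show ?thesis
    by (simp add: at_within_Icc_at)
qed

text \<open>Gronwall: \<open>u\<^sup>2 exp (2 C t)\<close> is nondecreasing and \<open>u\<^sup>2 exp (- 2 C t)\<close> is nonincreasing, so a zero of \<open>u\<close>
  spreads in both directions.\<close>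

lemma vanishes_of_derivative_bounded_by_value:
  fixes u u' :: "real \<Rightarrow> real"
  assumes cont: "continuous_on {a..b} u"
    and der: "\<And>t. t \<in> {a<..<b} \<Longrightarrow> (u has_real_derivative u' t) (at t)"
    and bd: "\<And>t. t \<in> {a<..<b} \<Longrightarrow> \<bar>u' t\<bar> \<le> C * \<bar>u t\<bar>"
    and r: "r \<in> {a..b}" "u r = 0" and t: "t \<in> {a..b}"
  shows "u t = 0"
proof -
  have key: "\<bar>u s * u' s\<bar> \<le> C * (u s)\<^sup>2" if "s \<in> {a<..<b}" for s
    using mult_left_mono[OF bd[OF that], of "\<bar>u s\<bar>"]
    by (simp add: abs_mult power2_eq_square ac_simps)
  consider "t \<le> r" | "r \<le> t" by linarith
  then have "(u t)\<^sup>2 \<le> 0"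
  proof cases
    case 1
    have "(u t)\<^sup>2 * exp (2 * C * t) \<le> (u r)\<^sup>2 * exp (2 * C * r)"
    proof (rule DERIV_nonneg_imp_increasing_open[OF 1])
      fix s assume s: "t < s" "s < r"
      have "((\<lambda>s. (u s)\<^sup>2 * exp (2 * C * s)) has_real_derivative 2 * (u s * u' s + C * (u s)\<^sup>2) * exp (2 * C * s)) (at s)"
        using s r t by (auto intro!: derivative_eq_intros der simp: algebra_simps power2_eq_square)
      moreover have "0 \<le> 2 * (u s * u' s + C * (u s)\<^sup>2) * exp (2 * C * s)"
        using key[of s] s r t by (auto simp: abs_le_iff)
      ultimately show "\<exists>y. ((\<lambda>s. (u s)\<^sup>2 * exp (2 * C * s)) has_real_derivative y) (at s) \<and> 0 \<le> y" by blast
    qed (use r t in \<open>auto intro!: continuous_intros continuous_on_subset[OF cont]\<close>)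
    then show ?thesis using r by (simp add: mult_le_0_iff)
  next
    case 2
    have "- ((u r)\<^sup>2 * exp (- 2 * C * r)) \<le> - ((u t)\<^sup>2 * exp (- 2 * C * t))"
    proof (rule DERIV_nonneg_imp_increasing_open[OF 2])
      fix s assume s: "r < s" "s < t"
      have "((\<lambda>s. - ((u s)\<^sup>2 * exp (- 2 * C * s))) has_real_derivative 2 * (C * (u s)\<^sup>2 - u s * u' s) * exp (- 2 * C * s)) (at s)"
        using s r t by (auto intro!: derivative_eq_intros der simp: algebra_simps power2_eq_square)
      moreover have "0 \<le> 2 * (C * (u s)\<^sup>2 - u s * u' s) * exp (- 2 * C * s)"
        using key[of s] s r t by (auto simp: abs_le_iff)
      ultimately show "\<exists>y. ((\<lambda>s. - ((u s)\<^sup>2 * exp (- 2 * C * s))) has_real_derivative y) (at s) \<and> 0 \<le> y" by blast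
    qed (use r t in \<open>auto intro!: continuous_intros continuous_on_subset[OF cont]\<close>)
    then show ?thesis using r by (simp add: mult_le_0_iff)
  qed
  then show ?thesis by simp
qed

text \<open>Over a step of fixed length \<open>h\<close> the function changes little far out, so its derivative is small somewhere in the
  step, and by the bound on the second derivative it is small throughout up to \<open>K h\<close>.\<close>

lemma derivative_tendsto_0:
  fixes s s' s'' :: "real \<Rightarrow> real"
  assumes F: "F = at_top \<or> F = at_bot"
    and s: "\<And>x. (s has_real_derivative s' x) (at x)"
    and s': "\<And>x. (s' has_real_derivative s'' x) (at x)"
    and bd: "\<And>x. \<bar>s'' x\<bar> \<le> K"
    and lim: "(s \<longlongrightarrow> l) F"
  shows "(s' \<longlongrightarrow> 0) F"
proof (rule tendstoI)
  fix e :: real assume e: "e > 0"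
  \<comment> \<open>The \<open>+ 1\<close> keeps the denominator positive when \<open>K = 0\<close>.\<close>
  define h where "h = e / (2 * (K + 1))"
  have K: "K \<ge> 0" using bd[of 0] by linarith
  have h: "h > 0" "K * h \<le> e / 2"
    using e K by (auto simp: h_def field_simps)
  have shift: "((\<lambda>x. s (x + h)) \<longlongrightarrow> l) F"
  proof -
    have "filterlim (\<lambda>x. h + x) at_top at_top"
      by (rule filterlim_tendsto_add_at_top[OF tendsto_const filterlim_ident])
    moreover have "filterlim (\<lambda>x. x + h) at_bot at_bot"
      unfolding filterlim_at_bot eventually_at_bot_linorder
    proof
      show "\<exists>N. \<forall>n\<le>N. n + h \<le> Z" for Z
        by (intro exI[of _ "Z - h"]) auto
    qed
    ultimately have "filterlim (\<lambda>x. x + h) F F"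
      using F by (auto simp: add.commute)
    from filterlim_compose[OF lim this] show ?thesis .
  qed
  from tendsto_diff[OF shift lim] have "((\<lambda>x. s (x + h) - s x) \<longlongrightarrow> 0) F" by simp
  from tendstoD[OF this, of "h * (e / 2)"] h e
  have "\<forall>\<^sub>F x in F. \<bar>s (x + h) - s x\<bar> < h * (e / 2)" by simp
  then show "\<forall>\<^sub>F x in F. dist (s' x) 0 < e"
  proof eventually_elim
    case (elim x)
    obtain z where z: "x < z" "z < x + h" "s (x + h) - s x = (x + h - x) * s' z"
      using MVT2[of x "x + h" s s'] h s by auto
    obtain w where w: "x < w" "w < z" "s' z - s' x = (z - x) * s'' w"
      using MVT2[of x z s' s''] z s' by auto
    have "h * \<bar>s' z\<bar> < h * (e / 2)"
      using elim z h by (simp add: abs_mult)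
    then have "\<bar>s' z\<bar> < e / 2" using h by (metis mult_less_cancel_left_pos)
    moreover have "\<bar>s' z - s' x\<bar> \<le> h * K"
      using mult_mono[of "\<bar>z - x\<bar>" h "\<bar>s'' w\<bar>" K] w z bd[of w] h by (simp add: abs_mult)
    ultimately show ?case using h by (simp add: mult.commute)
  qed
qed

text \<open>Far upstream and downstream the solution is a fixed continuous function \<open>V\<close> of two variables, evaluated at
  converging parameters. Uniformity comes from uniform continuity of \<open>V\<close> on a compact neighbourhood of the limiting
  segment.\<close>

lemma uniform_limit_continuous_compose:
  fixes V :: "real \<times> real \<Rightarrow> real"
  assumes V: "continuous_on Q V" and Q: "open Q" and K: "compact K"
    and a: "(a \<longlongrightarrow> a0) F" and b: "(b \<longlongrightarrow> b0) F"
    and sub: "\<And>y. y \<in> K \<Longrightarrow> (a0, y - b0) \<in> Q"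
  shows "uniform_limit K (\<lambda>x y. V (a x, y - b x)) (\<lambda>y. V (a0, y - b0)) F"
proof (cases "K = {}")
  case False
  define K' where "K' = (\<lambda>y. (a0, y - b0)) ` K"
  have K': "compact K'" "K' \<noteq> {}" "K' \<subseteq> Q"
    using False K sub by (auto simp: K'_def intro!: compact_continuous_image continuous_intros)
  obtain e where e: "e > 0" "{x. infdist x K' \<le> e} \<subseteq> Q"
    using compact_in_open_separated[OF K'(2,1) Q K'(3)] by blast
  define B where "B = {x. infdist x K' \<le> e}"
  have B: "compact B" using compact_infdist_le[OF K'(2,1) e(1)] by (simp add: B_def)
  have ul: "uniform_limit K (\<lambda>x y. (a x, y - b x)) (\<lambda>y. (a0, y - b0)) F"
  proof (rule uniform_limitI)
    fix d :: real assume d: "d > 0"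
    have "((\<lambda>x. (a x, - b x)) \<longlongrightarrow> (a0, - b0)) F"
      by (intro tendsto_Pair a tendsto_minus b)
    from tendstoD[OF this d] show "\<forall>\<^sub>F n in F. \<forall>y\<in>K. dist (a n, y - b n) (a0, y - b0) < d"
      by eventually_elim (auto simp: dist_prod_def dist_real_def)
  qed
  show ?thesis
  proof (rule uniform_limit_compose_uniformly_continuous_on[OF ul])
    show "uniformly_continuous_on B V"
      by (intro compact_uniformly_continuous B continuous_on_subset[OF V]) (use e B_def in auto)
    show "closed B" using B by (rule compact_imp_closed)
    from uniform_limitD[OF ul e(1)]
    show "\<forall>\<^sub>F x in F. \<forall>y\<in>K. (a x, y - b x) \<in> B"
    proof eventually_elim
      case (elim x)
      show ?case
      proof
        fix y assume "y \<in> K"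
        then have "infdist (a x, y - b x) K' \<le> dist (a x, y - b x) (a0, y - b0)"
          by (intro infdist_le) (auto simp: K'_def)
        also have "\<dots> < e" using elim \<open>y \<in> K\<close> by auto
        finally show "(a x, y - b x) \<in> B" by (simp add: B_def)
      qed
    qed
  qed
qed simp

text \<open>Both the labels of the explicit solution and the streamlines of an arbitrary solution arise by inverting a
  function that is strictly increasing in its second variable, on each fibre separately.\<close>

definition fibre_inverse :: "('a \<Rightarrow> real \<Rightarrow> real) \<Rightarrow> 'a \<Rightarrow> real \<Rightarrow> real" where
  "fibre_inverse A x = inv_into {0..1} (A x)"

context
  fixes U :: "real set" and A At :: "real \<Rightarrow> real \<Rightarrow> real"
  assumes contA: "continuous_on (U \<times> {0..1}) (\<lambda>(x, t). A x t)"
    and derA: "\<And>x t. x \<in> U \<Longrightarrow> t \<in> {0..1} \<Longrightarrow> (A x has_real_derivative At x t) (at t within {0..1})"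
    and pos: "\<And>x t. x \<in> U \<Longrightarrow> t \<in> {0..1} \<Longrightarrow> 0 < At x t"
begin

lemma fibre_strict_mono:
  assumes "x \<in> U" "s \<in> {0..1}" "t \<in> {0..1}" "s < t"
  shows "A x s < A x t"
proof (rule DERIV_pos_imp_increasing_open[OF \<open>s < t\<close>])
  fix r assume r: "s < r" "r < t"
  with derA[of x r] assms have "(A x has_real_derivative At x r) (at r)"
    by (auto simp: at_within_Icc_at)
  with pos[of x r] r assms show "\<exists>y. (A x has_real_derivative y) (at r) \<and> 0 < y" by auto
next
  show "continuous_on {s..t} (A x)"
    by (rule continuous_on_subset[OF continuous_on_slice(1)[OF contA]]) (use assms in auto)
qed

lemma fibre_less_iff:
  assumes "x \<in> U" "s \<in> {0..1}" "t \<in> {0..1}"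
  shows "A x s < A x t \<longleftrightarrow> s < t"
  using fibre_strict_mono[of x s t] fibre_strict_mono[of x t s] assms
  by (cases s t rule: linorder_cases) auto

lemma fibre_inverse_left:
  assumes "x \<in> U" "t \<in> {0..1}"
  shows "fibre_inverse A x (A x t) = t"
  unfolding fibre_inverse_def
proof (rule inv_into_f_f[OF _ assms(2)])
  show "inj_on (A x) {0..1}"
  proof (rule inj_onI)
    fix s r :: real assume "s \<in> {0..1}" "r \<in> {0..1}" "A x s = A x r"
    then show "s = r"
      using fibre_strict_mono[OF assms(1), of s r] fibre_strict_mono[OF assms(1), of r s]
      by (cases s r rule: linorder_cases) auto
  qed
qed

lemma fibre_inverse_right:
  assumes "x \<in> U" "A x 0 \<le> y" "y \<le> A x 1"
  shows "fibre_inverse A x y \<in> {0..1}" "A x (fibre_inverse A x y) = y"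
proof -
  have "\<exists>t\<ge>0. t \<le> 1 \<and> A x t = y"
    by (rule IVT') (use assms continuous_on_slice(1)[OF contA, of x] in auto)
  then have "y \<in> A x ` {0..1}" by auto
  then show "fibre_inverse A x y \<in> {0..1}" "A x (fibre_inverse A x y) = y"
    unfolding fibre_inverse_def by (auto simp: inv_into_into f_inv_into_f simp del: atLeastAtMost_iff)
qed

lemma fibre_inverse_interior:
  assumes "x \<in> U" "A x 0 < y" "y < A x 1"
  shows "fibre_inverse A x y \<in> {0<..<1}"
proof -
  have "fibre_inverse A x y \<in> {0..1}" "A x (fibre_inverse A x y) = y"
    using fibre_inverse_right[of x y] assms by auto
  moreover from this have "fibre_inverse A x y \<noteq> 0" "fibre_inverse A x y \<noteq> 1"
    using assms by auto
  ultimately show ?thesis by auto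
qed

text \<open>The graph of the inverse is closed because it is cut out by the continuous equation \<open>A x t = y\<close>. A map into the
  compact interval \<open>{0..1}\<close> with closed graph is continuous.\<close>

lemma continuous_on_fibre_inverse:
  "continuous_on {(x, y). x \<in> U \<and> A x 0 \<le> y \<and> y \<le> A x 1} (\<lambda>(x, y). fibre_inverse A x y)"
proof -
  define S where "S = {(x, y). x \<in> U \<and> A x 0 \<le> y \<and> y \<le> A x 1}"
  define f where "f = (\<lambda>(x, y). fibre_inverse A x y)"
  have f: "f ` S \<subseteq> {0..1}"
    using fibre_inverse_right by (auto simp: f_def S_def)
  have graph: "(\<lambda>p. (p, f p)) ` S = (S \<times> {0..1}) \<inter> (\<lambda>(p, t). A (fst p) t - snd p) -` {0}"
  proof (intro subset_antisym subsetI)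
    fix q assume "q \<in> (\<lambda>p. (p, f p)) ` S"
    then show "q \<in> (S \<times> {0..1}) \<inter> (\<lambda>(p, t). A (fst p) t - snd p) -` {0}"
      using f by (auto simp: f_def S_def fibre_inverse_right(2))
  next
    fix q assume "q \<in> (S \<times> {0..1}) \<inter> (\<lambda>(p, t). A (fst p) t - snd p) -` {0}"
    then obtain x y t where q: "q = ((x, y), t)" "(x, y) \<in> S" "t \<in> {0..1}" "A x t = y"
      by (cases q) auto
    moreover from q have "f (x, y) = t"
      using fibre_inverse_left[of x t] by (auto simp: f_def S_def)
    ultimately show "q \<in> (\<lambda>p. (p, f p)) ` S" by auto
  qed
  have "continuous_on (S \<times> {0..1}) (\<lambda>q. (\<lambda>(x, t). A x t) (fst (fst q), snd q))"
    by (rule continuous_on_compose2[OF contA]) (auto intro!: continuous_intros simp: S_def)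
  then have "continuous_on (S \<times> {0..1}) (\<lambda>(p, t). A (fst p) t - snd p)"
    by (auto simp: case_prod_unfold intro!: continuous_intros)
  then have "closedin (top_of_set (S \<times> {0..1})) ((S \<times> {0..1}) \<inter> (\<lambda>(p, t). A (fst p) t - snd p) -` {0})"
    by (rule continuous_closedin_preimage) simp
  then show ?thesis
    unfolding S_def[symmetric] f_def[symmetric] graph[symmetric]
    using f by (subst continuous_closed_graph_eq[of "{0..1::real}"]) auto
qed

text \<open>The map \<open>(x, t) \<mapsto> (x, A x t)\<close> is inverted by \<open>(x, y) \<mapsto> (x, fibre_inverse A x y)\<close>. The inverse is already known to be
  continuous, so inverting the derivative at the point suffices.\<close>

lemma has_derivative_fibre_inverse:
  assumes U: "open U"
    and derx: "\<And>x t. x \<in> U \<Longrightarrow> t \<in> {0<..<1} \<Longrightarrow> ((\<lambda>x. A x t) has_real_derivative Ax x t) (at x)"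
    and contAt: "continuous_on (U \<times> {0<..<1}) (\<lambda>(x, t). At x t)"
    and end0: "continuous_on U (\<lambda>x. A x 0)" and end1: "continuous_on U (\<lambda>x. A x 1)"
    and xy: "x \<in> U" "A x 0 < y" "y < A x 1"
  defines "t \<equiv> fibre_inverse A x y"
  shows "((\<lambda>(x, y). fibre_inverse A x y) has_derivative
            (\<lambda>(h, k). - Ax x t / At x t * h + 1 / At x t * k)) (at (x, y))"
proof -
  define R where "R = {(x, y). x \<in> U \<and> A x 0 < y \<and> y < A x 1}"
  define g where "g = (\<lambda>(x, y). (x, fibre_inverse A x y))"
  define f where "f = (\<lambda>(x, t). (x, A x t))"
  have R: "open R"
  proof -
    have "continuous_on (U \<times> UNIV) (\<lambda>p. snd p - A (fst p) 0)" "continuous_on (U \<times> UNIV) (\<lambda>p. A (fst p) 1 - snd p)"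
      by (auto intro!: continuous_intros continuous_on_compose2[OF end0] continuous_on_compose2[OF end1])
    then have "open ((U \<times> UNIV) \<inter> (\<lambda>p. snd p - A (fst p) 0) -` {0<..})" "open ((U \<times> UNIV) \<inter> (\<lambda>p. A (fst p) 1 - snd p) -` {0<..})"
      using U by (auto intro!: continuous_open_preimage open_Times)
    then have "open (((U \<times> UNIV) \<inter> (\<lambda>p. snd p - A (fst p) 0) -` {0<..}) \<inter> ((U \<times> UNIV) \<inter> (\<lambda>p. A (fst p) 1 - snd p) -` {0<..}))"
      by (rule open_Int)
    also have "\<dots> = R" by (auto simp: R_def)
    finally show ?thesis .
  qed
  have t: "t \<in> {0<..<1}" using fibre_inverse_interior[OF xy] by (simp add: t_def)
  have At: "At x t > 0" using pos[of x t] xy t by simp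
  have "((\<lambda>p. (\<lambda>(x, t). A x t) p) has_derivative (\<lambda>(h, k). Ax x t * h + (\<lambda>(x, t). At x t) (x, t) * k)) (at (x, t))"
  proof (rule has_derivative_from_partials[where \<Omega> = "U \<times> {0<..<1}"])
    show "((\<lambda>t. (\<lambda>(x, t). A x t) (x, t)) has_real_derivative (\<lambda>(x, t). At x t) (x, s)) (at s)"
      if "(x, s) \<in> U \<times> {0<..<1}" for x s
      using derA[of x s] that by (auto simp: at_within_Icc_at)
  qed (use U xy t derx contAt in \<open>auto intro!: open_Times\<close>)
  then have df: "(f has_derivative (\<lambda>(h, k). (h, Ax x t * h + At x t * k))) (at (g (x, y)))"
    unfolding f_def g_def t_def case_prod_unfold
    by (auto intro!: has_derivative_Pair has_derivative_fst has_derivative_ident)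
  have "(g has_derivative (\<lambda>(h, k). (h, - Ax x t / At x t * h + 1 / At x t * k))) (at (x, y))"
  proof (rule has_derivative_inverse_basic[where f = f and g = g and y = "(x, y)" and T = R, OF df])
    show "open R" by (fact R)
    show "bounded_linear (\<lambda>(h, k). (h, - Ax x t / At x t * h + 1 / At x t * k))"
      unfolding case_prod_unfold
      by (intro bounded_linear_Pair bounded_linear_add bounded_linear_fst bounded_linear_const_mult bounded_linear_snd)
    show "(\<lambda>(h, k). (h, - Ax x t / At x t * h + 1 / At x t * k)) \<circ> (\<lambda>(h, k). (h, Ax x t * h + At x t * k)) = id"
      using At by (auto simp: fun_eq_iff field_simps)
    show "(x, y) \<in> R" using xy by (simp add: R_def)
    have "continuous_on R (\<lambda>(x, y). fibre_inverse A x y)"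
      by (rule continuous_on_subset[OF continuous_on_fibre_inverse]) (auto simp: R_def)
    then have "continuous_on R g"
      unfolding g_def case_prod_unfold by (intro continuous_intros)
    then show "continuous (at (x, y)) g"
      using R \<open>(x, y) \<in> R\<close> by (simp add: continuous_on_eq_continuous_at)
    show "f (g z) = z" if "z \<in> R" for z
      using that fibre_inverse_right by (auto simp: f_def g_def R_def)
  qed
  from has_derivative_snd[OF this] show ?thesis
    by (simp add: g_def case_prod_unfold)
qed

end

section \<open>Sections of a parallel flow with given upstream profile\<close>

text \<open>The Lipschitz bound stands in for the second derivative of the profile: it gives quadratic growth of \<open>m\<close> away from
  a minimum point.\<close>

locale inflow_profile =
  fixes m m' :: "real \<Rightarrow> real" and K :: real
  assumes der_m: "t \<in> {0..1} \<Longrightarrow> (m has_real_derivative m' t) (at t within {0..1})"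
    and m_pos: "t \<in> {0..1} \<Longrightarrow> 0 < m t"
    and m'_lipschitz: "s \<in> {0..1} \<Longrightarrow> t \<in> {0..1} \<Longrightarrow> \<bar>m' s - m' t\<bar> \<le> K * \<bar>s - t\<bar>"
    and m'_0: "m' 0 \<le> 0" and m'_1: "0 \<le> m' 1"
begin

text \<open>The parameter \<open>l\<close> is the amount by which the square of the speed differs from its upstream value, the same on
  all streamlines of a section. For \<open>l \<in> heads\<close> the flow does not stagnate on any streamline. The function
  \<open>height_head\<close> is the derivative of \<open>height\<close> with respect to \<open>l\<close>.\<close>

definition speed :: "real \<Rightarrow> real \<Rightarrow> real" where
  "speed l t = sqrt ((m t)\<^sup>2 + l)"

definition heads :: "real set" where
  "heads = {l. \<forall>t\<in>{0..1}. 0 < (m t)\<^sup>2 + l}"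

definition height :: "real \<Rightarrow> real \<Rightarrow> real" where
  "height l t = integral {0..t} (\<lambda>s. m s / speed l s)"

definition height_head :: "real \<Rightarrow> real \<Rightarrow> real" where
  "height_head l t = integral {0..t} (\<lambda>s. - m s / (2 * speed l s ^ 3))"

definition width :: "real \<Rightarrow> real" where
  "width l = height l 1"

lemma cont_m: "continuous_on {0..1} m"
  using der_m by (rule DERIV_continuous_on)

lemma cont_m': "continuous_on {0..1} m'"
proof -
  have "K-lipschitz_on {0..1} m'" if "K \<ge> 0"
    using m'_lipschitz that by (auto simp: lipschitz_on_def dist_real_def)
  moreover have "K \<ge> 0" using m'_lipschitz[of 0 1] by auto
  ultimately show ?thesis by (auto intro: lipschitz_on_continuous_on)
qed

lemma der_m_interior: "t \<in> {0<..<1} \<Longrightarrow> (m has_real_derivative m' t) (at t)"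
  using der_m[of t] by (auto simp: at_within_Icc_at)

text \<open>At an interior minimum \<open>m' = 0\<close>. At a minimum on the wall \<open>0\<close> minimality gives \<open>m' 0 \<ge> 0\<close>, so the sign condition
  gives \<open>m' 0 = 0\<close>; likewise at \<open>1\<close>.\<close>

lemma minimum:
  obtains t0 where "t0 \<in> {0..1}" "m' t0 = 0" "\<And>t. t \<in> {0..1} \<Longrightarrow> m t0 \<le> m t"
    "heads = {- (m t0)\<^sup>2<..}"
proof -
  obtain t0 where t0: "t0 \<in> {0..1}" "\<And>t. t \<in> {0..1} \<Longrightarrow> m t0 \<le> m t"
    using continuous_attains_inf[OF compact_Icc _ cont_m] by auto
  have "m' t0 = 0"
  proof -
    consider "t0 = 0" | "t0 = 1" | "t0 \<in> {0<..<1}" using t0(1) by fastforce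
    then show ?thesis
    proof cases
      case 1
      have "0 \<le> m' 0"
      proof (rule ccontr)
        assume "\<not> 0 \<le> m' 0"
        then obtain e where "e > 0" and dec: "\<And>h. 0 + h \<in> {0..1} \<Longrightarrow> 0 < h \<Longrightarrow> h < e \<Longrightarrow> m (0 + h) < m 0"
          using has_real_derivative_neg_dec_right[OF der_m[of 0]] by auto
        obtain h where "0 < h" "h < e" "h < 1" using \<open>e > 0\<close> by (metis field_lbound_gt_zero less_numeral_extra(1))
        with dec[of h] t0(2)[of h] 1 show False by auto
      qed
      with m'_0 1 show ?thesis by simp
    next
      case 2
      have "m' 1 \<le> 0"
      proof (rule ccontr)
        assume "\<not> m' 1 \<le> 0"
        then obtain e where "e > 0" and dec: "\<And>h. 1 - h \<in> {0..1} \<Longrightarrow> 0 < h \<Longrightarrow> h < e \<Longrightarrow> m (1 - h) < m 1"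
          using has_real_derivative_pos_inc_left[OF der_m[of 1]] by auto
        obtain h where "0 < h" "h < e" "h < 1" using \<open>e > 0\<close> by (metis field_lbound_gt_zero less_numeral_extra(1))
        with dec[of h] t0(2)[of "1 - h"] 2 show False by auto
      qed
      with m'_1 2 show ?thesis by simp
    next
      case 3
      show ?thesis
      proof (rule DERIV_local_min[OF der_m_interior[OF 3], of "min t0 (1 - t0)"])
        show "\<forall>y. \<bar>t0 - y\<bar> < min t0 (1 - t0) \<longrightarrow> m t0 \<le> m y"
          using t0(2) by (auto simp: abs_less_iff)
      qed (use 3 in auto)
    qed
  qed
  moreover have "heads = {- (m t0)\<^sup>2<..}"
  proof (intro subset_antisym subsetI)
    fix l assume "l \<in> {- (m t0)\<^sup>2<..}"
    moreover have "(m t0)\<^sup>2 \<le> (m t)\<^sup>2" if "t \<in> {0..1}" for t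
      using t0(2)[OF that] m_pos[OF t0(1)] by (intro power_mono) auto
    ultimately show "l \<in> heads" by (fastforce simp: heads_def)
  qed (use t0(1) in \<open>auto simp: heads_def dest!: bspec[of _ _ t0]\<close>)
  ultimately show ?thesis using t0 that by blast
qed

lemma open_heads: "open heads" and convex_heads: "convex heads"
  by (rule minimum; simp)+

lemma speed_pos: "l \<in> heads \<Longrightarrow> t \<in> {0..1} \<Longrightarrow> 0 < speed l t"
  by (auto simp: speed_def heads_def)

lemma speed_square: "l \<in> heads \<Longrightarrow> t \<in> {0..1} \<Longrightarrow> (speed l t)\<^sup>2 = (m t)\<^sup>2 + l"
  by (simp add: speed_def heads_def less_imp_le)

lemma speed_0: "t \<in> {0..1} \<Longrightarrow> speed 0 t = m t"
  using m_pos[of t] by (simp add: speed_def)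

lemma zero_in_heads: "0 \<in> heads"
  using m_pos by (fastforce simp: heads_def)

lemma continuous_on_speed: "continuous_on (heads \<times> {0..1}) (\<lambda>(l, t). speed l t)"
  unfolding speed_def case_prod_unfold
  by (intro continuous_intros continuous_on_compose2[OF cont_m]) auto

lemma continuous_on_height_integrands:
  shows "continuous_on (heads \<times> {0..1}) (\<lambda>(l, t). m t / speed l t)"
    and "continuous_on (heads \<times> {0..1}) (\<lambda>(l, t). - m t / (2 * speed l t ^ 3))"
proof -
  have "continuous_on (heads \<times> {0..1}) (\<lambda>p. speed (fst p) (snd p))"
    using continuous_on_speed by (simp add: case_prod_unfold)
  moreover have "continuous_on (heads \<times> {0..1}) (\<lambda>p. m (snd p))"
    by (rule continuous_on_compose2[OF cont_m]) (auto intro: continuous_intros)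
  moreover have "speed (fst p) (snd p) \<noteq> 0" if "p \<in> heads \<times> {0..1}" for p
    using speed_pos[of "fst p" "snd p"] that by auto
  ultimately show "continuous_on (heads \<times> {0..1}) (\<lambda>(l, t). m t / speed l t)"
    "continuous_on (heads \<times> {0..1}) (\<lambda>(l, t). - m t / (2 * speed l t ^ 3))"
    unfolding case_prod_unfold by (auto intro!: continuous_intros)
qed

lemma continuous_on_height: "continuous_on (heads \<times> {0..1}) (\<lambda>(l, t). height l t)"
  and continuous_on_height_head: "continuous_on (heads \<times> {0..1}) (\<lambda>(l, t). height_head l t)"
  unfolding height_def height_head_def
  by (intro continuous_on_integral_upto continuous_on_height_integrands)+

lemma height_0: "height l 0 = 0" and height_head_0: "height_head l 0 = 0"
  by (simp_all add: height_def height_head_def)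

lemma height_DERIV:
  assumes "l \<in> heads" "t \<in> {0..1}"
  shows "(height l has_real_derivative m t / speed l t) (at t within {0..1})"
    and "(height_head l has_real_derivative - m t / (2 * speed l t ^ 3)) (at t within {0..1})"
  using integral_has_real_derivative[OF continuous_on_slice(1)[OF continuous_on_height_integrands(1)] assms(2)]
    integral_has_real_derivative[OF continuous_on_slice(1)[OF continuous_on_height_integrands(2)] assms(2)] assms(1)
  by (simp_all add: height_def[abs_def] height_head_def[abs_def])

lemma speed_DERIV_head:
  assumes "l \<in> heads" "t \<in> {0..1}"
  shows "((\<lambda>l. speed l t) has_real_derivative 1 / (2 * speed l t)) (at l)"
proof -
  have "0 < (m t)\<^sup>2 + l" using assms by (auto simp: heads_def)
  then show ?thesis unfolding speed_def
    by (auto intro!: derivative_eq_intros simp: field_simps)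
qed

lemma height_DERIV_head:
  assumes l: "l \<in> heads" and t: "t \<in> {0..1}"
  shows "((\<lambda>l. height l t) has_real_derivative height_head l t) (at l)"
proof -
  have sub: "heads \<times> {0..t} \<subseteq> heads \<times> {0..1}" using t by auto
  have "((\<lambda>l. integral (cbox 0 t) (\<lambda>s. m s / speed l s)) has_field_derivative
      integral (cbox 0 t) (\<lambda>s. - m s / (2 * speed l s ^ 3))) (at l within heads)"
  proof (rule leibniz_rule_field_derivative[OF _ _ _ l convex_heads])
    fix l s assume l: "l \<in> heads" and s: "s \<in> cbox 0 t"
    then have s1: "s \<in> {0..1}" using t by auto
    have "((\<lambda>l. m s / speed l s) has_real_derivative - m s / (2 * speed l s ^ 3)) (at l)"
      using speed_pos[OF l s1]
      by (auto intro!: derivative_eq_intros speed_DERIV_head[OF l s1] simp: field_simps power3_eq_cube)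
    then show "((\<lambda>l. m s / speed l s) has_real_derivative - m s / (2 * speed l s ^ 3)) (at l within heads)"
      by (rule has_field_derivative_at_within)
  next
    fix l assume "l \<in> heads"
    have "continuous_on {0..t} (\<lambda>s. m s / speed l s)"
      by (rule continuous_on_subset[OF continuous_on_slice(1)[OF continuous_on_height_integrands(1) \<open>l \<in> heads\<close>]])
        (use t in auto)
    then show "(\<lambda>s. m s / speed l s) integrable_on cbox 0 t"
      by (simp add: integrable_continuous_real)
  next
    show "continuous_on (heads \<times> cbox 0 t) (\<lambda>(l, s). - m s / (2 * speed l s ^ 3))"
      using continuous_on_subset[OF continuous_on_height_integrands(2) sub] by simp
  qed
  then show ?thesis
    using at_within_open[OF l open_heads] by (simp add: height_def height_head_def)
qed

lemma width_DERIV: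
  "l \<in> heads \<Longrightarrow> (width has_real_derivative height_head l 1) (at l)"
  using height_DERIV_head[of l 1] by (simp add: width_def[abs_def])

lemma height_head_1_neg:
  assumes "l \<in> heads"
  shows "height_head l 1 < 0"
proof -
  have "height_head l 1 < height_head l 0"
  proof (rule DERIV_neg_imp_decreasing_open[where f = "height_head l"])
    show "continuous_on {0..1} (height_head l)"
      using continuous_on_slice(1)[OF continuous_on_height_head assms] .
    show "\<exists>y. (height_head l has_real_derivative y) (at t) \<and> y < 0" if "0 < t" "t < 1" for t
      using height_DERIV(2)[OF assms, of t] speed_pos[OF assms, of t] m_pos[of t] that
      by (auto simp: at_within_Icc_at divide_neg_pos intro!: exI[of _ "- m t / (2 * speed l t ^ 3)"])
  qed simp
  then show ?thesis by (simp add: height_head_0)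
qed

lemma width_strict_antimono:
  assumes "l \<in> heads" "l < l'"
  shows "width l' < width l"
proof -
  obtain t0 where "heads = {- (m t0)\<^sup>2<..}" by (rule minimum)
  then have "r \<in> heads" if "l \<le> r" for r using that assms by auto
  then show ?thesis
    using width_DERIV height_head_1_neg by (intro DERIV_neg_imp_decreasing[OF assms(2)]) blast
qed

lemma inj_width: "inj_on width heads"
  by (rule inj_onI) (metis linorder_neqE width_strict_antimono less_irrefl)

lemma width_0: "width 0 = 1"
proof -
  have "integral {0..1} (\<lambda>s. m s / speed 0 s) = integral {0..1::real} (\<lambda>s. 1::real)"
  proof (rule Henstock_Kurzweil_Integration.integral_cong)
    show "m s / speed 0 s = 1" if "s \<in> {0..1}" for s
      using m_pos[OF that] speed_0[OF that] by simp
  qed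
  then show ?thesis by (simp add: width_def height_def)
qed


lemma width_upper_bound:
  assumes M: "\<And>t. t \<in> {0..1} \<Longrightarrow> m t \<le> M" and l: "0 < l"
  shows "width l \<le> M / sqrt l"
proof -
  have l': "l \<in> heads" using l by (auto simp: heads_def intro: add_nonneg_pos)
  have "width l \<le> integral {0..1::real} (\<lambda>s. M / sqrt l)"
    unfolding width_def height_def
  proof (rule integral_le)
    show "(\<lambda>s. m s / speed l s) integrable_on {0..1}"
      by (rule integrable_continuous_real[OF continuous_on_slice(1)[OF continuous_on_height_integrands(1) l']])
    show "(\<lambda>s. M / sqrt l) integrable_on {0..1::real}" by (rule integrable_const_ivl)
    show "m s / speed l s \<le> M / sqrt l" if "s \<in> {0..1}" for s
      using M[OF that] m_pos[OF that] l by (intro frac_le) (auto simp: speed_def)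
  qed
  then show ?thesis by simp
qed

lemma growth_from_minimum:
  assumes t0: "t0 \<in> {0..1}" "m' t0 = 0" and t: "t \<in> {0..1}"
  shows "m t - m t0 \<le> K * (t - t0)\<^sup>2"
proof (cases "t = t0")
  case False
  have "\<exists>z\<in>{0..1}. \<bar>z - t0\<bar> \<le> \<bar>t - t0\<bar> \<and> m t - m t0 = (t - t0) * m' z"
  proof (cases "t0 < t")
    case True
    have "\<exists>z\<in>{t0<..<t}. m t - m t0 = (\<lambda>h. h * m' z) (t - t0)"
      by (rule mvt_simple[OF True])
         (use t0 t in \<open>auto intro!: has_field_derivative_imp_has_derivative DERIV_subset[OF der_m] simp: mult_commute_abs\<close>)
    then obtain z where "z \<in> {t0<..<t}" "m t - m t0 = (t - t0) * m' z" by auto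
    then show ?thesis using t0 t by (intro bexI[of _ z]) auto
  next
    case 2: False
    with False have "t < t0" by simp
    then have "\<exists>z\<in>{t<..<t0}. m t0 - m t = (\<lambda>h. h * m' z) (t0 - t)"
      by (rule mvt_simple)
         (use t0 t in \<open>auto intro!: has_field_derivative_imp_has_derivative DERIV_subset[OF der_m] simp: mult_commute_abs\<close>)
    then obtain z where "z \<in> {t<..<t0}" "m t0 - m t = (t0 - t) * m' z" by auto
    then show ?thesis using t0 t by (intro bexI[of _ z]) (auto simp: algebra_simps)
  qed
  then obtain z where z: "z \<in> {0..1}" "\<bar>z - t0\<bar> \<le> \<bar>t - t0\<bar>" "m t - m t0 = (t - t0) * m' z"
    by blast
  have K: "K \<ge> 0" using m'_lipschitz[of 0 1] by auto
  have "\<bar>m' z\<bar> \<le> K * \<bar>t - t0\<bar>"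
    using m'_lipschitz[OF z(1) t0(1)] t0(2) mult_left_mono[OF z(2) K] by simp
  then have "\<bar>t - t0\<bar> * \<bar>m' z\<bar> \<le> \<bar>t - t0\<bar> * (K * \<bar>t - t0\<bar>)"
    by (rule mult_left_mono) simp
  then have "\<bar>m t - m t0\<bar> \<le> K * (t - t0)\<^sup>2"
    by (simp add: z(3) abs_mult power2_eq_square ac_simps)
  then show ?thesis by simp
qed simp

text \<open>The slope vanishes at a minimum point and is Lipschitz, so \<open>m\<close> and hence \<open>m\<^sup>2\<close> grow at most quadratically from
  there. The form \<open>(D \<bar>t - t0\<bar>)\<^sup>2\<close> compares directly with squares of speeds.\<close>

lemma square_growth_from_minimum:
  obtains D where "D > 0" "\<And>t0 t. t0 \<in> {0..1} \<Longrightarrow> m' t0 = 0 \<Longrightarrow> (\<And>t. t \<in> {0..1} \<Longrightarrow> m t0 \<le> m t) \<Longrightarrow>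
    t \<in> {0..1} \<Longrightarrow> (m t)\<^sup>2 - (m t0)\<^sup>2 \<le> (D * \<bar>t - t0\<bar>)\<^sup>2"
proof -
  obtain M where M: "\<And>t. t \<in> {0..1} \<Longrightarrow> m t \<le> M"
    using continuous_attains_sup[OF compact_Icc _ cont_m] by (metis atLeastAtMost_iff empty_iff zero_le_one order_refl)
  have K: "K \<ge> 0" using m'_lipschitz[of 0 1] by auto
  have M0: "M > 0" using M[of 0] m_pos[of 0] by auto
  define D where "D = sqrt (2 * M * K + 1)"
  have D2: "D\<^sup>2 = 2 * M * K + 1" using K M0 by (simp add: D_def)
  show ?thesis
  proof
    show "D > 0" using K M0 by (simp add: D_def add_nonneg_pos)
    fix t0 t :: real
    assume t0: "t0 \<in> {0..1}" "m' t0 = 0" and min: "\<And>t. t \<in> {0..1} \<Longrightarrow> m t0 \<le> m t" and t: "t \<in> {0..1}"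
    have "(m t)\<^sup>2 - (m t0)\<^sup>2 = (m t + m t0) * (m t - m t0)" by (simp add: power2_eq_square algebra_simps)
    also have "\<dots> \<le> (2 * M) * (K * (t - t0)\<^sup>2)"
      using growth_from_minimum[OF t0 t] M[OF t] M[OF t0(1)] min[OF t] M0 by (intro mult_mono) auto
    also have "\<dots> \<le> D\<^sup>2 * (t - t0)\<^sup>2" by (simp add: D2 algebra_simps)
    finally show "(m t)\<^sup>2 - (m t0)\<^sup>2 \<le> (D * \<bar>t - t0\<bar>)\<^sup>2" by (simp add: power_mult_distrib)
  qed
qed

text \<open>For \<open>l = e\<^sup>2 - min m\<^sup>2\<close> quadratic growth gives \<open>speed l t \<le> D \<bar>t - t0\<bar> + e\<close> for the minimum point \<open>t0\<close>. On the side of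
  \<open>t0\<close> that has length at least \<open>1 / 2\<close>, the width is therefore at least \<open>(min m / D) (ln (D / 2) - ln e)\<close>, which is
  large for small \<open>e\<close>.\<close>

lemma width_unbounded: "\<exists>l\<in>heads. d \<le> width l"
proof -
  obtain t0 where t0: "t0 \<in> {0..1}" "m' t0 = 0" "\<And>t. t \<in> {0..1} \<Longrightarrow> m t0 \<le> m t" "heads = {- (m t0)\<^sup>2<..}"
    using minimum by blast
  obtain D where D: "D > 0" "\<And>t. t \<in> {0..1} \<Longrightarrow> (m t)\<^sup>2 - (m t0)\<^sup>2 \<le> (D * \<bar>t - t0\<bar>)\<^sup>2"
    using square_growth_from_minimum t0 by metis
  define \<mu> where "\<mu> = m t0"
  have \<mu>: "\<mu> > 0" using m_pos t0 by (simp add: \<mu>_def)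
  \<comment> \<open>Chosen such that \<open>(\<mu> / D) (ln (D / 2) - ln e) = \<bar>d\<bar>\<close>.\<close>
  define e where "e = D / 2 * exp (- (\<bar>d\<bar> * D / \<mu>))"
  have e: "e > 0" using D by (simp add: e_def)
  define l where "l = e\<^sup>2 - \<mu>\<^sup>2"
  have l: "l \<in> heads" using e t0 by (simp add: l_def \<mu>_def)
  have lower: "\<mu> / (D * \<bar>t - t0\<bar> + e) \<le> m t / speed l t" if t: "t \<in> {0..1}" for t
  proof (rule frac_le)
    have "(speed l t)\<^sup>2 \<le> (D * \<bar>t - t0\<bar>)\<^sup>2 + e\<^sup>2"
      using D(2)[OF t] by (simp add: speed_square[OF l t]) (simp add: l_def \<mu>_def)
    also have "\<dots> \<le> (D * \<bar>t - t0\<bar> + e)\<^sup>2"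
      using D e by (simp add: power2_sum)
    finally show "speed l t \<le> D * \<bar>t - t0\<bar> + e"
      by (rule power2_le_imp_le) (use D e in simp)
  qed (use t0 t m_pos speed_pos[OF l t] \<mu>_def in \<open>auto simp: less_imp_le\<close>)
  have der: "(height l has_real_derivative m t / speed l t) (at t)" if "t \<in> {0<..<1}" for t
    using height_DERIV(1)[OF l, of t] that by (auto simp: at_within_Icc_at)
  have cont: "continuous_on {0..1} (height l)"
    using continuous_on_slice(1)[OF continuous_on_height l] .
  have "ln e = ln (D * (1 / 2)) - \<bar>d\<bar> * D / \<mu>"
    unfolding e_def using D by (subst ln_mult) auto
  then have d: "d \<le> \<mu> / D * (ln (D * (1 / 2)) - ln e)"
    using D \<mu> by simp
  have mono: "height l r \<le> height l s" if "0 \<le> r" "r \<le> s" "s \<le> 1" for r s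
  proof (rule DERIV_nonneg_imp_increasing_open[OF that(2)])
    show "\<exists>y. (height l has_real_derivative y) (at t) \<and> 0 \<le> y" if "r < t" "t < s" for t
      using der[of t] m_pos[of t] speed_pos[OF l, of t] that \<open>0 \<le> r\<close> \<open>s \<le> 1\<close>
      by (intro exI[of _ "m t / speed l t"]) auto
    show "continuous_on {r..s} (height l)"
      by (rule continuous_on_subset[OF cont]) (use that in auto)
  qed
  have nonneg: "height l 0 \<le> height l t0" "height l t0 \<le> height l 1"
    using t0 by (auto intro: mono)
  have right: "\<mu> / D * (ln (D * (1 - t0) + e) - ln e) \<le> height l 1 - height l t0"
  proof -
    have p: "0 < D * (t - t0) + e" if "t0 \<le> t" "t \<le> 1" for t
      using D e that by (intro add_nonneg_pos) auto
    have nz: "D * (t - t0) + e \<noteq> 0" if "t0 \<le> t" "t \<le> 1" for t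
      using p[OF that] by simp
    have "(\<lambda>t. height l t - \<mu> / D * ln (D * (t - t0) + e)) t0 \<le> (\<lambda>t. height l t - \<mu> / D * ln (D * (t - t0) + e)) 1"
    proof (rule DERIV_nonneg_imp_increasing_open[where f = "\<lambda>t. height l t - \<mu> / D * ln (D * (t - t0) + e)"])
      fix t assume t: "t0 < t" "t < 1"
      have "((\<lambda>t. height l t - \<mu> / D * ln (D * (t - t0) + e)) has_real_derivative m t / speed l t - \<mu> / (D * (t - t0) + e)) (at t)"
        using t t0 p[of t] D by (auto intro!: derivative_eq_intros der)
      moreover have "0 \<le> m t / speed l t - \<mu> / (D * (t - t0) + e)"
        using lower[of t] t t0 by auto
      ultimately show "\<exists>y. ((\<lambda>t. height l t - \<mu> / D * ln (D * (t - t0) + e)) has_real_derivative y) (at t) \<and> 0 \<le> y"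
        by blast
    next
      show "continuous_on {t0..1} (\<lambda>t. height l t - \<mu> / D * ln (D * (t - t0) + e))"
        by (intro continuous_intros continuous_on_subset[OF cont]) (use t0 nz in auto)
    qed (use t0 in auto)
    then show ?thesis by (simp add: algebra_simps)
  qed
  have left: "\<mu> / D * (ln (D * t0 + e) - ln e) \<le> height l t0 - height l 0"
  proof -
    have p: "0 < D * (t0 - t) + e" if "0 \<le> t" "t \<le> t0" for t
      using D e that by (intro add_nonneg_pos) auto
    have nz: "D * (t0 - t) + e \<noteq> 0" if "0 \<le> t" "t \<le> t0" for t
      using p[OF that] by simp
    have "(\<lambda>t. height l t + \<mu> / D * ln (D * (t0 - t) + e)) 0 \<le> (\<lambda>t. height l t + \<mu> / D * ln (D * (t0 - t) + e)) t0"
    proof (rule DERIV_nonneg_imp_increasing_open[where f = "\<lambda>t. height l t + \<mu> / D * ln (D * (t0 - t) + e)"])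
      fix t assume t: "0 < t" "t < t0"
      have "((\<lambda>t. height l t + \<mu> / D * ln (D * (t0 - t) + e)) has_real_derivative m t / speed l t - \<mu> / (D * (t0 - t) + e)) (at t)"
        using t t0 p[of t] D by (auto intro!: derivative_eq_intros der)
      moreover have "0 \<le> m t / speed l t - \<mu> / (D * (t0 - t) + e)"
        using lower[of t] t t0 by auto
      ultimately show "\<exists>y. ((\<lambda>t. height l t + \<mu> / D * ln (D * (t0 - t) + e)) has_real_derivative y) (at t) \<and> 0 \<le> y"
        by blast
    next
      show "continuous_on {0..t0} (\<lambda>t. height l t + \<mu> / D * ln (D * (t0 - t) + e))"
        by (intro continuous_intros continuous_on_subset[OF cont]) (use t0 nz in auto)
    qed (use t0 in auto)
    then show ?thesis by (simp add: algebra_simps)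
  qed
  have half: "\<mu> / D * (ln (D * (1 / 2)) - ln e) \<le> \<mu> / D * (ln (D * r + e) - ln e)" if "1 / 2 \<le> r" for r
  proof -
    have "D * (1 / 2) \<le> D * r" by (rule mult_left_mono) (use that D in auto)
    then have "ln (D * (1 / 2)) \<le> ln (D * r + e)" using D e by (intro ln_mono) linarith+
    then show ?thesis using \<mu> D by (intro mult_left_mono diff_right_mono) auto
  qed
  have "d \<le> width l"
  proof (cases "t0 \<le> 1 / 2")
    case True
    then show ?thesis using right half[of "1 - t0"] d nonneg by (auto simp: width_def height_0)
  next
    case False
    then show ?thesis using left half[of t0] d nonneg by (auto simp: width_def height_0)
  qed
  with l show ?thesis by blast
qed

text \<open>The value of \<open>l\<close> that a section of the given width enforces.\<close>

definition head_of_width :: "real \<Rightarrow> real" where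
  "head_of_width = inv_into heads width"

lemma head_width: "l \<in> heads \<Longrightarrow> head_of_width (width l) = l"
  by (simp add: head_of_width_def inv_into_f_f[OF inj_width])

text \<open>Intermediate value theorem, between a value of \<open>l\<close> with large width and one so large that
  \<open>width l \<le> max m / sqrt l \<le> d\<close>.\<close>

lemma width_attained:
  assumes d: "0 < d"
  shows "d \<in> width ` heads"
proof -
  obtain M where M: "\<And>t. t \<in> {0..1} \<Longrightarrow> m t \<le> M"
    using continuous_attains_sup[OF compact_Icc _ cont_m] by (metis atLeastAtMost_iff empty_iff zero_le_one order_refl)
  have M0: "M > 0" using M[of 0] m_pos[of 0] by simp
  obtain a where a: "a \<in> heads" "d \<le> width a" using width_unbounded by blast
  define b where "b = max a ((M / d)\<^sup>2)"
  have "0 < (M / d)\<^sup>2" using M0 d by simp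
  also have "\<dots> \<le> b" unfolding b_def by (rule max.cobounded2)
  finally have b: "b > 0" .
  have "M / d \<le> sqrt b" unfolding b_def by (rule real_le_rsqrt) (rule max.cobounded2)
  then have "M / sqrt b \<le> d" using d b by (simp add: divide_simps mult.commute)
  with width_upper_bound[OF M b] have wb: "width b \<le> d" by (rule order_trans)
  obtain t0 where heads: "heads = {- (m t0)\<^sup>2<..}" by (rule minimum)
  have sub: "{a..b} \<subseteq> heads" using a(1) unfolding heads by auto
  have "continuous_on {a..b} width"
  proof (rule DERIV_continuous_on)
    show "(width has_real_derivative height_head l 1) (at l within {a..b})" if "l \<in> {a..b}" for l
      by (rule has_field_derivative_at_within[OF width_DERIV]) (rule subsetD[OF sub that])
  qed
  moreover have "a \<le> b" unfolding b_def by (rule max.cobounded1)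
  ultimately obtain l where "a \<le> l" "l \<le> b" "width l = d"
    using IVT2'[of width b d a] wb a(2) by blast
  with sub show ?thesis by auto
qed

lemma head_in_heads: "0 < d \<Longrightarrow> head_of_width d \<in> heads"
  unfolding head_of_width_def by (rule inv_into_into[OF width_attained])

lemma width_head: "0 < d \<Longrightarrow> width (head_of_width d) = d"
  unfolding head_of_width_def by (rule f_inv_into_f[OF width_attained])

lemma head_DERIV:
  assumes d: "0 < d"
  shows "(head_of_width has_real_derivative 1 / height_head (head_of_width d) 1) (at d)"
proof -
  have l: "head_of_width d \<in> heads" using head_in_heads[OF d] .
  from open_heads[unfolded open_contains_cball, rule_format, OF l]
  obtain e where e: "e > 0" "cball (head_of_width d) e \<subseteq> heads" by (elim exE conjE)
  have "isCont head_of_width (width (head_of_width d))"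
  proof (rule isCont_inverse_function2[where f = width and g = head_of_width and a = "head_of_width d - e" and b = "head_of_width d + e"])
    show "head_of_width d - e < head_of_width d" "head_of_width d < head_of_width d + e" using e(1) by simp_all
    fix z assume "head_of_width d - e \<le> z" "z \<le> head_of_width d + e"
    then have "z \<in> cball (head_of_width d) e" by (simp add: dist_real_def abs_le_iff)
    with e(2) have z: "z \<in> heads" by (rule subsetD)
    show "head_of_width (width z) = z" by (rule head_width[OF z])
    show "isCont width z" by (rule DERIV_isCont[OF width_DERIV[OF z]])
  qed
  then have cont: "isCont head_of_width d" unfolding width_head[OF d] .
  have "(head_of_width has_real_derivative inverse (height_head (head_of_width d) 1)) (at d)"
  proof (rule DERIV_inverse_function[where f = width and g = head_of_width and a = 0 and b = "d + 1"])
    show "(width has_real_derivative height_head (head_of_width d) 1) (at (head_of_width d))" by (rule width_DERIV[OF l])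
    show "height_head (head_of_width d) 1 \<noteq> 0" using height_head_1_neg[OF l] by simp
    show "width (head_of_width y) = y" if "0 < y" for y by (rule width_head[OF that])
    show "0 < d" "d < d + 1" using d by simp_all
    show "isCont head_of_width d" by (rule cont)
  qed
  then show ?thesis by (simp add: inverse_eq_divide)
qed

end

section \<open>Label, velocity and drift as functions of the section parameter and the height\<close>

context inflow_profile begin

text \<open>In a section with parameter \<open>l\<close>, the point at height \<open>y\<close> above the lower wall lies on the streamline with this
  label. The drift is the vertical displacement of that streamline per unit change of \<open>l\<close>.\<close>

definition label :: "real \<Rightarrow> real \<Rightarrow> real" where
  "label l y = fibre_inverse height l y"

definition velocity :: "real \<Rightarrow> real \<Rightarrow> real" where
  "velocity l y = speed l (label l y)"

definition drift :: "real \<Rightarrow> real \<Rightarrow> real" where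
  "drift l y = height_head l (label l y)"

definition channel :: "(real \<times> real) set" where
  "channel = {(l, y). l \<in> heads \<and> 0 < y \<and> y < width l}"

definition closed_channel :: "(real \<times> real) set" where
  "closed_channel = {(l, y). l \<in> heads \<and> 0 \<le> y \<and> y \<le> width l}"

lemma channel_subset: "channel \<subseteq> closed_channel"
  by (auto simp: channel_def closed_channel_def)

lemma height_slope_pos: "l \<in> heads \<Longrightarrow> t \<in> {0..1} \<Longrightarrow> 0 < m t / speed l t"
  by (simp add: m_pos speed_pos)

lemmas height_fibre = continuous_on_height height_DERIV(1) height_slope_pos

lemma label_height: "l \<in> heads \<Longrightarrow> t \<in> {0..1} \<Longrightarrow> label l (height l t) = t"
  unfolding label_def by (rule fibre_inverse_left[OF height_fibre])

lemma label_in: "(l, y) \<in> closed_channel \<Longrightarrow> label l y \<in> {0..1}"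
  using fibre_inverse_right[OF height_fibre, of l y]
  by (auto simp: label_def closed_channel_def height_0 width_def)

lemma label_in_interior: "(l, y) \<in> channel \<Longrightarrow> label l y \<in> {0<..<1}"
  using fibre_inverse_interior[OF height_fibre, of l y]
  by (auto simp: label_def channel_def height_0 width_def)

lemma label_0: "l \<in> heads \<Longrightarrow> label l 0 = 0"
  using label_height[of l 0] by (simp add: height_0)

lemma label_width: "l \<in> heads \<Longrightarrow> label l (width l) = 1"
  using label_height[of l 1] by (simp add: width_def)

lemma continuous_on_label: "continuous_on closed_channel (\<lambda>(l, y). label l y)"
  using continuous_on_fibre_inverse[OF height_fibre]
  by (simp add: label_def closed_channel_def height_0 width_def)

lemma continuous_on_label_compose:
  assumes "continuous_on (heads \<times> {0..1}) (\<lambda>(l, t). f l t)"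
  shows "continuous_on closed_channel (\<lambda>(l, y). f l (label l y))"
proof -
  have "continuous_on closed_channel (\<lambda>p. (fst p, (\<lambda>(l, y). label l y) p))"
    by (intro continuous_intros continuous_on_label)
  moreover have "(\<lambda>p. (fst p, (\<lambda>(l, y). label l y) p)) ` closed_channel \<subseteq> heads \<times> {0..1}"
    using label_in by (auto simp: closed_channel_def)
  ultimately have "continuous_on closed_channel (\<lambda>p. (\<lambda>(l, t). f l t) (fst p, (\<lambda>(l, y). label l y) p))"
    by (rule continuous_on_compose2[OF assms])
  then show ?thesis by (simp add: case_prod_unfold)
qed

lemma continuous_on_velocity: "continuous_on closed_channel (\<lambda>(l, y). velocity l y)"
  unfolding velocity_def by (rule continuous_on_label_compose[OF continuous_on_speed])

lemma continuous_on_drift: "continuous_on closed_channel (\<lambda>(l, y). drift l y)"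
  unfolding drift_def by (rule continuous_on_label_compose[OF continuous_on_height_head])

lemma continuous_on_vorticity: "continuous_on closed_channel (\<lambda>(l, y). m' (label l y))"
proof (rule continuous_on_label_compose)
  show "continuous_on (heads \<times> {0..1}) (\<lambda>(l, t). m' t)"
    unfolding case_prod_unfold by (rule continuous_on_compose2[OF cont_m']) (auto intro: continuous_intros)
qed

lemma velocity_pos: "(l, y) \<in> closed_channel \<Longrightarrow> 0 < velocity l y"
  unfolding velocity_def using label_in by (intro speed_pos) (auto simp: closed_channel_def)

lemma velocity_0: "y \<in> {0..1} \<Longrightarrow> velocity 0 y = m y"
proof -
  assume y: "y \<in> {0..1}"
  have "height 0 y = integral {0..y} (\<lambda>s. 1)"
    unfolding height_def
  proof (rule Henstock_Kurzweil_Integration.integral_cong)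
    show "m s / speed 0 s = 1" if "s \<in> {0..y}" for s
      using m_pos[of s] speed_0[of s] that y by simp
  qed
  then have "label 0 y = y" using label_height[OF zero_in_heads y] y by simp
  then show ?thesis using speed_0[OF y] by (simp add: velocity_def)
qed

lemma continuous_on_width: "continuous_on heads width"
  by (rule DERIV_continuous_on[OF has_field_derivative_at_within[OF width_DERIV]])

lemma open_channel: "open channel"
proof -
  have "continuous_on (heads \<times> UNIV) (\<lambda>p. width (fst p) - snd p)"
    by (intro continuous_intros continuous_on_compose2[OF continuous_on_width]) auto
  then have "open ((heads \<times> UNIV) \<inter> (\<lambda>p. width (fst p) - snd p) -` {0<..})"
    by (intro continuous_open_preimage open_Times open_heads) auto
  moreover have "open (heads \<times> {0::real<..})"
    by (intro open_Times open_heads) simp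
  ultimately have "open ((heads \<times> UNIV) \<inter> (\<lambda>p. width (fst p) - snd p) -` {0<..} \<inter> heads \<times> {0<..})"
    by (rule open_Int)
  also have "\<dots> = channel" by (auto simp: channel_def)
  finally show ?thesis .
qed

lemma label_has_derivative:
  assumes "(l, y) \<in> channel"
  defines "t \<equiv> label l y"
  shows "((\<lambda>(l, y). label l y) has_derivative
    (\<lambda>(h, k). - height_head l t / (m t / speed l t) * h + 1 / (m t / speed l t) * k)) (at (l, y))"
  unfolding label_def t_def
proof (rule has_derivative_fibre_inverse[OF height_fibre open_heads])
  show "((\<lambda>l. height l t) has_real_derivative height_head l t) (at l)"
    if "l \<in> heads" "t \<in> {0<..<1}" for l t
    using height_DERIV_head[of l t] that by simp
  show "continuous_on (heads \<times> {0<..<1}) (\<lambda>(l, t). m t / speed l t)"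
    by (rule continuous_on_subset[OF continuous_on_height_integrands(1)]) auto
  show "continuous_on heads (\<lambda>l. height l 0)" "continuous_on heads (\<lambda>l. height l 1)"
    using continuous_on_width by (simp_all add: height_0 width_def[abs_def])
qed (use assms in \<open>auto simp: channel_def height_0 width_def\<close>)

text \<open>The \<open>y\<close>-derivative \<open>m' (label l y)\<close> is the vorticity; it is transported by the flow, and so depends on the label
  only. In the \<open>l\<close>-derivative, the first summand is the change of speed on a fixed streamline, the second one is due
  to the displacement of the streamlines.\<close>

lemma velocity_has_derivative:
  assumes ly: "(l, y) \<in> channel"
  shows "((\<lambda>(l, y). velocity l y) has_derivative
    (\<lambda>(h, k). (1 / (2 * velocity l y) - m' (label l y) * drift l y) * h + m' (label l y) * k)) (at (l, y))"
proof -
  define t where "t = label l y"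
  have t: "t \<in> {0<..<1}" and l: "l \<in> heads"
    using label_in_interior[OF ly] ly by (auto simp: t_def channel_def)
  have t': "t \<in> {0..1}" using t by auto
  have speed_der: "((\<lambda>p. speed (fst p) (snd p)) has_derivative (\<lambda>(h, k). 1 / (2 * speed l t) * h + m t * m' t / speed l t * k)) (at (l, t))"
  proof -
    have pos: "0 < (m t)\<^sup>2 + l" using l t' by (auto simp: heads_def)
    have m: "(m has_derivative (\<lambda>h. m' t * h)) (at (snd (l, t)))"
      using der_m_interior[OF t] by (simp add: has_field_derivative_def)
    have msnd: "((\<lambda>p. m (snd p)) has_derivative (\<lambda>p. m' t * snd p)) (at (l, t))"
      using has_derivative_compose[OF has_derivative_snd[OF has_derivative_ident] m] .
    have sq: "((\<lambda>p. (m (snd p))\<^sup>2 + fst p) has_derivative (\<lambda>p. 2 * m t * (m' t * snd p) + fst p)) (at (l, t))"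
      by (rule has_derivative_eq_rhs, rule has_derivative_add[OF has_derivative_power[OF msnd] has_derivative_fst[OF has_derivative_ident]])
         (auto simp: fun_eq_iff)
    have "(sqrt has_derivative (\<lambda>h. 1 / (2 * speed l t) * h)) (at ((m (snd (l, t)))\<^sup>2 + fst (l, t)))"
    proof -
      have "(sqrt has_real_derivative 1 / (2 * speed l t)) (at ((m t)\<^sup>2 + l))"
        using DERIV_real_sqrt[OF pos] by (simp add: speed_def divide_simps mult.commute)
      then show ?thesis unfolding has_field_derivative_def by (simp only: fst_conv snd_conv)
    qed
    from has_derivative_compose[OF sq this]
    show ?thesis unfolding speed_def
      by (rule has_derivative_eq_rhs) (auto simp: fun_eq_iff add_divide_distrib)
  qed
  define g where "g p = (fst p, (\<lambda>(l, y). label l y) p)" for p :: "real \<times> real"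
  have dg: "(g has_derivative
      (\<lambda>p. (fst p, (\<lambda>(h, k). - height_head l t / (m t / speed l t) * h + 1 / (m t / speed l t) * k) p))) (at (l, y))"
    unfolding g_def[abs_def] using label_has_derivative[OF ly]
    by (intro has_derivative_Pair has_derivative_fst has_derivative_ident) (simp add: t_def)
  have "g (l, y) = (l, t)" by (simp add: g_def t_def)
  with speed_der have "((\<lambda>p. speed (fst p) (snd p)) has_derivative (\<lambda>(h, k). 1 / (2 * speed l t) * h + m t * m' t / speed l t * k)) (at (g (l, y)))"
    by (simp only:)
  note has_derivative_compose[OF dg this]
  moreover have "(\<lambda>p. speed (fst (g p)) (snd (g p))) = (\<lambda>(l, y). velocity l y)"
    by (auto simp: g_def velocity_def)
  ultimately show ?thesis
    using m_pos[OF t'] speed_pos[OF l t']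
    by (simp only:) (erule has_derivative_eq_rhs,
       auto simp: fun_eq_iff velocity_def drift_def t_def[symmetric] field_simps)
qed

lemma label_DERIV:
  assumes ly: "(l, y) \<in> channel"
  shows "(label l has_real_derivative velocity l y / m (label l y)) (at y)"
  using DERIV_along_curve[where f = "\<lambda>(l, y). label l y" and a = "\<lambda>_. l" and b = "\<lambda>y. y" and t = y,
      OF label_has_derivative[OF ly] DERIV_const DERIV_ident]
  by (simp add: velocity_def)

lemma velocity_DERIV:
  assumes ly: "(l, y) \<in> channel"
  shows "(velocity l has_real_derivative m' (label l y)) (at y)"
  using DERIV_along_curve[where f = "\<lambda>(l, y). velocity l y" and a = "\<lambda>_. l" and b = "\<lambda>y. y" and t = y,
      OF velocity_has_derivative[OF ly] DERIV_const DERIV_ident]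
  by simp

lemma drift_DERIV:
  assumes ly: "(l, y) \<in> channel"
  shows "(drift l has_real_derivative - 1 / (2 * (velocity l y)\<^sup>2)) (at y)"
proof -
  define t where "t = label l y"
  have t: "t \<in> {0<..<1}" and l: "l \<in> heads"
    using label_in_interior[OF ly] ly by (auto simp: t_def channel_def)
  have t': "t \<in> {0..1}" using t by auto
  have "(height_head l has_real_derivative - m t / (2 * speed l t ^ 3)) (at (label l y))"
    using height_DERIV(2)[OF l t'] t by (auto simp: at_within_Icc_at t_def)
  from DERIV_chain2[OF this label_DERIV[OF ly]]
  show ?thesis
    using m_pos[OF t'] speed_pos[OF l t']
    by (simp add: drift_def[abs_def] velocity_def t_def[symmetric] field_simps power2_eq_square power3_eq_cube)
qed

section \<open>The downstream profile\<close>

text \<open>The upstream stream function: the flux below the streamline with a given label. It is inverted by \<open>kappa m\<close>.\<close>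

definition stream :: "real \<Rightarrow> real" where
  "stream t = integral {0..t} m"

lemma stream_DERIV: "t \<in> {0..1} \<Longrightarrow> (stream has_real_derivative m t) (at t within {0..1})"
  unfolding stream_def[abs_def] by (rule integral_has_real_derivative[OF cont_m])

lemma continuous_on_stream: "continuous_on {0..1} stream"
  using stream_DERIV by (rule DERIV_continuous_on)

lemma stream_0: "stream 0 = 0" and stream_1: "stream 1 = flux m"
  by (simp_all add: stream_def flux_def)

lemma stream_strict_mono:
  assumes "0 \<le> s" "s < t" "t \<le> 1"
  shows "stream s < stream t"
proof (rule DERIV_pos_imp_increasing_open[OF assms(2)])
  show "\<exists>y. (stream has_real_derivative y) (at r) \<and> 0 < y" if "s < r" "r < t" for r
    using stream_DERIV[of r] m_pos[of r] that assms by (auto simp: at_within_Icc_at)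
  show "continuous_on {s..t} stream"
    by (rule continuous_on_subset[OF continuous_on_stream]) (use assms in auto)
qed

lemma inj_on_stream: "inj_on stream {0..1}"
proof (rule inj_onI)
  fix s t :: real assume "s \<in> {0..1}" "t \<in> {0..1}" "stream s = stream t"
  then show "s = t"
    using stream_strict_mono[of s t] stream_strict_mono[of t s] by (cases s t rule: linorder_cases) auto
qed

lemma kappa_stream: "t \<in> {0..1} \<Longrightarrow> kappa m (stream t) = t"
  unfolding kappa_def stream_def[abs_def, symmetric] by (rule inv_into_f_f[OF inj_on_stream])

lemma stream_image: "stream ` {0..1} = {0..flux m}"
proof
  show "stream ` {0..1} \<subseteq> {0..flux m}"
  proof
    fix z assume "z \<in> stream ` {0..1}"
    then obtain t where t: "t \<in> {0..1}" "z = stream t" by blast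
    have "stream 0 \<le> stream t" "stream t \<le> stream 1"
      using stream_strict_mono[of 0 t] stream_strict_mono[of t 1] t(1)
      by (cases "t = 0"; cases "t = 1"; force)+
    then show "z \<in> {0..flux m}" using t by (simp add: stream_0 stream_1)
  qed
  show "{0..flux m} \<subseteq> stream ` {0..1}"
  proof
    fix z assume "z \<in> {0..flux m}"
    then obtain t where "0 \<le> t" "t \<le> 1" "stream t = z"
      using IVT'[of stream 0 z 1] continuous_on_stream by (auto simp: stream_0 stream_1)
    then show "z \<in> stream ` {0..1}" by auto
  qed
qed

lemma kappa_in: "z \<in> {0..flux m} \<Longrightarrow> kappa m z \<in> {0..1}"
  and stream_kappa: "z \<in> {0..flux m} \<Longrightarrow> stream (kappa m z) = z"
  by (auto simp: stream_image[symmetric] kappa_stream)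

lemma continuous_on_kappa: "continuous_on {0..flux m} (kappa m)"
  unfolding stream_image[symmetric]
  by (rule continuous_on_inv[OF continuous_on_stream]) (auto simp: kappa_stream)

text \<open>The derivative is taken within the closed interval, because a solution of the downstream problem is not known in
  advance to avoid the end points at interior times.\<close>

lemma kappa_DERIV:
  assumes t: "t \<in> {0..1}"
  shows "(kappa m has_real_derivative 1 / m t) (at (stream t) within {0..flux m})"
proof -
  have "(kappa m has_derivative (*) (1 / m t)) (at (stream t) within stream ` {0..1})"
  proof (rule has_derivative_inverse_within[where f' = "(*) (m t)"])
    show "(stream has_derivative (*) (m t)) (at t within {0..1})"
      using stream_DERIV[OF t] by (simp add: has_field_derivative_def)
    show "continuous (at (stream t) within stream ` {0..1}) (kappa m)"
      using continuous_on_kappa t unfolding stream_image[symmetric]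
      by (auto simp: continuous_on_eq_continuous_within)
    show "linear ((*) (1 / m t))" by (rule bounded_linear.linear[OF bounded_linear_mult_right])
    show "(*) (1 / m t) \<circ> (*) (m t) = id" using m_pos[OF t] by (auto simp: fun_eq_iff)
  qed (use t kappa_stream in auto)
  then show ?thesis by (simp add: has_field_derivative_def stream_image)
qed

lemma vort_stream:
  assumes t: "t \<in> {0..1}"
  shows "vort m (stream t) = m' t"
  unfolding vort_def kappa_stream[OF t]
  using der_m[OF t] t
  by (intro vector_derivative_within_closed_interval) (auto simp: has_real_derivative_iff_has_vector_derivative)

text \<open>The stream function of the limiting straight channel of width \<open>\<sigma>\<close>, rescaled to the unit interval.\<close>

definition downstream :: "real \<Rightarrow> real \<Rightarrow> real" where
  "downstream \<sigma> s = stream (label (head_of_width \<sigma>) (\<sigma> * s))"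

context
  fixes \<sigma> :: real
  assumes \<sigma>: "0 < \<sigma>"
begin

lemma downstream_in_channel:
  "s \<in> {0..1} \<Longrightarrow> (head_of_width \<sigma>, \<sigma> * s) \<in> closed_channel"
  "s \<in> {0<..<1} \<Longrightarrow> (head_of_width \<sigma>, \<sigma> * s) \<in> channel"
  using \<sigma> head_in_heads[OF \<sigma>] width_head[OF \<sigma>] by (auto simp: closed_channel_def channel_def)

lemma downstream_DERIV:
  assumes s: "s \<in> {0<..<1}"
  shows "(downstream \<sigma> has_real_derivative \<sigma> * velocity (head_of_width \<sigma>) (\<sigma> * s)) (at s)"
proof -
  have t: "label (head_of_width \<sigma>) (\<sigma> * s) \<in> {0<..<1}"
    using label_in_interior[OF downstream_in_channel(2)[OF s]] .
  have lin: "((\<lambda>s. \<sigma> * s) has_real_derivative \<sigma>) (at s)"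
    by (auto intro!: derivative_eq_intros)
  have st: "(stream has_real_derivative m (label (head_of_width \<sigma>) (\<sigma> * s))) (at (label (head_of_width \<sigma>) (\<sigma> * s)))"
    using stream_DERIV[of "label (head_of_width \<sigma>) (\<sigma> * s)"] t by (auto simp: at_within_Icc_at)
  from DERIV_chain2[OF st DERIV_chain2[OF label_DERIV[OF downstream_in_channel(2)[OF s]] lin]]
  show ?thesis
    using m_pos[of "label (head_of_width \<sigma>) (\<sigma> * s)"] t by (simp add: downstream_def[abs_def] mult.commute)
qed

lemma deriv_downstream:
  "s \<in> {0<..<1} \<Longrightarrow> deriv (downstream \<sigma>) s = \<sigma> * velocity (head_of_width \<sigma>) (\<sigma> * s)"
  by (rule DERIV_imp_deriv[OF downstream_DERIV])

lemma downstream_stream_fun_downstream: "downstream_stream_fun m \<sigma> (downstream \<sigma>)"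
  unfolding downstream_stream_fun_def
proof (intro conjI ballI)
  show "downstream \<sigma> \<in> {0..1} \<rightarrow> {0..flux m}"
    using label_in[OF downstream_in_channel(1)] stream_image by (fastforce simp: downstream_def)
  have lab: "continuous_on {0..1} (\<lambda>s. (\<lambda>(l, y). label l y) (head_of_width \<sigma>, \<sigma> * s))"
    by (rule continuous_on_compose2[OF continuous_on_label])
       (use downstream_in_channel(1) in \<open>auto intro!: continuous_intros\<close>)
  show "continuous_on {0..1} (downstream \<sigma>)"
    unfolding downstream_def[abs_def]
    by (rule continuous_on_compose2[OF continuous_on_stream])
       (use lab label_in[OF downstream_in_channel(1)] in auto)
  fix s :: real assume s: "s \<in> {0<..<1}"
  show "downstream \<sigma> differentiable at s"
    using downstream_DERIV[OF s] by (auto simp: real_differentiable_def)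
  have t: "label (head_of_width \<sigma>) (\<sigma> * s) \<in> {0..1}"
    using label_in[OF downstream_in_channel(1), of s] s by auto
  have lin: "((\<lambda>s. \<sigma> * s) has_real_derivative \<sigma>) (at s)"
    by (auto intro!: derivative_eq_intros)
  have "((\<lambda>s. \<sigma> * velocity (head_of_width \<sigma>) (\<sigma> * s)) has_real_derivative \<sigma> * (m' (label (head_of_width \<sigma>) (\<sigma> * s)) * \<sigma>)) (at s)"
    by (rule DERIV_cmult, rule DERIV_chain2[OF velocity_DERIV[OF downstream_in_channel(2)[OF s]] lin])
  then have "((\<lambda>s. \<sigma> * velocity (head_of_width \<sigma>) (\<sigma> * s)) has_real_derivative \<sigma>\<^sup>2 * vort m (downstream \<sigma> s)) (at s)"
    by (simp add: downstream_def vort_stream[OF t] power2_eq_square ac_simps)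
  then show "(deriv (downstream \<sigma>) has_real_derivative \<sigma>\<^sup>2 * vort m (downstream \<sigma> s)) (at s)"
    by (rule has_field_derivative_transform_within_open[of _ _ _ "{0<..<1}"])
       (use s deriv_downstream in auto)
next
  show "downstream \<sigma> 0 = 0"
    by (simp add: downstream_def label_0[OF head_in_heads[OF \<sigma>]] stream_0)
  show "downstream \<sigma> 1 = flux m"
    using label_width[OF head_in_heads[OF \<sigma>]] by (simp add: downstream_def stream_1 width_head[OF \<sigma>])
qed

text \<open>The label \<open>u = kappa m \<circ> \<psi>\<close> satisfies \<open>u' = \<psi>' / m u\<close>, and the equation has the first integral
  \<open>\<psi>'\<^sup>2 = \<sigma>\<^sup>2 ((m u)\<^sup>2 + l)\<close>. Once \<open>l \<in> heads\<close> is known, \<open>\<psi>'\<close> has no zero, so it is positive, and \<open>height l (u s)\<close> grows at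
  the constant rate \<open>\<sigma>\<close>. Its value at \<open>1\<close> determines \<open>l\<close>.\<close>

lemma downstream_unique:
  assumes \<psi>: "downstream_stream_fun m \<sigma> \<psi>" and s: "s \<in> {0..1}"
  shows "\<psi> s = downstream \<sigma> s"
proof -
  define u where "u s = kappa m (\<psi> s)" for s
  define \<psi>' where "\<psi>' = deriv \<psi>"
  have range: "\<psi> s \<in> {0..flux m}" if "s \<in> {0..1}" for s
    using \<psi> that by (auto simp: downstream_stream_fun_def)
  have cont: "continuous_on {0..1} \<psi>" and ends: "\<psi> 0 = 0" "\<psi> 1 = flux m"
    using \<psi> by (auto simp: downstream_stream_fun_def)
  have u: "u s \<in> {0..1}" "stream (u s) = \<psi> s" if "s \<in> {0..1}" for s
    using kappa_in stream_kappa range that by (auto simp: u_def)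
  have der: "(\<psi> has_real_derivative \<psi>' s) (at s)" if "s \<in> {0<..<1}" for s
    using \<psi> that by (auto simp: downstream_stream_fun_def \<psi>'_def DERIV_deriv_iff_real_differentiable)
  have der': "(\<psi>' has_real_derivative \<sigma>\<^sup>2 * m' (u s)) (at s)" if "s \<in> {0<..<1}" for s
  proof -
    have "(\<psi>' has_real_derivative \<sigma>\<^sup>2 * vort m (\<psi> s)) (at s)"
      using \<psi> that by (auto simp: downstream_stream_fun_def \<psi>'_def)
    moreover have "vort m (\<psi> s) = m' (u s)"
      using u[of s] vort_stream[of "u s"] that by simp
    ultimately show ?thesis by simp
  qed
  have u_cont: "continuous_on {0..1} u"
    unfolding u_def[abs_def] by (rule continuous_on_compose2[OF continuous_on_kappa cont]) (use range in auto)
  have u_der: "(u has_real_derivative \<psi>' s / m (u s)) (at s)" if s: "s \<in> {0<..<1}" for s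
  proof -
    have "(kappa m has_real_derivative 1 / m (u s)) (at (\<psi> s) within \<psi> ` {0<..<1})"
      using kappa_DERIV[OF u(1), of s] u(2)[of s] s range
      by (auto intro: DERIV_subset)
    from DERIV_image_chain[OF this has_field_derivative_at_within[OF der[OF s]]]
    have "(u has_real_derivative \<psi>' s / m (u s)) (at s within {0<..<1})"
      by (simp add: u_def[abs_def] o_def)
    then show ?thesis using s by (simp add: at_within_open[of _ "{0<..<1}"])
  qed
  have mu_der: "((\<lambda>s. m (u s)) has_real_derivative m' (u s) * (\<psi>' s / m (u s))) (at s)" if s: "s \<in> {0<..<1}" for s
  proof -
    have "(m has_real_derivative m' (u s)) (at (u s) within u ` {0<..<1})"
      using der_m[OF u(1), of s] s u(1) by (auto intro: DERIV_subset)
    from DERIV_image_chain[OF this has_field_derivative_at_within[OF u_der[OF s]]]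
    show ?thesis using s by (simp add: o_def at_within_open[of _ "{0<..<1}"])
  qed
  have mu_pos: "0 < m (u s)" if "s \<in> {0..1}" for s by (rule m_pos[OF u(1)[OF that]])
  obtain l where energy: "\<And>s. s \<in> {0<..<1} \<Longrightarrow> (\<psi>' s)\<^sup>2 = \<sigma>\<^sup>2 * ((m (u s))\<^sup>2 + l)"
  proof -
    have "((\<lambda>s. (\<psi>' s)\<^sup>2 - \<sigma>\<^sup>2 * (m (u s))\<^sup>2) has_real_derivative 0) (at s within {0<..<1})" if s: "s \<in> {0<..<1}" for s
    proof -
      have "((\<lambda>s. (\<psi>' s)\<^sup>2) has_real_derivative 2 * (\<sigma>\<^sup>2 * (m' (u s) * \<psi>' s))) (at s)"
        using DERIV_power[OF der'[OF s], of 2] by (simp add: mult.assoc)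
      moreover have "((\<lambda>s. (m (u s))\<^sup>2) has_real_derivative 2 * (m' (u s) * \<psi>' s)) (at s)"
        using DERIV_power[OF mu_der[OF s], of 2] mu_pos[of s] s by simp
      ultimately have "((\<lambda>s. (\<psi>' s)\<^sup>2 - \<sigma>\<^sup>2 * (m (u s))\<^sup>2) has_real_derivative
          2 * (\<sigma>\<^sup>2 * (m' (u s) * \<psi>' s)) - \<sigma>\<^sup>2 * (2 * (m' (u s) * \<psi>' s))) (at s)"
        by (intro DERIV_diff DERIV_cmult)
      then show ?thesis by (simp add: has_field_derivative_at_within)
    qed
    then obtain c where c: "\<And>s. s \<in> {0<..<1} \<Longrightarrow> (\<psi>' s)\<^sup>2 - \<sigma>\<^sup>2 * (m (u s))\<^sup>2 = c"
      using has_field_derivative_zero_constant[of "{0<..<1}" "\<lambda>s. (\<psi>' s)\<^sup>2 - \<sigma>\<^sup>2 * (m (u s))\<^sup>2"] by auto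
    have "(\<psi>' s)\<^sup>2 = \<sigma>\<^sup>2 * ((m (u s))\<^sup>2 + c / \<sigma>\<^sup>2)" if "s \<in> {0<..<1}" for s
      using c[OF that] \<sigma> by (simp add: field_simps)
    then show ?thesis by (rule that)
  qed
  have u0: "u 0 = 0" and u1: "u 1 = 1"
    using kappa_stream[of 0] kappa_stream[of 1] by (simp_all add: u_def ends stream_0 stream_1)
  have l: "l \<in> heads"
  proof -
    obtain t0 where t0: "t0 \<in> {0..1}" "m' t0 = 0" "\<And>t. t \<in> {0..1} \<Longrightarrow> m t0 \<le> m t" "heads = {- (m t0)\<^sup>2<..}"
      using minimum by blast
    obtain D where D: "D > 0" "\<And>t. t \<in> {0..1} \<Longrightarrow> (m t)\<^sup>2 - (m t0)\<^sup>2 \<le> (D * \<bar>t - t0\<bar>)\<^sup>2"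
      using square_growth_from_minimum t0 by metis
    have "- (m t0)\<^sup>2 < l"
    proof (rule ccontr)
      \<comment> \<open>Then \<open>\<bar>u'\<bar>\<close> is bounded by a multiple of \<open>\<bar>u - t0\<bar>\<close>, and \<open>u\<close>, which runs from \<open>0\<close> to \<open>1\<close>, meets \<open>t0\<close>.\<close>
      assume "\<not> - (m t0)\<^sup>2 < l"
      then have neg: "(m t0)\<^sup>2 + l \<le> 0" by simp
      obtain r where r: "r \<in> {0..1}" "u r = t0"
        using IVT'[of u 0 t0 1] t0(1) u_cont by (auto simp: u0 u1)
      have "u s - t0 = 0" if "s \<in> {0..1}" for s
      proof (rule vanishes_of_derivative_bounded_by_value[where u = "\<lambda>s. u s - t0" and a = 0 and b = 1 and r = r and u' = "\<lambda>s. \<psi>' s / m (u s)" and C = "\<sigma> * D / m t0"])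
        show "continuous_on {0..1} (\<lambda>s. u s - t0)" by (intro continuous_intros u_cont)
        show "((\<lambda>s. u s - t0) has_real_derivative \<psi>' s / m (u s)) (at s)" if "s \<in> {0<..<1}" for s
          by (auto intro!: derivative_eq_intros u_der[OF that])
        show "\<bar>\<psi>' s / m (u s)\<bar> \<le> \<sigma> * D / m t0 * \<bar>u s - t0\<bar>" if "s \<in> {0<..<1}" for s
        proof -
          have us: "u s \<in> {0..1}" using u(1) that by simp
          have "(\<psi>' s)\<^sup>2 \<le> \<sigma>\<^sup>2 * (D * \<bar>u s - t0\<bar>)\<^sup>2"
            unfolding energy[OF that] using D(2)[OF us] neg by (intro mult_left_mono) auto
          then have "\<bar>\<psi>' s\<bar> \<le> \<sigma> * (D * \<bar>u s - t0\<bar>)"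
            using \<sigma> D by (intro abs_le_square_iff[THEN iffD2, of "\<psi>' s" "\<sigma> * (D * \<bar>u s - t0\<bar>)", simplified abs_mult abs_abs, THEN order_trans])
              (auto simp: power_mult_distrib)
          then have "\<bar>\<psi>' s\<bar> / m (u s) \<le> (\<sigma> * (D * \<bar>u s - t0\<bar>)) / m t0"
            using t0(3)[OF us] m_pos[OF t0(1)] \<sigma> D by (intro frac_le) auto
          then show ?thesis using m_pos[OF us] by (simp add: abs_divide)
        qed
      qed (use r that in auto)
      from this[of 0] this[of 1] show False by (simp add: u0 u1)
    qed
    then show ?thesis by (simp add: t0)
  qed
  have nz: "\<psi>' s \<noteq> 0" if "s \<in> {0<..<1}" for s
    using energy[OF that] speed_square[OF l u(1), of s] speed_pos[OF l u(1), of s] that \<sigma> by auto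
  have pos: "0 < \<psi>' s" if s: "s \<in> {0<..<1}" for s
  proof (rule ccontr)
    assume "\<not> 0 < \<psi>' s"
    then have neg: "\<psi>' s \<le> 0" by simp
    have "0 < flux m" using stream_strict_mono[of 0 1] by (simp add: stream_0 stream_1)
    moreover obtain k z where z: "0 < z" "z < 1" "(\<psi> has_real_derivative k) (at z)" "\<psi> 1 - \<psi> 0 = (1 - 0) * k"
      using MVT[of 0 1 \<psi>] cont der by (auto simp: real_differentiable_def)
    moreover have "k = \<psi>' z" using z der[of z] DERIV_unique by auto
    ultimately have z': "0 < \<psi>' z" by (simp add: ends)
    have "connected (\<psi>' ` {0<..<1})"
      by (intro connected_continuous_image connected_Ioo continuous_at_imp_continuous_on ballI DERIV_isCont[OF der'])
    then have "0 \<in> \<psi>' ` {0<..<1}"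
      using connectedD_interval[of "\<psi>' ` {0<..<1}" "\<psi>' s" "\<psi>' z" 0] s z(1,2) z' neg by auto
    then show False using nz by auto
  qed
  have \<psi>'_eq: "\<psi>' s = \<sigma> * speed l (u s)" if "s \<in> {0<..<1}" for s
  proof -
    have us: "u s \<in> {0..1}" using u(1) that by simp
    have "(\<psi>' s)\<^sup>2 = (\<sigma> * speed l (u s))\<^sup>2"
      using energy[OF that] speed_square[OF l us] by (simp add: power_mult_distrib)
    then show ?thesis
      using pos[OF that] speed_pos[OF l us] \<sigma> by (simp add: power2_eq_iff_nonneg less_imp_le)
  qed
  have height_u: "height l (u s) = \<sigma> * s" if "s \<in> {0..1}" for s
  proof -
    have "continuous_on {0..1} (\<lambda>s. height l (u s) - \<sigma> * s)"
      by (intro continuous_intros continuous_on_compose2[OF continuous_on_slice(1)[OF continuous_on_height l] u_cont])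
         (use u in auto)
    moreover have "((\<lambda>s. height l (u s) - \<sigma> * s) has_real_derivative 0) (at s)" if s: "0 < s" "s < 1" for s
    proof -
      have us: "u s \<in> {0..1}" using u(1) s by simp
      have "(height l has_real_derivative m (u s) / speed l (u s)) (at (u s) within u ` {0<..<1})"
        using height_DERIV(1)[OF l us] u(1) by (auto intro: DERIV_subset)
      from DERIV_image_chain[OF this has_field_derivative_at_within[OF u_der]]
      have "((\<lambda>s. height l (u s)) has_real_derivative \<sigma>) (at s within {0<..<1})"
        using s \<psi>'_eq[of s] m_pos[OF us] speed_pos[OF l us] by (simp add: o_def)
      then have "((\<lambda>s. height l (u s)) has_real_derivative \<sigma>) (at s)"
        using s by (simp add: at_within_open[of _ "{0<..<1}"])
      then show ?thesis by (auto intro!: derivative_eq_intros)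
    qed
    ultimately have "height l (u s) - \<sigma> * s = height l (u 0) - \<sigma> * 0"
      using DERIV_isconst2[of 0 1 "\<lambda>s. height l (u s) - \<sigma> * s" s] that by auto
    then show ?thesis by (simp add: u0 height_0)
  qed
  have "width l = \<sigma>" using height_u[of 1] by (simp add: width_def u1)
  then have "head_of_width \<sigma> = l" using head_width[OF l] by simp
  then have "label (head_of_width \<sigma>) (\<sigma> * s) = u s"
    using height_u[OF s] label_height[OF l u(1)[OF s]] by simp
  then show ?thesis using u(2)[OF s] by (simp add: downstream_def)
qed

end

end

section \<open>Geometry of the nozzle\<close>

locale nozzle_shape =
  fixes s0 s1 s0' s1' :: "real \<Rightarrow> real"
  assumes der_s0: "(s0 has_real_derivative s0' x) (at x)"
    and der_s1: "(s1 has_real_derivative s1' x) (at x)"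
    and cont_s0': "continuous_on UNIV s0'"
    and cont_s1': "continuous_on UNIV s1'"
    and s0_less_s1: "s0 x < s1 x"
begin

abbreviation \<Omega> :: "(real \<times> real) set" where "\<Omega> \<equiv> nozzle s0 s1"

lemma cont_s0: "continuous_on A s0" and cont_s1: "continuous_on A s1"
  using der_s0 der_s1 by (auto intro!: continuous_at_imp_continuous_on DERIV_isCont)

lemma deriv_s0: "deriv s0 x = s0' x" and deriv_s1: "deriv s1 x = s1' x"
  using der_s0 der_s1 by (auto intro: DERIV_imp_deriv)

lemma mem_nozzle: "(x, y) \<in> \<Omega> \<longleftrightarrow> s0 x < y \<and> y < s1 x"
  by (simp add: nozzle_def)

lemma open_nozzle: "open \<Omega>"
proof -
  have "open {p. s0 (fst p) < snd p}" "open {p. snd p < s1 (fst p)}"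
    by (auto intro!: open_Collect_less continuous_intros continuous_on_compose2[OF cont_s0] continuous_on_compose2[OF cont_s1])
  then have "open ({p. s0 (fst p) < snd p} \<inter> {p. snd p < s1 (fst p)})" by (rule open_Int)
  also have "\<dots> = \<Omega>" by (auto simp: nozzle_def)
  finally show ?thesis .
qed

lemma closure_nozzle: "closure \<Omega> = {(x, y). s0 x \<le> y \<and> y \<le> s1 x}"
proof
  have "closed {p. s0 (fst p) \<le> snd p}" "closed {p. snd p \<le> s1 (fst p)}"
    by (auto intro!: closed_Collect_le continuous_intros continuous_on_compose2[OF cont_s0] continuous_on_compose2[OF cont_s1])
  then have "closed ({p. s0 (fst p) \<le> snd p} \<inter> {p. snd p \<le> s1 (fst p)})" by (rule closed_Int)
  also have "{p. s0 (fst p) \<le> snd p} \<inter> {p. snd p \<le> s1 (fst p)} = {(x, y). s0 x \<le> y \<and> y \<le> s1 x}" by auto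
  finally show "closure \<Omega> \<subseteq> {(x, y). s0 x \<le> y \<and> y \<le> s1 x}"
    by (intro closure_minimal) (auto simp: nozzle_def)
  show "{(x, y). s0 x \<le> y \<and> y \<le> s1 x} \<subseteq> closure \<Omega>"
  proof clarify
    fix x y assume "s0 x \<le> y" "y \<le> s1 x"
    then have "(x, y) \<in> closure ({x} \<times> {s0 x<..<s1 x})"
      using s0_less_s1[of x] by (simp add: closure_Times)
    also have "\<dots> \<subseteq> closure \<Omega>" by (intro closure_mono) (auto simp: nozzle_def)
    finally show "(x, y) \<in> closure \<Omega>" .
  qed
qed

lemma frontier_nozzle: "frontier \<Omega> = {(x, y). y = s0 x \<or> y = s1 x}"
proof (rule set_eqI)
  fix q :: "real \<times> real"
  obtain x y where q: "q = (x, y)" by (cases q)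
  show "q \<in> frontier \<Omega> \<longleftrightarrow> q \<in> {(x, y). y = s0 x \<or> y = s1 x}"
    unfolding q frontier_def closure_nozzle interior_open[OF open_nozzle]
    using s0_less_s1[of x] by (auto simp: mem_nozzle)
qed

text \<open>Clearing the normalising factor of the normal leaves the statement that the velocity is tangent to the wall.\<close>

lemma slip_condition_iff:
  "slip_condition s0 s1 v \<longleftrightarrow>
     (\<forall>x. snd (v (x, s0 x)) = fst (v (x, s0 x)) * s0' x \<and> snd (v (x, s1 x)) = fst (v (x, s1 x)) * s1' x)"
proof -
  have low: "v (x, s0 x) \<bullet> nozzle_normal s0 s1 (x, s0 x) = 0 \<longleftrightarrow> snd (v (x, s0 x)) = fst (v (x, s0 x)) * s0' x" for x
  proof -
    have "sqrt (1 + (s0' x)\<^sup>2) \<noteq> 0" using sum_power2_ge_zero[of 1 "s0' x"] by (simp add: add_nonneg_eq_0_iff)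
    then show ?thesis
      by (cases "v (x, s0 x)") (simp add: nozzle_normal_def deriv_s0 field_simps, auto)
  qed
  have up: "v (x, s1 x) \<bullet> nozzle_normal s0 s1 (x, s1 x) = 0 \<longleftrightarrow> snd (v (x, s1 x)) = fst (v (x, s1 x)) * s1' x" for x
  proof -
    have "sqrt (1 + (s1' x)\<^sup>2) \<noteq> 0" using sum_power2_ge_zero[of 1 "s1' x"] by (simp add: add_nonneg_eq_0_iff)
    moreover have "s1 x \<noteq> s0 x" using s0_less_s1[of x] by simp
    ultimately show ?thesis
      by (cases "v (x, s1 x)") (auto simp: nozzle_normal_def deriv_s1 field_simps)
  qed
  show ?thesis
    unfolding slip_condition_def frontier_nozzle by (auto simp: low up)
qed

end

section \<open>The explicit solution\<close>

locale nozzle_inflow = nozzle_shape + inflow_profile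
begin

text \<open>The chain rule explains \<open>lam'\<close>: the width of the section varies at rate \<open>s1' - s0'\<close>, and \<open>height_head l 1\<close> is the
  derivative of \<open>width\<close>.\<close>

definition lam :: "real \<Rightarrow> real" where
  "lam x = head_of_width (s1 x - s0 x)"

definition lam' :: "real \<Rightarrow> real" where
  "lam' x = (s1' x - s0' x) / height_head (lam x) 1"

lemma lam_in_heads: "lam x \<in> heads" and width_lam: "width (lam x) = s1 x - s0 x"
  using s0_less_s1[of x] by (auto simp: lam_def intro: head_in_heads width_head)

lemma lam_DERIV: "(lam has_real_derivative lam' x) (at x)"
proof -
  have "((\<lambda>x. s1 x - s0 x) has_real_derivative s1' x - s0' x) (at x)"
    by (intro DERIV_diff der_s0 der_s1)
  from DERIV_chain2[OF head_DERIV this] s0_less_s1[of x]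
  show ?thesis by (simp add: lam_def[abs_def] lam'_def)
qed

lemma cont_lam: "continuous_on A lam"
  by (intro continuous_at_imp_continuous_on ballI DERIV_isCont[OF lam_DERIV])

lemma cont_lam': "continuous_on A lam'"
  unfolding lam'_def
proof (intro continuous_intros)
  show "continuous_on A s1'" "continuous_on A s0'" using cont_s0' cont_s1' continuous_on_subset by blast+
  show "continuous_on A (\<lambda>x. height_head (lam x) 1)"
    by (rule continuous_on_compose2[OF continuous_on_slice(2)[OF continuous_on_height_head, of 1] cont_lam])
       (use lam_in_heads in auto)
  show "\<forall>x\<in>A. height_head (lam x) 1 \<noteq> 0" using height_head_1_neg[OF lam_in_heads] by (auto simp: less_le)
qed

text \<open>The solution is a function of the section parameter and of the height above the lower wall.\<close>

definition reduced :: "real \<times> real \<Rightarrow> real \<times> real" where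
  "reduced q = (lam (fst q), snd q - s0 (fst q))"

lemma reduced_in_channel: "q \<in> \<Omega> \<Longrightarrow> reduced q \<in> channel"
  by (auto simp: reduced_def channel_def nozzle_def lam_in_heads width_lam)

lemma reduced_in_closed_channel: "q \<in> closure \<Omega> \<Longrightarrow> reduced q \<in> closed_channel"
  by (auto simp: reduced_def closed_channel_def closure_nozzle lam_in_heads width_lam)

lemma continuous_on_reduced:
  assumes "continuous_on closed_channel (\<lambda>(l, y). f l y)"
  shows "continuous_on (closure \<Omega>) (\<lambda>q. f (lam (fst q)) (snd q - s0 (fst q)))"
proof -
  have "continuous_on (closure \<Omega>) reduced"
    unfolding reduced_def
    by (intro continuous_intros continuous_on_compose2[OF cont_lam[of UNIV]] continuous_on_compose2[OF cont_s0[of UNIV]]) auto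
  from continuous_on_compose2[OF assms this] reduced_in_closed_channel
  have "continuous_on (closure \<Omega>) (\<lambda>q. (\<lambda>(l, y). f l y) (reduced q))" by (simp add: image_subset_iff)
  then show ?thesis by (simp add: reduced_def)
qed

definition v1 :: "real \<times> real \<Rightarrow> real" where
  "v1 q = velocity (lam (fst q)) (snd q - s0 (fst q))"

text \<open>The slope of the streamline through a point, that is, \<open>v2 / v1\<close>: streamlines follow the lower wall and are
  displaced when the section parameter changes.\<close>

definition slope :: "real \<times> real \<Rightarrow> real" where
  "slope q = s0' (fst q) + lam' (fst q) * drift (lam (fst q)) (snd q - s0 (fst q))"

definition vorticity :: "real \<times> real \<Rightarrow> real" where
  "vorticity q = m' (label (lam (fst q)) (snd q - s0 (fst q)))"

lemma cont_v1: "continuous_on (closure \<Omega>) v1"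
  unfolding v1_def[abs_def] by (rule continuous_on_reduced[OF continuous_on_velocity])

lemma cont_slope: "continuous_on (closure \<Omega>) slope"
  unfolding slope_def[abs_def]
  by (intro continuous_intros continuous_on_reduced[OF continuous_on_drift] continuous_on_compose2[OF cont_s0']
        continuous_on_compose2[OF cont_lam'[of UNIV]]) auto

lemma cont_vorticity: "continuous_on (closure \<Omega>) vorticity"
  unfolding vorticity_def[abs_def] by (rule continuous_on_reduced[OF continuous_on_vorticity])

lemma v1_pos: "q \<in> closure \<Omega> \<Longrightarrow> 0 < v1 q"
  using velocity_pos[of "lam (fst q)" "snd q - s0 (fst q)"] reduced_in_closed_channel[of q]
  by (simp add: v1_def reduced_def)

context
  fixes x y :: real
  assumes xy: "(x, y) \<in> \<Omega>"
begin

lemma in_channel: "(lam x, y - s0 x) \<in> channel"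
  using reduced_in_channel[OF xy] by (simp add: reduced_def)

lemma v1_DERIV_1:
  "((\<lambda>t. v1 (t, y)) has_real_derivative lam' x / (2 * v1 (x, y)) - vorticity (x, y) * slope (x, y)) (at x)"
proof -
  have "((\<lambda>t. y - s0 t) has_real_derivative - s0' x) (at x)"
    using DERIV_diff[OF DERIV_const[of y] der_s0[of x]] by simp
  from DERIV_along_curve[OF velocity_has_derivative[OF in_channel] lam_DERIV this]
  show ?thesis by (simp add: v1_def vorticity_def slope_def algebra_simps)
qed

lemma v1_DERIV_2: "((\<lambda>t. v1 (x, t)) has_real_derivative vorticity (x, y)) (at y)"
proof -
  have "((\<lambda>t. t - s0 x) has_real_derivative 1) (at y)" by (auto intro!: derivative_eq_intros)
  from DERIV_chain2[OF velocity_DERIV[OF in_channel] this]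
  show ?thesis by (simp add: v1_def vorticity_def)
qed

lemma slope_DERIV_2: "((\<lambda>t. slope (x, t)) has_real_derivative - lam' x / (2 * (v1 (x, y))\<^sup>2)) (at y)"
proof -
  have "((\<lambda>t. t - s0 x) has_real_derivative 1) (at y)" by (auto intro!: derivative_eq_intros)
  from DERIV_add[OF DERIV_const[of "s0' x"] DERIV_cmult[OF DERIV_chain2[OF drift_DERIV[OF in_channel] this], of "lam' x"]]
  show ?thesis by (simp add: v1_def slope_def)
qed

end

definition v :: "real \<times> real \<Rightarrow> real \<times> real" where
  "v q = (v1 q, v1 q * slope q)"

text \<open>The square of the speed on a streamline is \<open>m\<^sup>2 + lam\<close>, so this makes \<open>v1\<^sup>2 / 2 + p\<close> independent of the section.\<close>

definition p :: "real \<times> real \<Rightarrow> real" where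
  "p q = - lam (fst q) / 2"

text \<open>Incompressibility is the identity between \<open>D = \<partial>\<^sub>1 v1\<close> and \<open>- \<partial>\<^sub>2 v2\<close>. In the momentum equation the terms with the
  vorticity cancel, which leaves \<open>lam' / 2\<close>.\<close>

lemma v_solution: "hydrostatic_Euler_solution \<Omega> v p"
proof -
  define D where "D q = lam' (fst q) / (2 * v1 q) - vorticity q * slope q" for q
  have D: "continuous_on (closure \<Omega>) D"
    unfolding D_def[abs_def]
    by (intro continuous_intros continuous_on_compose_fst cont_lam' cont_v1 cont_vorticity cont_slope)
       (use v1_pos in \<open>auto simp: less_le\<close>)
  show ?thesis
    unfolding hydrostatic_Euler_solution_def
  proof (intro conjI exI)
    show "continuous_on (closure \<Omega>) v"
      unfolding v_def[abs_def] by (intro continuous_intros cont_v1 cont_slope)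
    show "continuous_on (closure \<Omega>) p"
      unfolding p_def[abs_def] by (intro continuous_intros continuous_on_compose_fst cont_lam) auto
    show "has_cont_partial1 \<Omega> (\<lambda>x. fst (v x)) D"
      unfolding has_cont_partial1_def using D v1_DERIV_1 by (auto simp: v_def D_def)
    show "has_cont_partial2 \<Omega> (\<lambda>x. fst (v x)) vorticity"
      unfolding has_cont_partial2_def using cont_vorticity v1_DERIV_2 by (auto simp: v_def)
    show "has_cont_partial2 \<Omega> (\<lambda>x. snd (v x)) (\<lambda>q. - D q)"
    proof -
      have "((\<lambda>t. snd (v (x, t))) has_real_derivative - D (x, y)) (at y)" if xy: "(x, y) \<in> \<Omega>" for x y
      proof -
        have "0 < v1 (x, y)" using v1_pos[of "(x, y)"] xy closure_subset by blast
        then show ?thesis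
          using DERIV_mult'[OF v1_DERIV_2[OF xy] slope_DERIV_2[OF xy]]
          by (simp add: v_def D_def power2_eq_square)
      qed
      then show ?thesis
        unfolding has_cont_partial2_def using D by (auto intro: continuous_intros)
    qed
    show "has_cont_partial1 \<Omega> p (\<lambda>q. - lam' (fst q) / 2)"
      unfolding has_cont_partial1_def p_def[abs_def]
      by (auto intro!: continuous_intros continuous_on_compose_fst cont_lam' derivative_eq_intros lam_DERIV)
    show "has_cont_partial2 \<Omega> p (\<lambda>q. 0)"
      unfolding has_cont_partial2_def p_def[abs_def] by auto
    show "\<forall>q\<in>\<Omega>. fst (v q) * D q + snd (v q) * vorticity q = - (- lam' (fst q) / 2) \<and> 0 = - (0::real) \<and> D q + - D q = 0"
    proof
      fix q assume "q \<in> \<Omega>"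
      then have "0 < v1 q" using v1_pos[of q] closure_subset by blast
      then show "fst (v q) * D q + snd (v q) * vorticity q = - (- lam' (fst q) / 2) \<and> 0 = - (0::real) \<and> D q + - D q = 0"
        by (simp add: v_def D_def field_simps)
    qed
  qed
qed

lemma slope_lower: "slope (x, s0 x) = s0' x"
  by (simp add: slope_def drift_def label_0[OF lam_in_heads] height_head_0)

text \<open>On the upper wall \<open>drift\<close> is the derivative of the width, which cancels against the denominator of \<open>lam'\<close>.\<close>

lemma slope_upper: "slope (x, s1 x) = s1' x"
  using label_width[OF lam_in_heads, of x] height_head_1_neg[OF lam_in_heads, of x]
  by (simp add: slope_def drift_def width_lam lam'_def)

lemma v_slip: "slip_condition s0 s1 v"
  by (simp add: slip_condition_iff v_def slope_lower slope_upper)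

text \<open>The parameters of the section converge together with the walls, and both \<open>s0'\<close> and \<open>lam'\<close> tend to \<open>0\<close>, which makes
  the flow horizontal in the limit.\<close>

lemma v_far_field:
  assumes lim: "(s0 \<longlongrightarrow> b) F" "(s1 \<longlongrightarrow> b + w) F" "(s0' \<longlongrightarrow> 0) F" "(s1' \<longlongrightarrow> 0) F"
    and w: "0 < w"
  shows "far_field v (\<lambda>y. (velocity (head_of_width w) (y - b), 0)) {b<..<b + w} F"
  unfolding far_field_def
proof (intro allI impI)
  fix K :: "real set" assume K: "compact K \<and> K \<subseteq> {b<..<b + w}"
  have l: "head_of_width w \<in> heads" by (rule head_in_heads[OF w])
  have "((\<lambda>x. s1 x - s0 x) \<longlongrightarrow> w) F"
    using tendsto_diff[OF lim(2,1)] by simp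
  then have lam: "(lam \<longlongrightarrow> head_of_width w) F"
    unfolding lam_def[abs_def] by (rule isCont_tendsto_compose[OF DERIV_isCont[OF head_DERIV[OF w]]])
  have "isCont (\<lambda>l. height_head l 1) (head_of_width w)"
    using continuous_on_slice(2)[OF continuous_on_height_head, of 1] l open_heads
    by (simp add: continuous_on_eq_continuous_at)
  from isCont_tendsto_compose[OF this lam]
  have "((\<lambda>x. height_head (lam x) 1) \<longlongrightarrow> height_head (head_of_width w) 1) F" .
  from tendsto_divide[OF tendsto_diff[OF lim(4,3)] this]
  have lam': "(lam' \<longlongrightarrow> 0) F"
    using height_head_1_neg[OF l] by (simp add: lam'_def[abs_def])
  have sub: "(head_of_width w, y - b) \<in> channel" if "y \<in> K" for y
    using K that l by (auto simp: channel_def width_head[OF w])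
  have V: "continuous_on channel (\<lambda>(l, y). velocity l y)" and S: "continuous_on channel (\<lambda>(l, y). drift l y)"
    using continuous_on_velocity continuous_on_drift channel_subset by (blast intro: continuous_on_subset)+
  have VK: "bounded ((\<lambda>y. velocity (head_of_width w) (y - b)) ` K)" and SK: "bounded ((\<lambda>y. drift (head_of_width w) (y - b)) ` K)"
  proof -
    have "continuous_on K (\<lambda>y. (\<lambda>(l, y). velocity l y) (head_of_width w, y - b))"
      by (rule continuous_on_compose2[OF V]) (use sub in \<open>auto intro!: continuous_intros\<close>)
    then show "bounded ((\<lambda>y. velocity (head_of_width w) (y - b)) ` K)"
      using K by (intro compact_imp_bounded compact_continuous_image) auto
    have "continuous_on K (\<lambda>y. (\<lambda>(l, y). drift l y) (head_of_width w, y - b))"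
      by (rule continuous_on_compose2[OF S]) (use sub in \<open>auto intro!: continuous_intros\<close>)
    then show "bounded ((\<lambda>y. drift (head_of_width w) (y - b)) ` K)"
      using K by (intro compact_imp_bounded compact_continuous_image) auto
  qed
  have ulV: "uniform_limit K (\<lambda>x y. v1 (x, y)) (\<lambda>y. velocity (head_of_width w) (y - b)) F"
    using uniform_limit_continuous_compose[OF V open_channel _ lam lim(1) sub] K by (simp add: v1_def)
  have ulS: "uniform_limit K (\<lambda>x y. drift (lam x) (y - s0 x)) (\<lambda>y. drift (head_of_width w) (y - b)) F"
    using uniform_limit_continuous_compose[OF S open_channel _ lam lim(1) sub] K by simp
  have const: "uniform_limit K (\<lambda>x y. f x) (\<lambda>y. 0) F" if "(f \<longlongrightarrow> 0) F" for f :: "real \<Rightarrow> real"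
    using tendstoD[OF that] by (intro uniform_limitI) (auto elim: eventually_mono)
  have "uniform_limit K (\<lambda>x y. s0' x + lam' x * drift (lam x) (y - s0 x)) (\<lambda>y. 0 + 0 * drift (head_of_width w) (y - b)) F"
    by (intro uniform_limit_add uniform_lim_mult const lim(3) lam' ulS SK) (simp_all add: image_constant_conv)
  then have "uniform_limit K (\<lambda>x y. v1 (x, y) * slope (x, y)) (\<lambda>y. velocity (head_of_width w) (y - b) * 0) F"
    by (intro uniform_lim_mult ulV VK) (simp_all add: image_constant_conv slope_def)
  with ulV show "uniform_limit K (\<lambda>x y. v (x, y)) (\<lambda>y. (velocity (head_of_width w) (y - b), 0)) F"
  proof -
    assume 1: "uniform_limit K (\<lambda>x y. v1 (x, y)) (\<lambda>y. velocity (head_of_width w) (y - b)) F"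
      and 2: "uniform_limit K (\<lambda>x y. v1 (x, y) * slope (x, y)) (\<lambda>y. velocity (head_of_width w) (y - b) * 0) F"
    show ?thesis
    proof (rule uniform_limitI)
      fix e :: real assume "e > 0"
      then have e: "e / 2 > 0" by simp
      from uniform_limitD[OF 1 e] uniform_limitD[OF 2 e]
      show "\<forall>\<^sub>F n in F. \<forall>y\<in>K. dist (v (n, y)) (velocity (head_of_width w) (y - b), 0) < e"
      proof eventually_elim
        case (elim n)
        show ?case
        proof
          fix y assume "y \<in> K"
          have "dist (v (n, y)) (velocity (head_of_width w) (y - b), 0)
            \<le> dist (v1 (n, y)) (velocity (head_of_width w) (y - b)) + dist (v1 (n, y) * slope (n, y)) 0"
            using sqrt_sum_squares_le_sum_abs[of "dist (v1 (n, y)) (velocity (head_of_width w) (y - b))" "v1 (n, y) * slope (n, y)"]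
            by (simp add: v_def dist_Pair_Pair)
          also have "\<dots> < e / 2 + e / 2" using elim \<open>y \<in> K\<close> by (intro add_strict_mono) auto
          finally show "dist (v (n, y)) (velocity (head_of_width w) (y - b), 0) < e" by simp
        qed
      qed
    qed
  qed
qed

end

section \<open>Streamlines of an arbitrary solution\<close>

text \<open>An arbitrary classical solution, with the equations used to eliminate the derivatives of \<open>w2\<close> and \<open>q\<close> in favour of
  the derivatives \<open>D1\<close>, \<open>D2\<close> of the horizontal velocity \<open>w1\<close>.\<close>

locale euler_flow = nozzle_shape +
  fixes w1 w2 q D1 D2 :: "real \<times> real \<Rightarrow> real"
  assumes cont_w1: "continuous_on (closure \<Omega>) w1"
    and cont_w2: "continuous_on (closure \<Omega>) w2"
    and cont_q: "continuous_on (closure \<Omega>) q"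
    and cont_D1: "continuous_on (closure \<Omega>) D1"
    and cont_D2: "continuous_on (closure \<Omega>) D2"
    and w1_DERIV_1: "(x, y) \<in> \<Omega> \<Longrightarrow> ((\<lambda>t. w1 (t, y)) has_real_derivative D1 (x, y)) (at x)"
    and w1_DERIV_2: "(x, y) \<in> \<Omega> \<Longrightarrow> ((\<lambda>t. w1 (x, t)) has_real_derivative D2 (x, y)) (at y)"
    and w2_DERIV_2: "(x, y) \<in> \<Omega> \<Longrightarrow> ((\<lambda>t. w2 (x, t)) has_real_derivative - D1 (x, y)) (at y)"
    and q_DERIV_1: "(x, y) \<in> \<Omega> \<Longrightarrow>
      ((\<lambda>t. q (t, y)) has_real_derivative - (w1 (x, y) * D1 (x, y) + w2 (x, y) * D2 (x, y))) (at x)"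
    and q_DERIV_2: "(x, y) \<in> \<Omega> \<Longrightarrow> ((\<lambda>t. q (x, t)) has_real_derivative 0) (at y)"
    and slip_lower: "w2 (x, s0 x) = w1 (x, s0 x) * s0' x"
    and slip_upper: "w2 (x, s1 x) = w1 (x, s1 x) * s1' x"
    and w1_pos: "z \<in> closure \<Omega> \<Longrightarrow> 0 < w1 z"
begin

text \<open>The coordinates \<open>(x, t)\<close> straighten the nozzle to the strip of all \<open>x\<close> and \<open>t \<in> {0..1}\<close>: \<open>t\<close> is the relative height in the
  section.\<close>

definition gap :: "real \<Rightarrow> real" where "gap x = s1 x - s0 x"
definition gap' :: "real \<Rightarrow> real" where "gap' x = s1' x - s0' x"
definition level :: "real \<Rightarrow> real \<Rightarrow> real" where "level x t = s0 x + t * gap x"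
definition level' :: "real \<Rightarrow> real \<Rightarrow> real" where "level' x t = s0' x + t * gap' x"

lemma gap_pos: "0 < gap x" using s0_less_s1[of x] by (simp add: gap_def)

lemma gap_DERIV: "(gap has_real_derivative gap' x) (at x)"
  unfolding gap_def[abs_def] gap'_def by (intro DERIV_diff der_s0 der_s1)

lemma level_DERIV: "((\<lambda>x. level x t) has_real_derivative level' x t) (at x)"
  unfolding level_def[abs_def] level'_def by (intro DERIV_add DERIV_cmult der_s0 gap_DERIV)

lemma level_0: "level x 0 = s0 x" and level_1: "level x 1 = s1 x"
  by (simp_all add: level_def gap_def)

lemma level_in_closure: "t \<in> {0..1} \<Longrightarrow> (x, level x t) \<in> closure \<Omega>"
proof -
  assume t: "t \<in> {0..1}"
  then have "0 \<le> t * gap x" "t * gap x \<le> 1 * gap x"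
    using gap_pos[of x] by (auto intro!: mult_right_mono)
  then show ?thesis by (simp add: closure_nozzle level_def gap_def)
qed

lemma level_in_nozzle: "t \<in> {0<..<1} \<Longrightarrow> (x, level x t) \<in> \<Omega>"
proof -
  assume t: "t \<in> {0<..<1}"
  then have "0 < t * gap x" "t * gap x < 1 * gap x"
    using gap_pos[of x] by (auto intro!: mult_strict_right_mono)
  then show ?thesis by (simp add: mem_nozzle level_def gap_def)
qed

lemma cont_base: "continuous_on A gap" "continuous_on A gap'" "continuous_on A s0'"
proof -
  show s: "continuous_on A s0'" using cont_s0' continuous_on_subset by blast
  have "continuous_on A s1'" using cont_s1' continuous_on_subset by blast
  with s show "continuous_on A gap'" unfolding gap'_def[abs_def] by (intro continuous_intros)
  show "continuous_on A gap" by (intro continuous_at_imp_continuous_on ballI DERIV_isCont[OF gap_DERIV])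
qed

lemma cont_level: "continuous_on (UNIV \<times> {0..1}) (\<lambda>(x, t). level x t)"
  and cont_level': "continuous_on (UNIV \<times> {0..1}) (\<lambda>(x, t). level' x t)"
  unfolding level_def level'_def case_prod_unfold
  by (intro continuous_intros continuous_on_compose_fst cont_base cont_s0)+

lemma continuous_on_strip:
  assumes "continuous_on (closure \<Omega>) f"
  shows "continuous_on (UNIV \<times> {0..1}) (\<lambda>(x, t). f (x, level x t))"
proof -
  have "continuous_on (UNIV \<times> {0..1}) (\<lambda>z. (fst z, (\<lambda>(x, t). level x t) z))"
    by (intro continuous_intros cont_level)
  moreover have "(\<lambda>z. (fst z, (\<lambda>(x, t). level x t) z)) ` (UNIV \<times> {0..1}) \<subseteq> closure \<Omega>"
    using level_in_closure by auto
  ultimately have "continuous_on (UNIV \<times> {0..1}) (\<lambda>z. f (fst z, (\<lambda>(x, t). level x t) z))"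
    by (rule continuous_on_compose2[OF assms])
  then show ?thesis by (simp add: case_prod_unfold)
qed

lemma w1_has_derivative:
  "(x, y) \<in> \<Omega> \<Longrightarrow> (w1 has_derivative (\<lambda>(h, k). D1 (x, y) * h + D2 (x, y) * k)) (at (x, y))"
  by (rule has_derivative_from_partials[OF open_nozzle _ w1_DERIV_1 w1_DERIV_2])
     (use cont_D2 closure_subset in \<open>auto intro: continuous_on_subset\<close>)

text \<open>Inside the nozzle this is the chain rule. On the walls it holds by extension from the inside.\<close>

lemma w1_level_DERIV:
  assumes t: "t \<in> {0..1}"
  shows "((\<lambda>x. w1 (x, level x t)) has_real_derivative
    D1 (x, level x t) + D2 (x, level x t) * level' x t) (at x)"
proof (rule partial_extends_to_closed_strip[where g = "\<lambda>x t. w1 (x, level x t)" and D = "\<lambda>x t. D1 (x, level x t) + D2 (x, level x t) * level' x t", OF _ _ _ t])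
  show "continuous_on (UNIV \<times> {0..1}) (\<lambda>(x, t). w1 (x, level x t))"
    by (rule continuous_on_strip[OF cont_w1])
  show "continuous_on (UNIV \<times> {0..1}) (\<lambda>(x, t). D1 (x, level x t) + D2 (x, level x t) * level' x t)"
    using continuous_on_strip[OF cont_D1] continuous_on_strip[OF cont_D2] cont_level'
    unfolding case_prod_unfold by (intro continuous_intros)
  fix x t :: real assume t: "t \<in> {0<..<1}"
  show "((\<lambda>x. w1 (x, level x t)) has_real_derivative D1 (x, level x t) + D2 (x, level x t) * level' x t) (at x)"
    using DERIV_along_curve[OF w1_has_derivative[OF level_in_nozzle[OF t]] DERIV_ident level_DERIV] by simp
qed

text \<open>The stream function in the straightened coordinates, and its \<open>x\<close>-derivative.\<close>

definition \<Psi> :: "real \<Rightarrow> real \<Rightarrow> real" where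
  "\<Psi> x t = gap x * integral {0..t} (\<lambda>s. w1 (x, level x s))"

definition \<Psi>x :: "real \<Rightarrow> real \<Rightarrow> real" where
  "\<Psi>x x t = w1 (x, level x t) * level' x t - w2 (x, level x t)"

lemma \<Psi>_0: "\<Psi> x 0 = 0" by (simp add: \<Psi>_def)

lemma cont_\<Psi>: "continuous_on (UNIV \<times> {0..1}) (\<lambda>(x, t). \<Psi> x t)"
  using continuous_on_integral_upto[OF continuous_on_strip[OF cont_w1]]
  unfolding \<Psi>_def case_prod_unfold by (intro continuous_intros continuous_on_compose_fst cont_base)

lemma \<Psi>_DERIV_t:
  assumes "t \<in> {0..1}"
  shows "(\<Psi> x has_real_derivative gap x * w1 (x, level x t)) (at t within {0..1})"
  unfolding \<Psi>_def[abs_def]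
  by (intro DERIV_cmult integral_has_real_derivative assms continuous_on_slice(1)[OF continuous_on_strip[OF cont_w1]]) simp

lemma \<Psi>_slope_pos: "t \<in> {0..1} \<Longrightarrow> 0 < gap x * w1 (x, level x t)"
  by (intro mult_pos_pos gap_pos w1_pos level_in_closure)

text \<open>Differentiating under the integral sign, incompressibility turns the integrand into the \<open>s\<close>-derivative of
  \<open>\<Psi>x x s\<close>. The contribution of the lower wall vanishes because the velocity is tangent to it.\<close>

lemma \<Psi>_DERIV_x:
  assumes t: "t \<in> {0..1}"
  shows "((\<lambda>x. \<Psi> x t) has_real_derivative \<Psi>x x t) (at x)"
proof -
  define W where "W x s = w1 (x, level x s)" for x s
  define Wx where "Wx x s = D1 (x, level x s) + D2 (x, level x s) * level' x s" for x s
  have sub: "{0..t} \<subseteq> {0..1}" using t by auto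
  have cW: "continuous_on (UNIV \<times> {0..1}) (\<lambda>(x, t). W x t)"
    unfolding W_def by (rule continuous_on_strip[OF cont_w1])
  have cWx: "continuous_on (UNIV \<times> {0..1}) (\<lambda>(x, t). Wx x t)"
    unfolding Wx_def
    using continuous_on_strip[OF cont_D1] continuous_on_strip[OF cont_D2] cont_level'
    unfolding case_prod_unfold by (intro continuous_intros)
  have iW: "continuous_on {0..t} (W x)" and iWx: "continuous_on {0..t} (Wx x)" for x
    using continuous_on_subset[OF continuous_on_slice(1)[OF cW] sub] continuous_on_subset[OF continuous_on_slice(1)[OF cWx] sub] by auto
  have "((\<lambda>x. integral (cbox 0 t) (W x)) has_field_derivative integral (cbox 0 t) (Wx x)) (at x within UNIV)"
  proof (rule leibniz_rule_field_derivative)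
    show "((\<lambda>x. W x s) has_real_derivative Wx x s) (at x within UNIV)" if "s \<in> cbox 0 t" for x s
      unfolding W_def Wx_def using w1_level_DERIV[of s x] that sub by auto
    show "W x integrable_on cbox 0 t" for x
      using iW[of x] by (simp add: integrable_continuous_real)
    show "continuous_on (UNIV \<times> cbox 0 t) (\<lambda>(x, t). Wx x t)"
      by (rule continuous_on_subset[OF cWx]) (use sub in auto)
  qed auto
  from DERIV_mult'[OF gap_DERIV this[unfolded box_real]]
  have der: "((\<lambda>x. \<Psi> x t) has_real_derivative gap x * integral {0..t} (Wx x) + gap' x * integral {0..t} (W x)) (at x)"
    by (simp add: \<Psi>_def W_def[abs_def])
  \<comment> \<open>The derivatives exist inside the nozzle only, continuity of \<open>\<Psi>x\<close> up to the walls suffices.\<close>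
  have ftc: "((\<lambda>s. gap x * Wx x s + gap' x * W x s) has_integral \<Psi>x x t - \<Psi>x x 0) {0..t}"
  proof (rule fundamental_theorem_of_calculus_interior)
    show "0 \<le> t" using t by simp
    have "continuous_on (UNIV \<times> {0..1}) (\<lambda>(x, t). \<Psi>x x t)"
      using continuous_on_strip[OF cont_w1] continuous_on_strip[OF cont_w2] cont_level'
      unfolding \<Psi>x_def case_prod_unfold by (intro continuous_intros)
    from continuous_on_subset[OF continuous_on_slice(1)[OF this] sub]
    show "continuous_on {0..t} (\<Psi>x x)" by simp
    fix s assume "s \<in> {0<..<t}"
    then have s: "s \<in> {0<..<1}" using t by auto
    have lev: "(level x has_real_derivative gap x) (at s)"
      unfolding level_def[abs_def] by (auto intro!: derivative_eq_intros)
    have lev': "(level' x has_real_derivative gap' x) (at s)"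
      unfolding level'_def[abs_def] by (auto intro!: derivative_eq_intros)
    note d1 = DERIV_chain2[OF w1_DERIV_2[OF level_in_nozzle[OF s]] lev]
    note d2 = DERIV_chain2[OF w2_DERIV_2[OF level_in_nozzle[OF s]] lev]
    from DERIV_diff[OF DERIV_mult'[OF d1 lev'] d2]
    have "(\<Psi>x x has_real_derivative gap x * Wx x s + gap' x * W x s) (at s)"
      by (simp add: \<Psi>x_def[abs_def] W_def Wx_def algebra_simps)
    then show "(\<Psi>x x has_vector_derivative gap x * Wx x s + gap' x * W x s) (at s)"
      by (simp add: has_real_derivative_iff_has_vector_derivative)
  qed
  have "\<Psi>x x 0 = 0" by (simp add: \<Psi>x_def level_0 level'_def slip_lower)
  moreover have "((\<lambda>s. gap x * Wx x s + gap' x * W x s) has_integral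
      gap x * integral {0..t} (Wx x) + gap' x * integral {0..t} (W x)) {0..t}"
    by (intro has_integral_add has_integral_mult_right integrable_integral integrable_continuous_real iW iWx)
  ultimately have "\<Psi>x x t = gap x * integral {0..t} (Wx x) + gap' x * integral {0..t} (W x)"
    using has_integral_unique[OF ftc] by simp
  with der show ?thesis by simp
qed

definition total_flux :: real where "total_flux = \<Psi> 0 1"

text \<open>No fluid crosses the upper wall either.\<close>

lemma \<Psi>_1: "\<Psi> x 1 = total_flux"
proof -
  have "((\<lambda>x. \<Psi> x 1) has_real_derivative 0) (at x)" for x
    using \<Psi>_DERIV_x[of 1 x] by (simp add: \<Psi>x_def level_1 level'_def gap'_def slip_upper)
  then show ?thesis unfolding total_flux_def by (intro DERIV_isconst_all[rule_format]) auto
qed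

definition streamline :: "real \<Rightarrow> real \<Rightarrow> real" where
  "streamline z x = level x (fibre_inverse \<Psi> x z)"

lemmas \<Psi>_fibre = cont_\<Psi> \<Psi>_DERIV_t \<Psi>_slope_pos

lemma fibre_in: "z \<in> {0..total_flux} \<Longrightarrow> fibre_inverse \<Psi> x z \<in> {0..1}"
  and \<Psi>_fibre_inverse: "z \<in> {0..total_flux} \<Longrightarrow> \<Psi> x (fibre_inverse \<Psi> x z) = z"
  using fibre_inverse_right[of UNIV \<Psi> "\<lambda>x t. gap x * w1 (x, level x t)" x z] \<Psi>_fibre
  by (auto simp: \<Psi>_0 \<Psi>_1)

lemma fibre_in_interior: "z \<in> {0<..<total_flux} \<Longrightarrow> fibre_inverse \<Psi> x z \<in> {0<..<1}"
  using fibre_inverse_interior[of UNIV \<Psi> "\<lambda>x t. gap x * w1 (x, level x t)" x z] \<Psi>_fibre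
  by (auto simp: \<Psi>_0 \<Psi>_1)

lemma fibre_\<Psi>: "t \<in> {0..1} \<Longrightarrow> fibre_inverse \<Psi> x (\<Psi> x t) = t"
  using fibre_inverse_left[of UNIV \<Psi> "\<lambda>x t. gap x * w1 (x, level x t)" x t] \<Psi>_fibre by auto

lemma \<Psi>_less_iff: "s \<in> {0..1} \<Longrightarrow> t \<in> {0..1} \<Longrightarrow> \<Psi> x s < \<Psi> x t \<longleftrightarrow> s < t"
  using fibre_less_iff[of UNIV \<Psi> "\<lambda>x t. gap x * w1 (x, level x t)" x s t] \<Psi>_fibre by auto

text \<open>A level line of \<open>\<Psi>\<close> has slope \<open>- \<Psi>x / \<Psi>t\<close> in the strip. Back in the nozzle this becomes the direction of the
  velocity.\<close>

lemma streamline_DERIV: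
  assumes z: "z \<in> {0<..<total_flux}"
  shows "(streamline z has_real_derivative w2 (x, streamline z x) / w1 (x, streamline z x)) (at x)"
proof -
  define t where "t = fibre_inverse \<Psi> x z"
  have t: "t \<in> {0<..<1}" using fibre_in_interior[OF z] by (simp add: t_def)
  have t': "t \<in> {0..1}" using t by auto
  have pos: "0 < w1 (x, level x t)" by (rule w1_pos[OF level_in_closure[OF t']])
  have "((\<lambda>(x, y). fibre_inverse \<Psi> x y) has_derivative
      (\<lambda>(h, k). - \<Psi>x x t / (gap x * w1 (x, level x t)) * h + 1 / (gap x * w1 (x, level x t)) * k)) (at (x, z))"
    unfolding t_def
  proof (rule has_derivative_fibre_inverse[where U = UNIV])
    show "((\<lambda>x. \<Psi> x t) has_real_derivative \<Psi>x x t) (at x)" if "t \<in> {0<..<1}" for x t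
      using \<Psi>_DERIV_x[of t x] that by auto
    show "continuous_on (UNIV \<times> {0<..<1}) (\<lambda>(x, t). gap x * w1 (x, level x t))"
      using continuous_on_subset[OF continuous_on_strip[OF cont_w1], of "UNIV \<times> {0<..<1}"]
      unfolding case_prod_unfold by (intro continuous_intros continuous_on_compose_fst cont_base) (auto simp: subset_eq)
  qed (use \<Psi>_fibre z in \<open>auto simp: \<Psi>_0 \<Psi>_1\<close>)
  from DERIV_along_curve[where f = "\<lambda>(x, y). fibre_inverse \<Psi> x y" and a = "\<lambda>x. x" and b = "\<lambda>x. z" and t = x, OF this DERIV_ident DERIV_const]
  have T: "((\<lambda>x. fibre_inverse \<Psi> x z) has_real_derivative - \<Psi>x x t / (gap x * w1 (x, level x t))) (at x)"
    by simp
  from DERIV_add[OF der_s0 DERIV_mult'[OF this gap_DERIV]]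
  have "(streamline z has_real_derivative s0' x + (t * gap' x + - \<Psi>x x t / (gap x * w1 (x, level x t)) * gap x)) (at x)"
    by (simp add: streamline_def[abs_def] level_def t_def)
  moreover have "s0' x + (t * gap' x + - \<Psi>x x t / (gap x * w1 (x, level x t)) * gap x) = w2 (x, level x t) / w1 (x, level x t)"
    using pos gap_pos[of x] by (simp add: \<Psi>x_def level'_def field_simps)
  ultimately show ?thesis by (simp add: streamline_def t_def)
qed

text \<open>The pressure is constant on vertical sections, so any interior point of the section may be used to read it off.\<close>

definition pressure :: "real \<Rightarrow> real" where
  "pressure x = q (x, level x (1 / 2))"

lemma q_eq_pressure:
  assumes "(x, y) \<in> closure \<Omega>"
  shows "q (x, y) = pressure x"
proof -
  have sl: "closure {s0 x<..<s1 x} = {s0 x..s1 x}" using s0_less_s1[of x] by simp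
  have mid: "level x (1 / 2) \<in> {s0 x<..<s1 x}" using level_in_nozzle[of "1 / 2" x] by (simp add: mem_nozzle)
  have "\<exists>c. \<forall>y\<in>{s0 x<..<s1 x}. q (x, y) = c"
    by (rule has_field_derivative_zero_constant)
       (auto intro!: has_field_derivative_at_within q_DERIV_2 simp: mem_nozzle)
  then have const: "q (x, y) = pressure x" if "y \<in> {s0 x<..<s1 x}" for y
    using mid that unfolding pressure_def by metis
  have "continuous_on (closure {s0 x<..<s1 x}) (\<lambda>y. q (x, y))"
    unfolding sl by (rule continuous_on_compose2[OF cont_q]) (auto intro!: continuous_intros simp: closure_nozzle)
  then show ?thesis
    by (rule continuous_constant_on_closure[where f = "\<lambda>y. q (x, y)"]) (use const assms sl in \<open>auto simp: closure_nozzle\<close>)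
qed

lemma pressure_DERIV:
  assumes "(x, y) \<in> \<Omega>"
  shows "(pressure has_real_derivative - (w1 (x, y) * D1 (x, y) + w2 (x, y) * D2 (x, y))) (at x)"
proof -
  have "open ((\<lambda>t. (t, y)) -` \<Omega>)"
    by (rule open_vimage[OF open_nozzle]) (auto intro: continuous_intros)
  then show ?thesis
    by (rule has_field_derivative_transform_within_open[OF q_DERIV_1[OF assms]])
       (use assms closure_subset q_eq_pressure in auto)
qed

text \<open>Along a streamline, the derivative of \<open>w1\<^sup>2 / 2\<close> is \<open>w1 (D1 + D2 w2 / w1)\<close>, the negative of the pressure
  gradient.\<close>

lemma bernoulli:
  assumes z: "z \<in> {0<..<total_flux}"
  shows "(w1 (x, streamline z x))\<^sup>2 / 2 + pressure x = (w1 (0, streamline z 0))\<^sup>2 / 2 + pressure 0"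
proof -
  have "((\<lambda>x. (w1 (x, streamline z x))\<^sup>2 / 2 + pressure x) has_real_derivative 0) (at x)" for x
  proof -
    define y where "y = streamline z x"
    have y: "(x, y) \<in> \<Omega>"
      unfolding y_def streamline_def by (rule level_in_nozzle[OF fibre_in_interior[OF z]])
    have pos: "0 < w1 (x, y)" using w1_pos y closure_subset by blast
    have "((\<lambda>x. w1 (x, streamline z x)) has_real_derivative D1 (x, y) + D2 (x, y) * (w2 (x, y) / w1 (x, y))) (at x)"
      using DERIV_along_curve[OF w1_has_derivative[OF y, unfolded y_def] DERIV_ident streamline_DERIV[OF z]]
      by (simp add: y_def)
    from DERIV_add[OF DERIV_cdivide[OF DERIV_power[OF this, of 2], of 2] pressure_DERIV[OF y]]
    show ?thesis using pos by (simp add: y_def[symmetric] field_simps)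
  qed
  then show ?thesis by (intro DERIV_isconst_all[where f = "\<lambda>x. (w1 (x, streamline z x))\<^sup>2 / 2 + pressure x"]) auto
qed

end

section \<open>Uniqueness from the upstream behaviour\<close>

locale upstream_flow =
  nozzle_inflow s0 s1 s0' s1' m m' K + euler_flow s0 s1 s0' s1' w1 w2 q D1 D2
  for s0 s1 s0' s1' m m' :: "real \<Rightarrow> real" and K :: real and w1 w2 q D1 D2 :: "real \<times> real \<Rightarrow> real" +
  assumes s0_upstream: "(s0 \<longlongrightarrow> 0) at_bot" and s1_upstream: "(s1 \<longlongrightarrow> 1) at_bot"
    and w1_upstream: "far_field w1 m {0<..<1} at_bot"
begin

text \<open>Locally uniform convergence allows the point of evaluation to move as well, as long as it stays away from the
  walls.\<close>

lemma w1_tendsto: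
  assumes X: "filterlim X at_bot F" and Y: "(Y \<longlongrightarrow> \<tau>) F" and \<tau>: "\<tau> \<in> {0<..<1}"
  shows "((\<lambda>n. w1 (X n, Y n)) \<longlongrightarrow> m \<tau>) F"
proof -
  obtain \<delta> where \<delta>: "\<delta> > 0" "cball \<tau> \<delta> \<subseteq> {0<..<1}"
    using open_contains_cball[of "{0<..<1::real}"] \<tau> by (meson open_greaterThanLessThan)
  have ul: "uniform_limit (cball \<tau> \<delta>) (\<lambda>x y. w1 (x, y)) m at_bot"
    using w1_upstream \<delta>(2) by (auto simp: far_field_def)
  have "isCont m \<tau>" using der_m_interior[OF \<tau>] by (rule DERIV_isCont)
  from isCont_tendsto_compose[OF this Y] have mY: "((\<lambda>n. m (Y n)) \<longlongrightarrow> m \<tau>) F" .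
  have "((\<lambda>n. w1 (X n, Y n) - m (Y n)) \<longlongrightarrow> 0) F"
  proof (rule tendstoI)
    fix e :: real assume "e > 0"
    from eventually_compose_filterlim[OF uniform_limitD[OF ul this] X] tendstoD[OF Y \<delta>(1)]
    show "\<forall>\<^sub>F n in F. dist (w1 (X n, Y n) - m (Y n)) 0 < e"
      by eventually_elim (auto simp: dist_real_def abs_minus_commute)
  qed
  from tendsto_add[OF this mY] show ?thesis by simp
qed

lemma gap_upstream: "(gap \<longlongrightarrow> 1) at_bot"
  unfolding gap_def[abs_def] using tendsto_diff[OF s1_upstream s0_upstream] by simp

lemma level_tendsto:
  assumes "filterlim X at_bot F" "(T \<longlongrightarrow> t) F"
  shows "((\<lambda>n. level (X n) (T n)) \<longlongrightarrow> t) F"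
proof -
  have "((\<lambda>n. s0 (X n) + T n * gap (X n)) \<longlongrightarrow> 0 + t * 1) F"
    by (intro tendsto_add tendsto_mult assms(2) filterlim_compose[OF s0_upstream assms(1)] filterlim_compose[OF gap_upstream assms(1)])
  then show ?thesis by (simp add: level_def)
qed

lemma \<Psi>_interior: "t \<in> {0<..<1} \<Longrightarrow> \<Psi> x t \<in> {0<..<total_flux}"
  using \<Psi>_less_iff[of 0 t x] \<Psi>_less_iff[of t 1 x] by (auto simp: \<Psi>_0 \<Psi>_1)

lemma \<Psi>_range: "t \<in> {0..1} \<Longrightarrow> \<Psi> x t \<in> {0..total_flux}"
  using \<Psi>_less_iff[of t 0 x] \<Psi>_less_iff[of 1 t x] by (auto simp: \<Psi>_0 \<Psi>_1 not_less[symmetric])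

text \<open>The Bernoulli quantity as a function of the streamline, read off in the section at \<open>0\<close>.\<close>

definition bernoulli_on :: "real \<Rightarrow> real" where
  "bernoulli_on z = (w1 (0, streamline z 0))\<^sup>2 / 2 + pressure 0"

lemma bernoulli_level:
  assumes "t \<in> {0<..<1}"
  shows "(w1 (x, level x t))\<^sup>2 / 2 + pressure x = bernoulli_on (\<Psi> x t)"
  using bernoulli[OF \<Psi>_interior[OF assms], of x x] fibre_\<Psi>[of t x] assms
  by (simp add: streamline_def bernoulli_on_def)

text \<open>On the compact section at \<open>0\<close> the velocity is bounded, hence the Bernoulli quantity is bounded over all
  streamlines. In the middle of the nozzle \<open>w1\<close> converges, which bounds the pressure from below upstream. Together this
  bounds \<open>w1\<close> on whole sections, including the neighbourhood of the walls, where no convergence is assumed.\<close>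

lemma w1_bounded_upstream:
  obtains b M where "\<And>x t. x \<le> b \<Longrightarrow> t \<in> {0..1} \<Longrightarrow> w1 (x, level x t) \<le> M"
proof -
  have cont: "continuous_on {0..1} (\<lambda>t. w1 (x, level x t))" for x
    using continuous_on_slice(1)[OF continuous_on_strip[OF cont_w1], of x] by simp
  have pos: "0 < w1 (x, level x t)" if "t \<in> {0..1}" for x t
    by (rule w1_pos[OF level_in_closure[OF that]])
  obtain t0 where t0: "t0 \<in> {0..1}" "\<And>t. t \<in> {0..1} \<Longrightarrow> w1 (0, level 0 t) \<le> w1 (0, level 0 t0)"
    using continuous_attains_sup[OF compact_Icc _ cont[of 0]] by (auto simp del: atLeastAtMost_iff)
  define M0 where "M0 = w1 (0, level 0 t0)"
  have M0: "0 < M0" using pos[OF t0(1)] by (simp add: M0_def)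
  have bounds: "pressure 0 \<le> bernoulli_on z" "bernoulli_on z \<le> M0\<^sup>2 / 2 + pressure 0" if z: "z \<in> {0<..<total_flux}" for z
  proof -
    have T: "fibre_inverse \<Psi> 0 z \<in> {0..1}" using fibre_in_interior[OF z, of 0] by auto
    have "(w1 (0, streamline z 0))\<^sup>2 \<le> M0\<^sup>2"
      unfolding streamline_def M0_def using t0(2)[OF T] pos[OF T, of 0] by (intro power_mono) auto
    then show "pressure 0 \<le> bernoulli_on z" "bernoulli_on z \<le> M0\<^sup>2 / 2 + pressure 0"
      by (simp_all add: bernoulli_on_def)
  qed
  have "((\<lambda>x. w1 (x, level x (1 / 2))) \<longlongrightarrow> m (1 / 2)) at_bot"
    by (rule w1_tendsto[OF filterlim_ident level_tendsto[OF filterlim_ident tendsto_const]]) simp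
  from order_tendstoD(2)[OF this, of "m (1 / 2) + 1"]
  obtain b where b: "\<And>x. x \<le> b \<Longrightarrow> w1 (x, level x (1 / 2)) < m (1 / 2) + 1"
    by (auto simp: eventually_at_bot_linorder)
  \<comment> \<open>An upper bound for \<open>w1\<close> on the middle line far upstream.\<close>
  define c where "c = m (1 / 2) + 1"
  have c: "0 < c" using m_pos[of "1 / 2"] by (simp add: c_def)
  have "w1 (x, level x t) \<le> M0 + c" if x: "x \<le> b" and t: "t \<in> {0..1}" for x t
  proof -
    have "(w1 (x, level x (1 / 2)))\<^sup>2 \<le> c\<^sup>2"
      using b[OF x] pos[of "1 / 2" x] by (intro power_mono) (auto simp: c_def)
    then have P: "pressure 0 - c\<^sup>2 / 2 \<le> pressure x"
      using bernoulli_level[of "1 / 2" x] bounds(1)[OF \<Psi>_interior[of "1 / 2" x]] by simp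
    have cl: "closure {0<..<1} = {0..1::real}" by simp
    have int: "w1 (x, level x t) \<le> M0 + c" if t: "t \<in> {0<..<1}" for t
    proof -
      have "(w1 (x, level x t))\<^sup>2 \<le> M0\<^sup>2 + c\<^sup>2"
        using bernoulli_level[OF t, of x] bounds(2)[OF \<Psi>_interior[OF t, of x]] P by simp
      also have "\<dots> \<le> (M0 + c)\<^sup>2" using M0 c by (simp add: power2_sum)
      finally show ?thesis by (rule power2_le_imp_le) (use M0 c in simp)
    qed
    show ?thesis
      by (rule continuous_le_on_closure[where S = "{0<..<1}" and f = "\<lambda>t. w1 (x, level x t)", unfolded cl, OF cont t])
         (use int in auto)
  qed
  then show ?thesis by (rule that)
qed

text \<open>Dominated convergence. The integrals are taken over open intervals because the integrand need not converge at the
  walls.\<close>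

lemma \<Psi>_upstream:
  obtains X :: "nat \<Rightarrow> real" where "filterlim X at_bot sequentially"
    "\<And>t. t \<in> {0..1} \<Longrightarrow> (\<lambda>n. \<Psi> (X n) t) \<longlonglongrightarrow> stream t"
proof -
  obtain b M where bM: "\<And>x t. x \<le> b \<Longrightarrow> t \<in> {0..1} \<Longrightarrow> w1 (x, level x t) \<le> M"
    using w1_bounded_upstream by blast
  define X where "X n = b - real n" for n
  have X: "filterlim X at_bot sequentially"
    unfolding filterlim_at_bot eventually_sequentially
  proof
    fix Z :: real
    obtain N :: nat where "b - Z \<le> real N" using real_arch_simple by blast
    then show "\<exists>N. \<forall>n\<ge>N. X n \<le> Z"
      by (intro exI[of _ N]) (auto simp: X_def)
  qed
  have "(\<lambda>n. \<Psi> (X n) t) \<longlonglongrightarrow> stream t" if t: "t \<in> {0..1}" for t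
  proof -
    have cont: "continuous_on {0..t} (\<lambda>s. w1 (x, level x s))" for x
      by (rule continuous_on_subset[OF continuous_on_slice(1)[OF continuous_on_strip[OF cont_w1]]]) (use t in auto)
    have "(\<lambda>n. integral {0<..<t} (\<lambda>s. w1 (X n, level (X n) s))) \<longlonglongrightarrow> integral {0<..<t} m"
    proof (rule dominated_convergence(2)[where h = "\<lambda>s. M"])
      show "(\<lambda>s. w1 (X n, level (X n) s)) integrable_on {0<..<t}" for n
        using integrable_continuous_real[OF cont] by (simp add: integrable_on_open_interval_real)
      show "(\<lambda>s. M) integrable_on {0<..<t}"
        by (simp add: integrable_on_open_interval_real integrable_const_ivl)
      show "norm (w1 (X n, level (X n) s)) \<le> M" if "s \<in> {0<..<t}" for n s
      proof -
        have "s \<in> {0..1}" using that t by auto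
        moreover have "0 < w1 (X n, level (X n) s)" by (rule w1_pos[OF level_in_closure[OF \<open>s \<in> {0..1}\<close>]])
        ultimately show ?thesis using bM[of "X n" s] by (simp add: X_def)
      qed
      show "(\<lambda>n. w1 (X n, level (X n) s)) \<longlonglongrightarrow> m s" if "s \<in> {0<..<t}" for s
        by (rule w1_tendsto[OF X level_tendsto[OF X tendsto_const]]) (use that t in auto)
    qed
    then have "(\<lambda>n. integral {0..t} (\<lambda>s. w1 (X n, level (X n) s))) \<longlonglongrightarrow> integral {0..t} m"
      by (simp add: integral_open_interval_real)
    from tendsto_mult[OF filterlim_compose[OF gap_upstream X] this]
    show ?thesis by (simp add: \<Psi>_def stream_def)
  qed
  with X show ?thesis by (rule that)
qed

lemma total_flux: "total_flux = flux m"
proof -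
  obtain X :: "nat \<Rightarrow> real" where "\<And>t. t \<in> {0..1} \<Longrightarrow> (\<lambda>n. \<Psi> (X n) t) \<longlonglongrightarrow> stream t"
    using \<Psi>_upstream by metis
  from this[of 1] have "(\<lambda>n::nat. total_flux) \<longlonglongrightarrow> flux m" by (simp add: \<Psi>_1 stream_1)
  then show ?thesis by (simp add: LIMSEQ_const_iff)
qed

text \<open>Follow the streamline with stream function value \<open>stream \<tau>\<close> upstream. By monotonicity of \<open>\<Psi>\<close> it tends to height
  \<open>\<tau>\<close>, so \<open>w1\<close> tends to \<open>m \<tau>\<close> on it, and the Bernoulli quantity forces the pressure to converge. The limit of the
  pressure is the same for all streamlines.\<close>

lemma bernoulli_on_stream:
  obtains P where "\<And>\<tau>. \<tau> \<in> {0<..<1} \<Longrightarrow> bernoulli_on (stream \<tau>) = P + (m \<tau>)\<^sup>2 / 2"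
proof -
  obtain X :: "nat \<Rightarrow> real" where X: "filterlim X at_bot sequentially"
    and lim: "\<And>t. t \<in> {0..1} \<Longrightarrow> (\<lambda>n. \<Psi> (X n) t) \<longlonglongrightarrow> stream t"
    using \<Psi>_upstream by metis
  have P: "(\<lambda>n. pressure (X n)) \<longlonglongrightarrow> bernoulli_on (stream \<tau>) - (m \<tau>)\<^sup>2 / 2" if \<tau>: "\<tau> \<in> {0<..<1}" for \<tau>
  proof -
    have z: "stream \<tau> \<in> {0<..<total_flux}"
      using stream_strict_mono[of 0 \<tau>] stream_strict_mono[of \<tau> 1] \<tau> by (auto simp: stream_0 stream_1 total_flux)
    then have z': "stream \<tau> \<in> {0..total_flux}" by auto
    define T where "T n = fibre_inverse \<Psi> (X n) (stream \<tau>)" for n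
    have T: "T n \<in> {0..1}" "\<Psi> (X n) (T n) = stream \<tau>" for n
      unfolding T_def by (rule fibre_in[OF z'], rule \<Psi>_fibre_inverse[OF z'])
    have "T \<longlonglongrightarrow> \<tau>"
    proof (rule order_tendstoI)
      fix a assume "a < \<tau>"
      define r where "r = max 0 a"
      have r: "r \<in> {0..1}" "r < \<tau>" using \<open>a < \<tau>\<close> \<tau> by (auto simp: r_def)
      then have "stream r < stream \<tau>" using \<tau> by (intro stream_strict_mono) auto
      from order_tendstoD(2)[OF lim[OF r(1)] this]
      show "\<forall>\<^sub>F n in sequentially. a < T n"
      proof eventually_elim
        case (elim n)
        then have "r < T n" using \<Psi>_less_iff[OF r(1) T(1), of "X n" n] T(2)[of n] by simp
        then show ?case by (simp add: r_def)
      qed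
    next
      fix a assume "\<tau> < a"
      define r where "r = min 1 a"
      have r: "r \<in> {0..1}" "\<tau> < r" using \<open>\<tau> < a\<close> \<tau> by (auto simp: r_def)
      then have "stream \<tau> < stream r" using \<tau> by (intro stream_strict_mono) auto
      from order_tendstoD(1)[OF lim[OF r(1)] this]
      show "\<forall>\<^sub>F n in sequentially. T n < a"
      proof eventually_elim
        case (elim n)
        then have "T n < r" using \<Psi>_less_iff[OF T(1) r(1), of "X n" n] T(2)[of n] by simp
        then show ?case by (simp add: r_def)
      qed
    qed
    from w1_tendsto[OF X level_tendsto[OF X this] \<tau>]
    have "(\<lambda>n. bernoulli_on (stream \<tau>) - (w1 (X n, level (X n) (T n)))\<^sup>2 / 2) \<longlonglongrightarrow> bernoulli_on (stream \<tau>) - (m \<tau>)\<^sup>2 / 2"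
      by (intro tendsto_intros) auto
    moreover have "bernoulli_on (stream \<tau>) - (w1 (X n, level (X n) (T n)))\<^sup>2 / 2 = pressure (X n)" for n
      using bernoulli[OF z, of "X n"] by (simp add: bernoulli_on_def streamline_def T_def)
    ultimately show ?thesis by simp
  qed
  have half: "(1 / 2 :: real) \<in> {0<..<1}" by simp
  show ?thesis
  proof (rule that)
    fix \<tau> :: real assume \<tau>: "\<tau> \<in> {0<..<1}"
    from LIMSEQ_unique[OF P[OF \<tau>] P[OF half]]
    show "bernoulli_on (stream \<tau>) = (bernoulli_on (stream (1 / 2)) - (m (1 / 2))\<^sup>2 / 2) + (m \<tau>)\<^sup>2 / 2" by simp
  qed
qed

text \<open>In a fixed section let \<open>\<tau> t\<close> be the upstream label of the streamline at relative height \<open>t\<close>. The Bernoulli quantity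
  gives \<open>w1 = speed l (\<tau> t)\<close> with \<open>l\<close> depending on the section only. By conservation of flux, \<open>height l (\<tau> t)\<close> has the
  constant derivative \<open>gap x\<close>. So \<open>width l = gap x\<close>, which determines \<open>l\<close> and then the label of every point.\<close>

lemma w1_unique:
  obtains P where "\<And>x. pressure x = P - lam x / 2" "\<And>x t. t \<in> {0..1} \<Longrightarrow> w1 (x, level x t) = v1 (x, level x t)"
proof -
  obtain P where P: "\<And>\<tau>. \<tau> \<in> {0<..<1} \<Longrightarrow> bernoulli_on (stream \<tau>) = P + (m \<tau>)\<^sup>2 / 2"
    using bernoulli_on_stream by blast
  have "pressure x = P - lam x / 2 \<and> (\<forall>t\<in>{0..1}. w1 (x, level x t) = v1 (x, level x t))" for x
  proof -
    define l where "l = 2 * (P - pressure x)"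
    define \<tau> where "\<tau> t = kappa m (\<Psi> x t)" for t
    have range: "\<Psi> x t \<in> {0..flux m}" if "t \<in> {0..1}" for t
      using \<Psi>_range[OF that] by (simp add: total_flux)
    have \<tau>: "\<tau> t \<in> {0..1}" "stream (\<tau> t) = \<Psi> x t" if "t \<in> {0..1}" for t
      unfolding \<tau>_def by (rule kappa_in[OF range[OF that]], rule stream_kappa[OF range[OF that]])
    have \<tau>_int: "\<tau> t \<in> {0<..<1}" if "t \<in> {0<..<1}" for t
    proof -
      have "\<tau> t \<in> {0..1}" "stream (\<tau> t) \<in> {0<..<flux m}" using \<tau>[of t] \<Psi>_interior[OF that, of x] that by (auto simp: total_flux)
      moreover from this have "\<tau> t \<noteq> 0" "\<tau> t \<noteq> 1" by (auto simp: stream_0 stream_1)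
      ultimately show ?thesis by auto
    qed
    have \<Psi>c: "continuous_on {0..1} (\<Psi> x)" using continuous_on_slice(1)[OF cont_\<Psi>] by simp
    have \<tau>c: "continuous_on {0..1} \<tau>"
      unfolding \<tau>_def[abs_def] by (rule continuous_on_compose2[OF continuous_on_kappa \<Psi>c]) (use range in auto)
    have wc: "continuous_on {0..1} (\<lambda>t. w1 (x, level x t))"
      using continuous_on_slice(1)[OF continuous_on_strip[OF cont_w1], of x] by simp
    have pos: "0 < w1 (x, level x t)" if "t \<in> {0..1}" for t by (rule w1_pos[OF level_in_closure[OF that]])
    \<comment> \<open>The wall streamlines are reached by continuity.\<close>
    have sq: "(w1 (x, level x t))\<^sup>2 = (m (\<tau> t))\<^sup>2 + l" if t: "t \<in> {0..1}" for t
    proof -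
      have cl: "closure {0<..<1} = {0..1::real}" by simp
      have c: "continuous_on {0..1} (\<lambda>t. (w1 (x, level x t))\<^sup>2 - (m (\<tau> t))\<^sup>2)"
        by (intro continuous_intros wc continuous_on_compose2[OF cont_m \<tau>c]) (use \<tau>(1) in auto)
      have "(w1 (x, level x t))\<^sup>2 - (m (\<tau> t))\<^sup>2 = l" if t: "t \<in> {0<..<1}" for t
        using bernoulli_level[OF t, of x] P[OF \<tau>_int[OF t]] \<tau>(2)[of t] t by (simp add: l_def)
      then have "(w1 (x, level x t))\<^sup>2 - (m (\<tau> t))\<^sup>2 = l"
        by (intro continuous_constant_on_closure[where S = "{0<..<1}" and f = "\<lambda>t. (w1 (x, level x t))\<^sup>2 - (m (\<tau> t))\<^sup>2", unfolded cl, OF c _ t])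
      then show ?thesis by simp
    qed
    have l: "l \<in> heads"
      unfolding heads_def
    proof (intro CollectI ballI)
      fix r :: real assume r: "r \<in> {0..1}"
      have z: "stream r \<in> {0..total_flux}" using stream_image r by (auto simp: total_flux)
      define t where "t = fibre_inverse \<Psi> x (stream r)"
      have t: "t \<in> {0..1}" "\<Psi> x t = stream r"
        unfolding t_def by (rule fibre_in[OF z], rule \<Psi>_fibre_inverse[OF z])
      have "\<tau> t = r" using kappa_stream[OF r] by (simp add: \<tau>_def t(2))
      then show "0 < (m r)\<^sup>2 + l" using sq[OF t(1)] pos[OF t(1)] by (metis zero_less_power)
    qed
    have w_eq: "w1 (x, level x t) = speed l (\<tau> t)" if t: "t \<in> {0..1}" for t
      using sq[OF t] pos[OF t] by (simp add: speed_def real_sqrt_unique less_imp_le)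
    have height: "height l (\<tau> t) = gap x * t" if t: "t \<in> {0..1}" for t
    proof -
      have "((\<lambda>t. height l (\<tau> t) - gap x * t) has_real_derivative 0) (at t within {0..1})" if t: "t \<in> {0..1}" for t
      proof -
        have "(kappa m has_real_derivative 1 / m (\<tau> t)) (at (\<Psi> x t) within \<Psi> x ` {0..1})"
          using kappa_DERIV[OF \<tau>(1)[OF t]] \<tau>(2)[OF t] range by (auto intro: DERIV_subset)
        from DERIV_image_chain[OF this \<Psi>_DERIV_t[OF t]]
        have "(\<tau> has_real_derivative 1 / m (\<tau> t) * (gap x * w1 (x, level x t))) (at t within {0..1})"
          by (simp add: \<tau>_def[abs_def] o_def)
        moreover have "(height l has_real_derivative m (\<tau> t) / speed l (\<tau> t)) (at (\<tau> t) within \<tau> ` {0..1})"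
          using height_DERIV(1)[OF l \<tau>(1)[OF t]] \<tau>(1) by (auto intro: DERIV_subset)
        ultimately have "((\<lambda>t. height l (\<tau> t)) has_real_derivative gap x) (at t within {0..1})"
          using DERIV_image_chain[of "height l" "m (\<tau> t) / speed l (\<tau> t)" \<tau> t "{0..1}"]
            m_pos[OF \<tau>(1)[OF t]] speed_pos[OF l \<tau>(1)[OF t]] w_eq[OF t] by (fastforce simp: o_def)
        then show ?thesis by (auto intro!: derivative_eq_intros)
      qed
      from has_field_derivative_zero_constant[OF convex_real_interval(5) this]
      obtain c where c: "\<And>t. t \<in> {0..1} \<Longrightarrow> height l (\<tau> t) - gap x * t = c" by auto
      have "\<tau> 0 = 0" using kappa_stream[of 0] by (simp add: \<tau>_def \<Psi>_0 stream_0)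
      then have "c = 0" using c[of 0] by (simp add: height_0)
      with c[OF t] show ?thesis by simp
    qed
    have "\<tau> 1 = 1" using kappa_stream[of 1] by (simp add: \<tau>_def \<Psi>_1 stream_1 total_flux)
    then have "width l = gap x" using height[of 1] by (simp add: width_def)
    then have lam: "lam x = l" using head_width[OF l] by (simp add: lam_def gap_def)
    have "w1 (x, level x t) = v1 (x, level x t)" if t: "t \<in> {0..1}" for t
    proof -
      have "label l (gap x * t) = \<tau> t"
        using label_height[OF l \<tau>(1)[OF t]] height[OF t] by simp
      then show ?thesis
        using w_eq[OF t] by (simp add: v1_def velocity_def lam level_def mult.commute)
    qed
    moreover have "pressure x = P - lam x / 2" by (simp add: lam l_def diff_divide_distrib)
    ultimately show ?thesis by blast
  qed
  then show ?thesis by (intro that[of P]) auto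
qed

text \<open>Once the horizontal velocities agree, incompressibility shows that the vertical velocities differ by a constant on
  every section, and the constant is \<open>0\<close> on the lower wall.\<close>

lemma flow_unique:
  shows "z \<in> closure \<Omega> \<Longrightarrow> (w1 z, w2 z) = v z"
    and "\<exists>k. \<forall>z\<in>closure \<Omega>. q z = p z + k"
proof -
  obtain P where P: "\<And>x. pressure x = P - lam x / 2"
    and w: "\<And>x t. t \<in> {0..1} \<Longrightarrow> w1 (x, level x t) = v1 (x, level x t)"
    using w1_unique by blast
  have w1: "w1 (x, y) = v1 (x, y)" if "(x, y) \<in> closure \<Omega>" for x y
  proof -
    have "level x ((y - s0 x) / gap x) = y" using gap_pos[of x] by (simp add: level_def)
    moreover have "(y - s0 x) / gap x \<in> {0..1}"
      using that gap_pos[of x] by (auto simp: closure_nozzle gap_def)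
    ultimately show ?thesis using w[of "(y - s0 x) / gap x" x] by simp
  qed
  have D1: "D1 (x, y) = lam' x / (2 * v1 (x, y)) - vorticity (x, y) * slope (x, y)" if xy: "(x, y) \<in> \<Omega>" for x y
  proof -
    have "open ((\<lambda>t. (t, y)) -` \<Omega>)"
      by (rule open_vimage[OF open_nozzle]) (auto intro: continuous_intros)
    then have "((\<lambda>t. v1 (t, y)) has_real_derivative D1 (x, y)) (at x)"
      by (rule has_field_derivative_transform_within_open[OF w1_DERIV_1[OF xy]])
         (use xy closure_subset w1 in auto)
    from DERIV_unique[OF this v1_DERIV_1[OF xy]] show ?thesis .
  qed
  have w2: "w2 (x, y) = v1 (x, y) * slope (x, y)" if xy: "(x, y) \<in> closure \<Omega>" for x y
  proof -
    define f where "f y = w2 (x, y) - v1 (x, y) * slope (x, y)" for y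
    have "f y = f (s0 x)"
    proof (rule DERIV_isconst2[of "s0 x" "s1 x"])
      have c: "continuous_on {s0 x..s1 x} (\<lambda>y. g (x, y))" if "continuous_on (closure \<Omega>) g" for g :: "real \<times> real \<Rightarrow> real"
        by (rule continuous_on_compose2[OF that]) (auto intro!: continuous_intros simp: closure_nozzle)
      show "continuous_on {s0 x..s1 x} f"
        unfolding f_def[abs_def] by (intro continuous_intros c cont_w2 cont_v1 cont_slope)
      fix y assume "s0 x < y" "y < s1 x"
      then have xy: "(x, y) \<in> \<Omega>" by (simp add: mem_nozzle)
      have "0 < v1 (x, y)" using v1_pos xy closure_subset by blast
      then show "(f has_real_derivative 0) (at y)"
        using DERIV_diff[OF w2_DERIV_2[OF xy] DERIV_mult'[OF v1_DERIV_2[OF xy] slope_DERIV_2[OF xy]]] D1[OF xy]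
        by (simp add: f_def[abs_def] power2_eq_square)
    qed (use s0_less_s1 xy in \<open>auto simp: closure_nozzle\<close>)
    also have "f (s0 x) = 0"
      using w1[of x "s0 x"] s0_less_s1[of x] by (simp add: f_def slip_lower slope_lower closure_nozzle)
    finally show ?thesis by (simp add: f_def)
  qed
  show "(w1 z, w2 z) = v z" if "z \<in> closure \<Omega>"
    using w1 w2 that by (cases z) (simp add: v_def)
  have "q z = p z + P" if "z \<in> closure \<Omega>" for z
    using q_eq_pressure that P by (cases z) (simp add: p_def)
  then show "\<exists>k. \<forall>z\<in>closure \<Omega>. q z = p z + k" by blast
qed

end

section \<open>Existence and uniqueness\<close>

lemma far_field_cong:
  "far_field w f I F \<Longrightarrow> (\<And>y. y \<in> I \<Longrightarrow> f y = g y) \<Longrightarrow> far_field w g I F"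
  unfolding far_field_def
proof (intro allI impI)
  fix K assume far: "\<forall>K. compact K \<and> K \<subseteq> I \<longrightarrow> uniform_limit K (\<lambda>x1 x2. w (x1, x2)) f F"
    and eq: "\<And>y. y \<in> I \<Longrightarrow> f y = g y" and K: "compact K \<and> K \<subseteq> I"
  have "uniform_limit K (\<lambda>x1 x2. w (x1, x2)) f F" using far K by blast
  moreover have "uniform_limit K (\<lambda>x1 x2. w (x1, x2)) f F \<longleftrightarrow> uniform_limit K (\<lambda>x1 x2. w (x1, x2)) g F"
    by (rule uniform_limit_cong') (use eq K in auto)
  ultimately show "uniform_limit K (\<lambda>x1 x2. w (x1, x2)) g F" by simp
qed

lemma far_field_fst:
  "far_field w (\<lambda>y. (f y, g y)) I F \<Longrightarrow> far_field (\<lambda>x. fst (w x)) f I F"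
  for w :: "real \<times> real \<Rightarrow> real \<times> real"
  unfolding far_field_def
  using bounded_linear.uniform_limit[OF bounded_linear_fst] by fastforce

lemma finite_C2_normD:
  assumes "C2_on UNIV s" "finite_C2_norm s"
  obtains s' s'' K where "\<And>x. (s has_real_derivative s' x) (at x)"
    "\<And>x. (s' has_real_derivative s'' x) (at x)" "\<And>x. \<bar>s'' x\<bar> \<le> K"
proof -
  obtain s' s'' where s: "\<And>x. (s has_real_derivative s' x) (at x)" "\<And>x. (s' has_real_derivative s'' x) (at x)"
    using assms(1) by (auto simp: C2_on_def)
  then have "deriv s = s'" "deriv s' = s''" by (auto intro!: ext DERIV_imp_deriv)
  then have "bounded (range s'')" using assms(2) by (simp add: finite_C2_norm_def)
  then obtain K where "\<And>x. \<bar>s'' x\<bar> \<le> K" by (auto simp: bounded_iff)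
  with s show ?thesis by (rule that)
qed

lemma C2_on_unit_intervalD:
  assumes "C2_on {0..1} u"
  obtains u' K where "\<And>t. t \<in> {0..1} \<Longrightarrow> (u has_real_derivative u' t) (at t within {0..1})"
    "\<And>s t. s \<in> {0..1} \<Longrightarrow> t \<in> {0..1} \<Longrightarrow> \<bar>u' s - u' t\<bar> \<le> K * \<bar>s - t\<bar>"
proof -
  obtain u' u'' where u: "\<And>t. t \<in> {0..1} \<Longrightarrow> (u has_real_derivative u' t) (at t within {0..1})"
    "\<And>t. t \<in> {0..1} \<Longrightarrow> (u' has_real_derivative u'' t) (at t within {0..1})" "continuous_on {0..1} u''"
    using assms unfolding C2_on_def by blast
  have "bounded (u'' ` {0..1})"
    by (rule compact_imp_bounded[OF compact_continuous_image[OF u(3) compact_Icc]])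
  then obtain K where K: "\<And>t. t \<in> {0..1} \<Longrightarrow> norm (u'' t) \<le> K"
    unfolding bounded_iff by blast
  have "\<bar>u' s - u' t\<bar> \<le> K * \<bar>s - t\<bar>" if "s \<in> {0..1}" "t \<in> {0..1}" for s t
    using field_differentiable_bound[OF convex_real_interval(5) u(2) K that] by simp
  with u(1) show ?thesis by (rule that)
qed

theorem theorem1p2:
  fixes s0 s1 v1m :: "real \<Rightarrow> real" and a \<sigma> :: real
  assumes "nozzle_conditions s0 s1 a \<sigma>"
    and "C2_on {0..1} v1m"
    and "\<forall>x2\<in>{0..1}. 0 < v1m x2"
    and "vector_derivative v1m (at 0 within {0..1}) \<le> 0"
    and "0 \<le> vector_derivative v1m (at 1 within {0..1})"
  shows "\<exists>\<phi> v p.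
    downstream_stream_fun v1m \<sigma> \<phi> \<and>
    (\<forall>\<psi>. downstream_stream_fun v1m \<sigma> \<psi> \<longrightarrow> (\<forall>t\<in>{0..1}. \<psi> t = \<phi> t)) \<and>
    admissible_solution s0 s1 v1m v p \<and>
    far_field (\<lambda>x. fst (v x)) v1m {0<..<1} at_bot \<and>
    far_field v (\<lambda>x2. (1 / \<sigma> * deriv \<phi> ((x2 - a) / \<sigma>), 0)) {a<..<a + \<sigma>} at_top \<and>
    (\<forall>w q. admissible_solution s0 s1 v1m w q \<longrightarrow>
       (\<forall>x\<in>closure (nozzle s0 s1). w x = v x) \<and>
       (\<exists>k. \<forall>x\<in>closure (nozzle s0 s1). q x = p x + k))"
proof -
  from assms(1) have C2: "C2_on UNIV s0" "finite_C2_norm s0" "C2_on UNIV s1" "finite_C2_norm s1"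
    and less: "\<And>x. s0 x < s1 x" and \<sigma>: "0 < \<sigma>"
    and bot: "((\<lambda>x. (s1 x, s0 x)) \<longlongrightarrow> (1, 0)) at_bot" and top: "((\<lambda>x. (s1 x, s0 x)) \<longlongrightarrow> (a + \<sigma>, a)) at_top"
    by (auto simp: nozzle_conditions_def)
  have lim: "(s0 \<longlongrightarrow> 0) at_bot" "(s1 \<longlongrightarrow> 0 + 1) at_bot" "(s0 \<longlongrightarrow> a) at_top" "(s1 \<longlongrightarrow> a + \<sigma>) at_top"
    using tendsto_fst[OF bot] tendsto_snd[OF bot] tendsto_fst[OF top] tendsto_snd[OF top] by simp_all
  obtain s0' s0'' K0 where s0: "\<And>x. (s0 has_real_derivative s0' x) (at x)"
    "\<And>x. (s0' has_real_derivative s0'' x) (at x)" "\<And>x. \<bar>s0'' x\<bar> \<le> K0"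
    using finite_C2_normD[OF C2(1,2)] by metis
  obtain s1' s1'' K1 where s1: "\<And>x. (s1 has_real_derivative s1' x) (at x)"
    "\<And>x. (s1' has_real_derivative s1'' x) (at x)" "\<And>x. \<bar>s1'' x\<bar> \<le> K1"
    using finite_C2_normD[OF C2(3,4)] by metis
  have slopes: "(s0' \<longlongrightarrow> 0) at_bot" "(s0' \<longlongrightarrow> 0) at_top" "(s1' \<longlongrightarrow> 0) at_bot" "(s1' \<longlongrightarrow> 0) at_top"
    using derivative_tendsto_0[OF _ s0 lim(1)] derivative_tendsto_0[OF _ s0 lim(3)]
      derivative_tendsto_0[OF _ s1 lim(2)] derivative_tendsto_0[OF _ s1 lim(4)] by simp_all
  obtain m' K where m': "\<And>t. t \<in> {0..1} \<Longrightarrow> (v1m has_real_derivative m' t) (at t within {0..1})"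
    "\<And>s t. s \<in> {0..1} \<Longrightarrow> t \<in> {0..1} \<Longrightarrow> \<bar>m' s - m' t\<bar> \<le> K * \<bar>s - t\<bar>"
    using C2_on_unit_intervalD[OF assms(2)] by metis
  have vd: "vector_derivative v1m (at t within {0..1}) = m' t" if "t \<in> {0..1}" for t
    using m'(1)[OF that] that
    by (intro vector_derivative_within_closed_interval) (auto simp: has_real_derivative_iff_has_vector_derivative)
  interpret nozzle_inflow s0 s1 s0' s1' v1m m' K
  proof unfold_locales
    show "continuous_on UNIV s0'" "continuous_on UNIV s1'"
      using s0(2) s1(2) by (auto intro!: continuous_at_imp_continuous_on DERIV_isCont)
    show "m' 0 \<le> 0" "0 \<le> m' 1" using assms(4,5) vd by simp_all
  qed (use s0(1) s1(1) less m' assms(3) in auto)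
  have far_bot: "far_field v (\<lambda>y. (v1m y, 0)) {0<..<1} at_bot"
  proof -
    have "head_of_width 1 = 0" using head_width[OF zero_in_heads] by (simp add: width_0)
    with v_far_field[OF lim(1,2) slopes(1,3)] have "far_field v (\<lambda>y. (velocity 0 (y - 0), 0)) {0<..<1} at_bot"
      by simp
    then show ?thesis by (rule far_field_cong) (simp add: velocity_0)
  qed
  have far_top: "far_field v (\<lambda>y. (1 / \<sigma> * deriv (downstream \<sigma>) ((y - a) / \<sigma>), 0)) {a<..<a + \<sigma>} at_top"
    using v_far_field[OF lim(3,4) slopes(2,4) \<sigma>]
  proof (rule far_field_cong)
    fix y assume "y \<in> {a<..<a + \<sigma>}"
    then have "(y - a) / \<sigma> \<in> {0<..<1}" using \<sigma> by (auto simp: field_simps)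
    from deriv_downstream[OF \<sigma> this] \<sigma>
    show "(velocity (head_of_width \<sigma>) (y - a), 0) = (1 / \<sigma> * deriv (downstream \<sigma>) ((y - a) / \<sigma>), 0::real)" by simp
  qed
  have unique: "(\<forall>x\<in>closure (nozzle s0 s1). w x = v x) \<and> (\<exists>k. \<forall>x\<in>closure (nozzle s0 s1). q x = p x + k)"
    if adm: "admissible_solution s0 s1 v1m w q" for w q
  proof -
    define \<Omega> where "\<Omega> = nozzle s0 s1"
    from adm have hyd: "hydrostatic_Euler_solution \<Omega> w q" and slip: "slip_condition s0 s1 w"
      and pos: "\<And>x. x \<in> closure \<Omega> \<Longrightarrow> 0 < fst (w x)" and far: "far_field w (\<lambda>y. (v1m y, 0)) {0<..<1} at_bot"
      by (auto simp: admissible_solution_def \<Omega>_def)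
    from hyd obtain D1 D2 E2 P1 P2 where cont: "continuous_on (closure \<Omega>) w" "continuous_on (closure \<Omega>) q"
      and part: "has_cont_partial1 \<Omega> (\<lambda>x. fst (w x)) D1" "has_cont_partial2 \<Omega> (\<lambda>x. fst (w x)) D2"
        "has_cont_partial2 \<Omega> (\<lambda>x. snd (w x)) E2" "has_cont_partial1 \<Omega> q P1" "has_cont_partial2 \<Omega> q P2"
      and eq: "\<And>x. x \<in> \<Omega> \<Longrightarrow> fst (w x) * D1 x + snd (w x) * D2 x = - P1 x \<and> 0 = - P2 x \<and> D1 x + E2 x = 0"
      unfolding hydrostatic_Euler_solution_def by blast
    have E2: "E2 x = - D1 x" and P1: "P1 x = - (fst (w x) * D1 x + snd (w x) * D2 x)" and P2: "P2 x = 0" if "x \<in> \<Omega>" for x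
      using eq[OF that] by auto
    interpret U: upstream_flow s0 s1 s0' s1' v1m m' K "\<lambda>x. fst (w x)" "\<lambda>x. snd (w x)" q D1 D2
    proof unfold_locales
      show "continuous_on (closure (nozzle s0 s1)) (\<lambda>x. fst (w x))" "continuous_on (closure (nozzle s0 s1)) (\<lambda>x. snd (w x))"
        "continuous_on (closure (nozzle s0 s1)) q" "continuous_on (closure (nozzle s0 s1)) D1" "continuous_on (closure (nozzle s0 s1)) D2"
        using cont part by (auto simp: \<Omega>_def has_cont_partial1_def has_cont_partial2_def intro: continuous_intros)
      fix x y :: real assume xy: "(x, y) \<in> nozzle s0 s1"
      then have xy': "(x, y) \<in> \<Omega>" by (simp add: \<Omega>_def)
      show "((\<lambda>t. fst (w (t, y))) has_real_derivative D1 (x, y)) (at x)"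
        "((\<lambda>t. fst (w (x, t))) has_real_derivative D2 (x, y)) (at y)"
        "((\<lambda>t. snd (w (x, t))) has_real_derivative - D1 (x, y)) (at y)"
        "((\<lambda>t. q (t, y)) has_real_derivative - (fst (w (x, y)) * D1 (x, y) + snd (w (x, y)) * D2 (x, y))) (at x)"
        "((\<lambda>t. q (x, t)) has_real_derivative 0) (at y)"
        using part xy' E2[OF xy'] P1[OF xy'] P2[OF xy'] by (fastforce simp: has_cont_partial1_def has_cont_partial2_def)+
    next
      show "snd (w (x, s0 x)) = fst (w (x, s0 x)) * s0' x" "snd (w (x, s1 x)) = fst (w (x, s1 x)) * s1' x" for x
        using slip by (simp_all add: slip_condition_iff)
      show "0 < fst (w z)" if "z \<in> closure (nozzle s0 s1)" for z using pos that by (simp add: \<Omega>_def)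
      show "(s0 \<longlongrightarrow> 0) at_bot" "(s1 \<longlongrightarrow> 1) at_bot" using lim by simp_all
      show "far_field (\<lambda>x. fst (w x)) v1m {0<..<1} at_bot" by (rule far_field_fst[OF far])
    qed
    show ?thesis using U.flow_unique by simp
  qed
  have "admissible_solution s0 s1 v1m v p"
    using v_solution v_slip v1_pos far_bot by (simp add: admissible_solution_def v_def)
  with downstream_stream_fun_downstream[OF \<sigma>] downstream_unique[OF \<sigma>] far_field_fst[OF far_bot] far_top unique
  show ?thesis by blast
qed

end
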